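(* Let $Q(x,y,z)$ be a real non-degenerate quadratic form. (1) The space $V(d;\mathbb R)$ of real homogeneous polynomials of degree $d$ admits an $O_Q(3;\mathbb R)$-invariant decomposition $$V(d;\mathbb R)=\bigoplus_{d-2k\ge0}Q^k\cdot Har_Q(d-2k;\mathbb R).$$ The summands are orthogonal with respect to the inner product $\langle f,g\rangle^{\mathbb R}=\mathsf{Re}\int_{\Upsilon_Q}f\cdot\bar g\,dm_Q$. (2) Any (real) polynomial function $F$ on the surface $\mathcal S^{\mathbb R}=\{Q(x,y,z)=const\}\subset\mathbb R^3$ can be obtained by restricting to $\mathcal S^{\mathbb R}$ a real polynomial $P$ with $\Delta_Q(P)=0$. (3) For any two real polynomials $M$ and $N$, the Dirichlet problem $$\Delta_Q(P)=M,\qquad P|_{\mathcal S^{\mathbb R}}=N|_{\mathcal S^{\mathbb R}}$$ has a unique real polynomial solution $P$. (4) Any real homogeneous polynomial $P$ of degree $d$ admits the Maxwell-type representation $$P(x,y,z)=\mathsf{Re}\Big\{\sum_{d-2k\ge0}Q(x,y,z)^{d-k+\frac12}\cdot\nabla_{\mathbf u_{1,k}}\nabla_{\mathbf u_{2,k}}\cdots\nabla_{\mathbf u_{d-2k,k}}\Big(Q(x,y,z)^{-\frac12}\Big)\Big\},$$ where $\mathbf u_{j,k}$ are complex 3-vectors and, for even $d$, the term with $k=d/2$ is understood as $\lambda\,Q^{d/2}$ with a scalar $\lambda$. If $Q$ is positive-definite, these vectors (and $\lambda$) can be taken real, and the representation by real vectors is unique, up to reordering and rescaling of the vectors in each term.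
   Context: Write $Q(v)=vBv^T$ for row vectors $v=(x,y,z)$ with $B$ real symmetric invertible, and choose an invertible complex matrix $A$ with $B=AA^T$. $\Delta_Q=\sum_{j,k}b^{jk}\partial_j\partial_k$, where $(b^{jk})=B^{-1}$. $Har_Q(d;\mathbb R)=Ker(\Delta_Q)\cap V(d;\mathbb R)$. $O_Q(3;\mathbb R)$ is the subgroup of $GL(3;\mathbb R)$ preserving $Q$, acting on polynomials by substitution. $\Upsilon_Q=\{v\in\mathbb C^3:vA\in\mathbb R^3,\ |vA|=1\}$, and $dm_Q$ is the pull-back under $v\mapsto vA$ of the standard measure on the unit sphere. $\mathcal S^{\mathbb R}$ is assumed to be a genuine (two-dimensional) real surface. $\nabla_{\mathbf u}$ is the directional derivative along $\mathbf u\in\mathbb C^3$; $x,y,z$ are real in (4), and the same branch of $Q^{1/2}$ is used in both occurrences, so the choice of sign cancels.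
   Formalization: In (4), uniqueness up to reordering and rescaling is claimed for nonvanishing terms; if a term vanishes, both families contain a zero vector and the other vectors are arbitrary (P=0, d=2: (0,e1) and (0,e2) both represent it). *)

theory Defs
  imports "HOL-Analysis.Analysis" "HOL-Library.Poly_Mapping"
begin


section \<open>Real polynomials in three variables\<close>

text \<open>A polynomial is a finitely supported map from exponent vectors to coefficients; the ring
  structure is the one of \<^theory>\<open>HOL-Library.Poly_Mapping\<close>. Real points and complex
  points are row vectors in \<^typ>\<open>real^3\<close> and \<^typ>\<open>complex^3\<close>.\<close>

type_synonym rpoly = "(3 \<Rightarrow>\<^sub>0 nat) \<Rightarrow>\<^sub>0 real"

definition Const :: "real \<Rightarrow> rpoly" where
  "Const c = Poly_Mapping.single 0 c"

definition Var :: "3 \<Rightarrow> rpoly" where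
  "Var i = Poly_Mapping.single (Poly_Mapping.single i 1) 1"

global_interpretation rpoly: vector_space "\<lambda>c p. Const c * p"
proof unfold_locales
  fix a b :: real and x y :: rpoly
  show "Const a * (x + y) = Const a * x + Const a * y"
    by (simp add: distrib_left)
  show "Const (a + b) * x = Const a * x + Const b * x"
    by (simp add: Const_def single_add distrib_right)
  show "Const a * (Const b * x) = Const (a * b) * x"
    by (simp add: Const_def mult_single flip: mult.assoc)
  show "Const 1 * x = x"
    by (simp add: Const_def)
qed

text \<open>Evaluation at \<open>x\<close>, with coefficients mapped by \<open>h\<close>.\<close>

definition peval :: "(real \<Rightarrow> 'a::comm_semiring_1) \<Rightarrow> (3 \<Rightarrow> 'a) \<Rightarrow> rpoly \<Rightarrow> 'a" where
  "peval h x p =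
     (\<Sum>m\<in>Poly_Mapping.keys p. h (Poly_Mapping.lookup p m) * (\<Prod>i\<in>UNIV. x i ^ Poly_Mapping.lookup m i))"

definition reval :: "rpoly \<Rightarrow> real^3 \<Rightarrow> real" where
  "reval p v = peval id (\<lambda>i. v $ i) p"

definition ceval :: "rpoly \<Rightarrow> complex^3 \<Rightarrow> complex" where
  "ceval p v = peval of_real (\<lambda>i. v $ i) p"

text \<open>The polynomial \<open>v \<mapsto> p (v v* g)\<close>.\<close>

definition psubst :: "real^3^3 \<Rightarrow> rpoly \<Rightarrow> rpoly" where
  "psubst g p = peval Const (\<lambda>i. \<Sum>j\<in>UNIV. Const (g $ j $ i) * Var j) p"

text \<open>Formal partial derivative. The exponent subtraction truncates at \<open>0\<close>, but then the
  coefficient is \<open>0\<close>.\<close>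

definition pd :: "3 \<Rightarrow> rpoly \<Rightarrow> rpoly" where
  "pd i p = (\<Sum>m\<in>Poly_Mapping.keys p.
     Poly_Mapping.single (m - Poly_Mapping.single i 1)
       (of_nat (Poly_Mapping.lookup m i) * Poly_Mapping.lookup p m))"

definition homog :: "nat \<Rightarrow> rpoly set" where
  "homog d = {p. \<forall>m\<in>Poly_Mapping.keys p. (\<Sum>i\<in>UNIV. Poly_Mapping.lookup m i) = d}"

definition internal_direct_sum :: "rpoly set \<Rightarrow> nat set \<Rightarrow> (nat \<Rightarrow> rpoly set) \<Rightarrow> bool" where
  "internal_direct_sum V K W \<longleftrightarrow>
     rpoly.subspace V \<and>
     (\<forall>k\<in>K. rpoly.subspace (W k) \<and> W k \<subseteq> V) \<and>
     (\<forall>p\<in>V. \<exists>!h. h \<in> (\<Pi>\<^sub>E k\<in>K. W k) \<and> p = (\<Sum>k\<in>K. h k))"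


section \<open>Quadratic form, Laplacian and harmonic polynomials\<close>

definition Qpoly :: "real^3^3 \<Rightarrow> rpoly" where
  "Qpoly B = (\<Sum>j\<in>UNIV. \<Sum>k\<in>UNIV. Const (B $ j $ k) * Var j * Var k)"

definition Laplace :: "real^3^3 \<Rightarrow> rpoly \<Rightarrow> rpoly" where
  "Laplace B p = (\<Sum>j\<in>UNIV. \<Sum>k\<in>UNIV. Const (matrix_inv B $ j $ k) * pd j (pd k p))"

definition Har :: "real^3^3 \<Rightarrow> nat \<Rightarrow> rpoly set" where
  "Har B d = {p \<in> homog d. Laplace B p = 0}"

text \<open>For \<open>2 * k \<le> d\<close> this is \<open>Q\<^sup>k \<cdot> Har\<^sub>Q(d - 2k)\<close>.\<close>

definition har_summand :: "real^3^3 \<Rightarrow> nat \<Rightarrow> nat \<Rightarrow> rpoly set" where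
  "har_summand B d k = (\<lambda>h. Qpoly B ^ k * h) ` Har B (d - 2 * k)"

definition orth_group :: "real^3^3 \<Rightarrow> (real^3^3) set" where
  "orth_group B = {g. invertible g \<and> (\<forall>v. reval (Qpoly B) (v v* g) = reval (Qpoly B) v)}"

definition pos_definite :: "real^3^3 \<Rightarrow> bool" where
  "pos_definite B \<longleftrightarrow> (\<forall>v. v \<noteq> 0 \<longrightarrow> reval (Qpoly B) v > 0)"


section \<open>The inner product\<close>

definition cvec :: "real^3 \<Rightarrow> complex^3" where
  "cvec w = (\<chi> i. of_real (w $ i))"

definition Upsilon :: "complex^3^3 \<Rightarrow> (complex^3) set" where
  "Upsilon A = {v. (\<exists>w. v v* A = cvec w) \<and> norm (v v* A) = 1}"

text \<open>Surface area of the unit sphere: by integration in polar coordinates, a set \<open>E\<close> on the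
  sphere has area three times the volume of the cone \<open>{t x | x \<in> E, 0 < t < 1}\<close> over it.
  (The origin, which the radial projection does not send to the sphere, is a null set.)\<close>

definition sphere_measure :: "(real^3) measure" where
  "sphere_measure =
     distr (density lborel (\<lambda>x. 3 * indicator (ball 0 1) x)) borel (\<lambda>x. x /\<^sub>R norm x)"

text \<open>The pull-back under the bijection \<open>v \<mapsto> v v* A\<close> from \<open>Upsilon A\<close> to the unit sphere is the
  push-forward under its inverse.\<close>

definition Upsilon_measure :: "complex^3^3 \<Rightarrow> (complex^3) measure" where
  "Upsilon_measure A = distr sphere_measure borel (\<lambda>w. cvec w v* matrix_inv A)"

definition Upsilon_inner :: "complex^3^3 \<Rightarrow> rpoly \<Rightarrow> rpoly \<Rightarrow> real" where
  "Upsilon_inner A f g =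
     Re (set_lebesgue_integral (Upsilon_measure A) (Upsilon A) (\<lambda>v. ceval f v * cnj (ceval g v)))"


section \<open>Level surfaces\<close>

definition level_set :: "real^3^3 \<Rightarrow> real \<Rightarrow> (real^3) set" where
  "level_set B c = {v. reval (Qpoly B) v = c}"

text \<open>Some nonempty relatively open part is a topological surface patch. For level sets of a
  non-degenerate quadratic form this excludes the empty set and the single point \<open>{0}\<close>, while it
  admits the cone \<open>Q = 0\<close> of an indefinite form in spite of its singular vertex.\<close>

definition two_dimensional :: "(real^3) set \<Rightarrow> bool" where
  "two_dimensional S \<longleftrightarrow>
     (\<exists>U (W :: (real^2) set). openin (top_of_set S) U \<and> U \<noteq> {} \<and> open W \<and> U homeomorphic W)"


section \<open>Maxwell-type representations\<close>

text \<open>Directional derivative, extended complex-linearly to complex directions.\<close>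

definition nabla :: "complex^3 \<Rightarrow> (real^3 \<Rightarrow> complex) \<Rightarrow> real^3 \<Rightarrow> complex" where
  "nabla u f v =
     vector_derivative (\<lambda>t. f (v + t *\<^sub>R (\<chi> i. Re (u $ i)))) (at 0) +
     \<i> * vector_derivative (\<lambda>t. f (v + t *\<^sub>R (\<chi> i. Im (u $ i)))) (at 0)"

definition sqrt_branch :: "real^3^3 \<Rightarrow> (real^3 \<Rightarrow> complex) \<Rightarrow> bool" where
  "sqrt_branch B s \<longleftrightarrow>
     continuous_on {v. reval (Qpoly B) v \<noteq> 0} s \<and>
     (\<forall>v. reval (Qpoly B) v \<noteq> 0 \<longrightarrow> (s v)\<^sup>2 = of_real (reval (Qpoly B) v))"

text \<open>With \<open>s = Q\<^sup>1\<^sup>/\<^sup>2\<close>, the factor \<open>Q ^ (d - k) * s\<close> is \<open>Q\<close> to the power \<open>d - k + 1/2\<close>.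
  The directions of the \<open>k\<close>-th term are \<open>u k 1, \<dots>, u k (d - 2 * k)\<close>.\<close>

definition maxwell_term ::
  "real^3^3 \<Rightarrow> (real^3 \<Rightarrow> complex) \<Rightarrow> nat \<Rightarrow> (nat \<Rightarrow> nat \<Rightarrow> complex^3) \<Rightarrow> complex \<Rightarrow> nat \<Rightarrow> real^3 \<Rightarrow> complex"
where
  "maxwell_term B s d u \<mu> k v =
     (if 2 * k = d then \<mu> * of_real (reval (Qpoly B) v) ^ k
      else of_real (reval (Qpoly B) v) ^ (d - k) * s v *
           foldr nabla (map (u k) [1..<Suc (d - 2 * k)]) (\<lambda>w. inverse (s w)) v)"

text \<open>The right-hand side is singular on \<open>Q = 0\<close>, so the identity is required off that set. The same
  directions must serve every branch.\<close>

definition maxwell_rep ::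
  "real^3^3 \<Rightarrow> nat \<Rightarrow> rpoly \<Rightarrow> (nat \<Rightarrow> nat \<Rightarrow> complex^3) \<Rightarrow> complex \<Rightarrow> bool"
where
  "maxwell_rep B d P u \<mu> \<longleftrightarrow>
     (\<forall>s. sqrt_branch B s \<longrightarrow>
       (\<forall>v. reval (Qpoly B) v \<noteq> 0 \<longrightarrow>
         reval P v = Re (\<Sum>k | 2 * k \<le> d. maxwell_term B s d u \<mu> k v)))"

text \<open>Equality of two families of \<open>m\<close> directions up to order and scale. Scalings that preserve a
  nonzero term have product \<open>1\<close>. A term vanishes when one of its directions is \<open>0\<close>; the others are
  then arbitrary, so any two such families count as equal.\<close>

definition same_directions :: "nat \<Rightarrow> (nat \<Rightarrow> real^3) \<Rightarrow> (nat \<Rightarrow> real^3) \<Rightarrow> bool" where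
  "same_directions m u u' \<longleftrightarrow>
     (\<exists>j\<in>{1..m}. u j = 0) \<and> (\<exists>j\<in>{1..m}. u' j = 0) \<or>
     (\<exists>\<pi> c. \<pi> permutes {1..m} \<and> (\<Prod>j\<in>{1..m}. c j) = 1 \<and>
       (\<forall>j\<in>{1..m}. u' j = c j *\<^sub>R u (\<pi> j)))"

end

theory Submission
  imports Defs "HOL-Computational_Algebra.Fundamental_Theorem_Algebra"
begin

text \<open>
  Write \<open>Q\<close> for the form and \<open>\<Delta>\<close> for its Laplacian. The decomposition and the Dirichlet problem
  rest on the identity \<open>\<Delta> (Q p) = Q \<Delta> p + (4 m + 6) p\<close> for \<open>p\<close> homogeneous of degree \<open>m\<close>
  (\<open>lap_quad_mult_hom\<close>). For every integer \<open>a > 0\<close> the operator \<open>p \<mapsto> Q \<Delta> p + a p\<close> is bijective on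
  the homogeneous polynomials of a given degree: applying \<open>\<Delta>\<close> to \<open>Q \<Delta> p + a p = f\<close> produces an
  equation of the same shape for \<open>\<Delta> p\<close>, in degree two less, and then \<open>p = (f - Q \<Delta> p) / a\<close>. In
  particular \<open>p \<mapsto> \<Delta> (Q p)\<close> is bijective in every degree, and since lower order terms do not
  matter, so is \<open>R \<mapsto> \<Delta> ((Q - c) R)\<close> on all polynomials. Solving \<open>\<Delta> (Q q) = \<Delta> p\<close> splits \<open>p\<close> into a
  harmonic part \<open>p - Q q\<close> and a multiple of \<open>Q\<close>; iteration gives the decomposition. The Dirichlet
  problem is solved by \<open>N + (Q - c) R\<close> with \<open>\<Delta> ((Q - c) R) = M - \<Delta> N\<close>, and the solution is unique
  because a polynomial that vanishes on the surface \<open>Q = c\<close> is a multiple of \<open>Q - c\<close>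
  (\<open>vanishing_on_level_set_imp_multiple\<close>): a generic line in a suitable direction meets the
  surface in two points.

  For orthogonality, the substitution \<open>w = v A\<close> turns \<open>Q\<close> into the sum of squares, so the claim
  is that spherical harmonics of different degrees are orthogonal on the unit sphere. The sphere
  measure is invariant under rotations, hence the generators \<open>x\<^sub>i \<partial>\<^sub>j - x\<^sub>j \<partial>\<^sub>i\<close> are skew for the
  bilinear pairing \<open>\<integral> p q\<close> and the sum of their squares is symmetric. That sum acts on harmonic
  polynomials of degree \<open>d\<close> as \<open>- d (d + 1)\<close>.

  For the Maxwell representation, \<open>m\<close> directional derivatives of \<open>Q\<^sup>-\<^sup>1\<^sup>/\<^sup>2\<close> give \<open>Q\<^sup>-\<^sup>m\<^sup>-\<^sup>1\<^sup>/\<^sup>2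
  H\<close> with a polynomial \<open>H\<close> (\<open>maxwell_poly\<close>) that is harmonic and, modulo \<open>Q\<close>, a nonzero constant
  times the product of the linear forms \<open>b(u\<^sub>j, _)\<close>, where \<open>b\<close> is the bilinear form of \<open>Q\<close>. A
  harmonic polynomial is determined by its class modulo \<open>Q\<close> (\<open>harmonic_eqI\<close>), so a harmonic \<open>h\<close>
  has a Maxwell representation as soon as it is congruent modulo \<open>Q\<close> to a product of linear
  forms. That it always is, is Sylvester's theorem. Over the complex numbers the conic \<open>Q = 0\<close> is
  parametrised by quadratic polynomials in one variable; a form of degree \<open>m\<close> becomes a
  polynomial of degree at most \<open>2 m\<close>, which is a product of \<open>m\<close> polynomials of degree at most
  \<open>2\<close>, and those come from linear forms. If \<open>Q\<close> is positive definite, an isotropic zero \<open>w\<close> of a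
  real form \<open>h\<close> has linearly independent real and imaginary parts; the real plane that they span
  is the zero set of a real linear form, which can be split off from \<open>h\<close> modulo \<open>Q\<close>. For the same
  reason an isotropic zero determines a real linear form up to scale, and this makes the factors
  unique.
\<close>

section \<open>Polynomials in three variables over an arbitrary field\<close>

type_synonym 'a tpoly = "(3 \<Rightarrow>\<^sub>0 nat) \<Rightarrow>\<^sub>0 'a"

abbreviation coef :: "('b \<Rightarrow>\<^sub>0 'a::zero) \<Rightarrow> 'b \<Rightarrow> 'a" where
  "coef \<equiv> Poly_Mapping.lookup"

definition cst :: "'a::zero \<Rightarrow> 'a tpoly" where
  "cst c = Poly_Mapping.single 0 c"

definition var :: "3 \<Rightarrow> 'a::zero_neq_one tpoly" where
  "var i = Poly_Mapping.single (Poly_Mapping.single i 1) 1"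

definition mdeg :: "(3 \<Rightarrow>\<^sub>0 nat) \<Rightarrow> nat" where
  "mdeg m = (\<Sum>i\<in>UNIV. coef m i)"

lemma mdeg_add: "mdeg (a + b) = mdeg a + mdeg b"
  by (simp add: mdeg_def lookup_add sum.distrib)

lemma mdeg_zero [simp]: "mdeg 0 = 0"
  by (simp add: mdeg_def)

lemma mdeg_single [simp]: "mdeg (Poly_Mapping.single i n) = n"
  by (simp add: mdeg_def lookup_single when_def)

lemma mdeg_eq_0D: "mdeg m = 0 \<Longrightarrow> m = 0"
  by (rule poly_mapping_eqI) (simp add: mdeg_def)

lemma exponent_split:
  assumes "coef m i \<noteq> (0::nat)"
  shows "m = Poly_Mapping.single i 1 + (m - Poly_Mapping.single i 1)"
  using assms by (intro poly_mapping_eqI)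
    (auto simp: lookup_add lookup_minus lookup_single when_def)

lemma cst_0 [simp]: "cst 0 = 0"
  by (simp add: cst_def)

lemma cst_1 [simp]: "cst (1::'a::semiring_1) = 1"
  by (simp add: cst_def)

lemma cst_add: "cst (a + b) = cst a + cst (b::'a::monoid_add)"
  by (simp add: cst_def single_add)

lemma cst_minus: "cst (- a) = - cst (a::'a::ab_group_add)"
  by (simp add: cst_def single_uminus)

lemma cst_mult: "cst (a * b) = cst a * cst (b::'a::semiring_0)"
  by (simp add: cst_def mult_single)

lemma cst_of_nat: "cst (of_nat n) = (of_nat n :: 'a::semiring_1 tpoly)"
  by (simp add: cst_def)

lemma cst_numeral: "cst (numeral n) = (numeral n :: 'a::semiring_1 tpoly)"
  by (simp add: cst_def)

lemma cst_sum: "cst (sum f S) = (\<Sum>x\<in>S. cst (f x :: 'a::comm_monoid_add))"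
  by (induction S rule: infinite_finite_induct) (auto simp: cst_add)

lemma cst_power: "cst (a ^ n) = cst (a::'a::semiring_1) ^ n"
  by (induction n) (auto simp: cst_mult)

lemma cst_inverse_mult [simp]: "(a::'a::field) \<noteq> 0 \<Longrightarrow> cst a * (cst (inverse a) * p) = p"
  "(a::'a::field) \<noteq> 0 \<Longrightarrow> cst (inverse a) * (cst a * p) = p"
  by (simp_all flip: cst_mult mult.assoc)

lemma lookup_single_times_add:
  fixes q :: "'a::comm_semiring_1 tpoly"
  shows "coef (Poly_Mapping.single a c * q) (a + m) = c * coef q m"
proof -
  have "coef (Poly_Mapping.single a c * q) (a + m)
      = Sum_any (\<lambda>l. (c when a = l) * Sum_any (\<lambda>k. coef q k when a + m = l + k))"
    by (simp add: lookup_mult lookup_single)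
  also have "\<dots> = Sum_any (\<lambda>l. c * Sum_any (\<lambda>k. coef q k when a + m = l + k) when a = l)"
    by (simp add: when_mult)
  also have "\<dots> = c * coef q m"
    by simp
  finally show ?thesis .
qed

lemma lookup_single_times_zero:
  fixes q :: "'a::comm_semiring_1 tpoly"
  assumes "\<And>m. n \<noteq> a + m"
  shows "coef (Poly_Mapping.single a c * q) n = 0"
proof -
  have "n \<notin> Poly_Mapping.keys (Poly_Mapping.single a c * q)"
  proof
    assume "n \<in> Poly_Mapping.keys (Poly_Mapping.single a c * q)"
    then show False
      using keys_mult[of "Poly_Mapping.single a c" q] assms by (auto split: if_splits)
  qed
  then show ?thesis by (simp add: in_keys_iff)
qed

lemma lookup_cst_times [simp]:
  "coef (cst c * q) m = c * coef (q :: 'a::comm_semiring_1 tpoly) m"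
  using lookup_single_times_add[of 0 c q m] by (simp add: cst_def)

lemma lookup_var_times:
  "coef (var i * q) m =
    (if coef m i = 0 then 0
     else coef (q :: 'a::comm_semiring_1 tpoly) (m - Poly_Mapping.single i 1))"
proof (cases "coef m i = 0")
  case True
  have "m \<noteq> Poly_Mapping.single i 1 + k" for k
  proof
    assume "m = Poly_Mapping.single i 1 + k"
    then have "coef m i = 1 + coef k i"
      by (simp add: lookup_add)
    with True show False by simp
  qed
  then show ?thesis
    using True by (simp add: var_def lookup_single_times_zero)
next
  case False
  then show ?thesis
    using lookup_single_times_add[of "Poly_Mapping.single i 1" 1 q "m - Poly_Mapping.single i 1"]
    by (simp only: var_def exponent_split[OF False, symmetric] if_False mult_1)
qed

lemma single_add_var:
  "Poly_Mapping.single (Poly_Mapping.single i 1 + m) (c::'a::comm_semiring_1)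
    = var i * Poly_Mapping.single m c"
  by (simp add: var_def mult_single)

lemma tpoly_sum_singles:
  "p = (\<Sum>m\<in>Poly_Mapping.keys p. Poly_Mapping.single m (coef p m))"
proof (rule poly_mapping_eqI)
  fix k
  show "coef p k = coef
    (\<Sum>m\<in>Poly_Mapping.keys p. Poly_Mapping.single m (coef p m)) k"
    by (auto simp: lookup_sum lookup_single when_def in_keys_iff)
qed

text \<open>Every polynomial arises from constants by additions and multiplications by variables, so
  that identities between ring homomorphisms and derivations need to be checked on these only.\<close>

lemma tpoly_induct [case_names cst add var]:
  fixes p :: "'a::comm_semiring_1 tpoly"
  assumes c: "\<And>c. P (cst c)"
    and a: "\<And>p q. P p \<Longrightarrow> P q \<Longrightarrow> P (p + q)"
    and v: "\<And>i p. P p \<Longrightarrow> P (var i * p)"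
  shows "P p"
proof -
  have s: "P (Poly_Mapping.single m x)" for m x
  proof (induction "mdeg m" arbitrary: m)
    case 0
    then have "m = 0" by (simp add: mdeg_eq_0D)
    then show ?case using c by (simp add: cst_def)
  next
    case (Suc n)
    then obtain i where i: "coef m i \<noteq> 0"
      by (metis mdeg_def sum.neutral Suc_neq_Zero)
    define k where "k = m - Poly_Mapping.single i 1"
    have m: "m = Poly_Mapping.single i 1 + k"
      using exponent_split[OF i] by (simp add: k_def)
    have "n = mdeg k" using Suc(2) m mdeg_add[of "Poly_Mapping.single i 1" k] by simp
    then show ?case using Suc(1) v m single_add_var by metis
  qed
  have "P (\<Sum>m\<in>K. Poly_Mapping.single m (coef p m))" if "finite K" for K
    using that by (induction K) (use c[of 0] a s in auto)
  then show ?thesis using tpoly_sum_singles[of p] by (metis finite_keys)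
qed

subsection \<open>Evaluation homomorphisms\<close>

definition ins :: "('a::zero \<Rightarrow> 'b::comm_semiring_1) \<Rightarrow> (3 \<Rightarrow> 'b) \<Rightarrow> 'a tpoly \<Rightarrow> 'b" where
  "ins h x p = (\<Sum>m\<in>Poly_Mapping.keys p.
     h (coef p m) * (\<Prod>i\<in>UNIV. x i ^ coef m i))"

text \<open>Substitution of values for the variables is a ring homomorphism whenever the coefficients
  are mapped by one; real and complex evaluation, linear substitution and complexification are
  all instances.\<close>

locale coeff_hom =
  fixes h :: "'a::comm_ring_1 \<Rightarrow> 'b::comm_ring_1"
  assumes h0 [simp]: "h 0 = 0" and h1 [simp]: "h 1 = 1"
    and hadd: "h (a + b) = h a + h b" and hmult: "h (a * b) = h a * h b"
begin

lemma ins_superset: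
  assumes "finite K" "Poly_Mapping.keys p \<subseteq> K"
  shows "ins h x p = (\<Sum>m\<in>K. h (coef p m) * (\<Prod>i\<in>UNIV. x i ^ coef m i))"
  unfolding ins_def
  by (rule sum.mono_neutral_left) (use assms in \<open>auto simp: in_keys_iff\<close>)

lemma ins_0 [simp]: "ins h x 0 = 0"
  by (simp add: ins_def)

lemma ins_cst [simp]: "ins h x (cst c) = h c"
  by (simp add: ins_def cst_def)

lemma ins_add [simp]: "ins h x (p + q) = ins h x p + ins h x q"
proof -
  let ?K = "Poly_Mapping.keys p \<union> Poly_Mapping.keys q"
  have "Poly_Mapping.keys (p + q) \<subseteq> ?K" by (rule keys_add)
  then show ?thesis
    by (simp add: ins_superset[of ?K] lookup_add hadd distrib_right sum.distrib)
qed

lemma ins_cst_mult: "ins h x (cst c * p) = h c * ins h x p"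
proof -
  have "Poly_Mapping.keys (cst c * p) \<subseteq> Poly_Mapping.keys p"
    by (auto simp: in_keys_iff)
  then show ?thesis
    by (simp add: ins_superset[of "Poly_Mapping.keys p"] hmult sum_distrib_left mult.assoc)
qed

lemma ins_var_mult: "ins h x (var i * p) = x i * ins h x p"
proof -
  let ?e = "Poly_Mapping.single i (1::nat)"
  have k: "Poly_Mapping.keys (var i * p) \<subseteq> (+) ?e ` Poly_Mapping.keys p"
  proof
    fix m assume "m \<in> Poly_Mapping.keys (var i * p)"
    then have "coef m i \<noteq> 0" "m - ?e \<in> Poly_Mapping.keys p"
      by (auto simp: in_keys_iff lookup_var_times split: if_splits)
    then show "m \<in> (+) ?e ` Poly_Mapping.keys p"
      using image_eqI[of m "(+) ?e" "m - ?e", OF exponent_split[of m i]] by blast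
  qed
  have 1: "(\<Prod>j\<in>UNIV. x j ^ coef (?e + m) j)
     = x i * (\<Prod>j\<in>UNIV. x j ^ coef m j)" for m
  proof -
    have "(\<Prod>j\<in>UNIV. x j ^ coef ?e j) = (\<Prod>j\<in>UNIV. if j = i then x i else 1)"
      by (rule prod.cong) (auto simp: lookup_single when_def)
    then show ?thesis by (simp add: lookup_add power_add prod.distrib)
  qed
  have "ins h x (var i * p) = (\<Sum>m\<in>(+) ?e ` Poly_Mapping.keys p.
    h (coef (var i * p) m) * (\<Prod>i\<in>UNIV. x i ^ coef m i))"
    using k by (intro ins_superset) auto
  also have "\<dots> = (\<Sum>m\<in>Poly_Mapping.keys p.
    h (coef (var i * p) (?e + m)) * (\<Prod>i\<in>UNIV. x i ^ coef (?e + m) i))"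
    by (rule sum.reindex_cong[of "(+) ?e"]) (auto simp: inj_on_def)
  also have "\<dots> = (\<Sum>m\<in>Poly_Mapping.keys p.
    x i * (h (coef p m) * (\<Prod>i\<in>UNIV. x i ^ coef m i)))"
    by (intro sum.cong refl, subst 1) (simp add: lookup_var_times lookup_add)
  also have "\<dots> = x i * ins h x p"
    by (simp add: ins_def sum_distrib_left)
  finally show ?thesis .
qed

lemma ins_1 [simp]: "ins h x 1 = 1"
  using ins_cst[of x 1] by simp

lemma ins_var [simp]: "ins h x (var i) = x i"
  using ins_var_mult[of x i 1] by simp

lemma ins_mult [simp]: "ins h x (p * q) = ins h x p * ins h x q"
  by (induction p rule: tpoly_induct)
    (simp_all add: ins_cst_mult ins_var_mult distrib_right mult.assoc)

lemma ins_minus [simp]: "ins h x (- p) = - ins h x p"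
proof -
  have "ins h x (- p) + ins h x p = ins h x (- p + p)" by (simp only: ins_add)
  then show ?thesis by (simp add: eq_neg_iff_add_eq_0)
qed

lemma ins_diff [simp]: "ins h x (p - q) = ins h x p - ins h x q"
  using ins_add[of x p "- q"] by simp

lemma ins_sum [simp]: "ins h x (sum f S) = (\<Sum>s\<in>S. ins h x (f s))"
  by (induction S rule: infinite_finite_induct) auto

lemma ins_power [simp]: "ins h x (p ^ n) = ins h x p ^ n"
  by (induction n) auto

lemma ins_prod [simp]: "ins h x (prod f S) = (\<Prod>s\<in>S. ins h x (f s))"
  by (induction S rule: infinite_finite_induct) auto

lemma ins_of_nat [simp]: "ins h x (of_nat n) = of_nat n"
  by (induction n) auto

lemma ins_numeral [simp]: "ins h x (numeral n) = numeral n"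
  using ins_of_nat[of x "numeral n"] by simp

end

definition ev :: "'a::comm_semiring_1 tpoly \<Rightarrow> 'a^3 \<Rightarrow> 'a" where
  "ev p v = ins id (\<lambda>i. v $ i) p"

interpretation id_hom: coeff_hom "id :: 'a::comm_ring_1 \<Rightarrow> 'a"
  by unfold_locales auto

interpretation cst_hom: coeff_hom "cst :: 'a::comm_ring_1 \<Rightarrow> 'a tpoly"
  by unfold_locales (auto simp: cst_add cst_mult)

lemma ev_simps [simp]:
  "ev 0 v = 0" "ev 1 v = 1" "ev (cst c) v = c" "ev (var i) v = v $ i"
  "ev (p + q) v = ev p v + ev q v" "ev (p - q) v = ev p v - ev q v" "ev (- p) v = - ev p v"
  "ev (p * q) v = ev p v * ev q v" "ev (p ^ n) v = ev p v ^ n"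
  "ev (sum f S) v = (\<Sum>s\<in>S. ev (f s) v)" "ev (prod f S) v = (\<Prod>s\<in>S. ev (f s) v)"
  "ev (of_nat n) v = of_nat n" "ev (numeral k) v = numeral k"
  for v :: "'a::comm_ring_1^3"
  by (simp_all add: ev_def)

subsection \<open>Partial derivatives\<close>

definition der :: "3 \<Rightarrow> 'a::comm_semiring_1 tpoly \<Rightarrow> 'a tpoly" where
  "der i p = (\<Sum>m\<in>Poly_Mapping.keys p.
     Poly_Mapping.single (m - Poly_Mapping.single i 1)
       (of_nat (coef m i) * coef p m))"

lemma lookup_der:
  "coef (der i p) m =
     of_nat (Suc (coef m i)) * coef p (Poly_Mapping.single i 1 + m)"
proof -
  let ?e = "Poly_Mapping.single i (1::nat)"
  have eq: "(of_nat (coef k i) * coef p k when k - ?e = m)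
    = (if k = ?e + m then of_nat (Suc (coef m i)) * coef p k else 0)" for k
  proof (cases "coef k i = 0")
    case True
    then have "k \<noteq> ?e + m" by (auto simp: lookup_add)
    with True show ?thesis by (simp add: when_def)
  next
    case False
    then have "k - ?e = m \<longleftrightarrow> k = ?e + m"
      using exponent_split[OF False] by auto
    then show ?thesis by (auto simp: when_def lookup_add)
  qed
  have "coef (der i p) m = (\<Sum>k\<in>Poly_Mapping.keys p.
     (if k = ?e + m then of_nat (Suc (coef m i)) * coef p k else 0))"
    by (simp only: der_def lookup_sum lookup_single eq)
  also have "\<dots> = of_nat (Suc (coef m i)) * coef p (?e + m)"
    by (simp add: in_keys_iff del: of_nat_Suc)
  finally show ?thesis .
qed

lemma der_add [simp]: "der i (p + q) = der i p + der i q"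
  by (rule poly_mapping_eqI) (simp add: lookup_der lookup_add distrib_left)

lemma der_cst_mult [simp]: "der i (cst c * p) = cst c * der i p"
  by (rule poly_mapping_eqI) (simp add: lookup_der mult.left_commute)

lemma der_0 [simp]: "der i 0 = 0"
  by (simp add: der_def)

lemma der_cst [simp]: "der i (cst c) = 0"
proof (rule poly_mapping_eqI)
  fix m :: "3 \<Rightarrow>\<^sub>0 nat"
  have "Poly_Mapping.single i 1 + m \<noteq> 0"
  proof
    assume "Poly_Mapping.single i 1 + m = 0"
    then have "mdeg (Poly_Mapping.single i 1 + m) = 0" by simp
    then show False by (simp add: mdeg_add)
  qed
  then show "coef (der i (cst c)) m = coef 0 m"
    by (simp add: lookup_der cst_def lookup_single when_def)
qed

lemma der_1 [simp]: "der i 1 = 0"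
  using der_cst[of i 1] by simp

lemma der_sum [simp]: "der i (sum f S) = (\<Sum>s\<in>S. der i (f s))"
  by (induction S rule: infinite_finite_induct) auto

lemma der_minus [simp]: "der i (- p :: 'a::comm_ring_1 tpoly) = - der i p"
  by (rule poly_mapping_eqI) (simp add: lookup_der)

lemma der_diff [simp]: "der i (p - q :: 'a::comm_ring_1 tpoly) = der i p - der i q"
  by (rule poly_mapping_eqI) (simp add: lookup_der lookup_minus algebra_simps)

lemma der_var_mult:
  "der i (var j * p) = (if i = j then p else 0) + var j * der i (p :: 'a::comm_semiring_1 tpoly)"
proof (rule poly_mapping_eqI)
  fix m
  let ?ei = "Poly_Mapping.single i (1::nat)" and ?ej = "Poly_Mapping.single j (1::nat)"
  show "coef (der i (var j * p)) m =
    coef ((if i = j then p else 0) + var j * der i p) m"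
  proof (cases "i = j")
    case True
    show ?thesis
    proof (cases "coef m i = 0")
      case False
      from exponent_split[OF False, symmetric] True show ?thesis
        by (simp add: lookup_der lookup_var_times lookup_add lookup_minus distrib_right)
    qed (use True in \<open>simp add: lookup_der lookup_var_times lookup_add\<close>)
  next
    case False
    show ?thesis
    proof (cases "coef m j = 0")
      case True
      then show ?thesis using False
        by (simp add: lookup_der lookup_var_times lookup_add lookup_single)
    next
      case ne: False
      then have "?ei + m - ?ej = ?ei + (m - ?ej)"
        by (intro poly_mapping_eqI) (auto simp: lookup_add lookup_minus lookup_single when_def)
      then show ?thesis using False ne
        by (simp add: lookup_der lookup_var_times lookup_add lookup_single lookup_minus)
    qed
  qed
qed

lemma der_var: "der i (var j) = (if i = j then 1 else (0 :: 'a::comm_semiring_1 tpoly))"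
  using der_var_mult[of i j 1] by simp

lemma der_mult: "der i (p * q) = der i p * q + p * der i (q :: 'a::comm_semiring_1 tpoly)"
  by (induction p rule: tpoly_induct)
    (auto simp: der_var_mult distrib_left distrib_right mult.assoc add_ac)

lemma der_commute: "der i (der j p) = der j (der i (p :: 'a::comm_semiring_1 tpoly))"
  by (induction p rule: tpoly_induct) (auto simp: der_var_mult)

subsection \<open>Homogeneous polynomials\<close>

definition hom :: "nat \<Rightarrow> 'a::zero tpoly set" where
  "hom d = {p. \<forall>m\<in>Poly_Mapping.keys p. mdeg m = d}"

lemma hom_iff: "p \<in> hom d \<longleftrightarrow> (\<forall>m. mdeg m \<noteq> d \<longrightarrow> coef p m = 0)"
  by (auto simp: hom_def in_keys_iff)

lemma hom_0 [simp]: "0 \<in> hom d"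
  by (simp add: hom_iff)

lemma hom_add: "p \<in> hom d \<Longrightarrow> q \<in> hom d \<Longrightarrow> p + q \<in> hom d"
  by (simp add: hom_iff lookup_add)

lemma hom_diff: "p \<in> hom d \<Longrightarrow> q \<in> hom d \<Longrightarrow> p - q \<in> hom d" for p :: "'a::ab_group_add tpoly"
  by (simp add: hom_iff lookup_minus)

lemma hom_sum: "(\<And>s. s \<in> S \<Longrightarrow> f s \<in> hom d) \<Longrightarrow> sum f S \<in> hom d"
  by (induction S rule: infinite_finite_induct) (auto intro: hom_add)

lemma hom_cst [simp]: "cst c \<in> hom 0"
  by (simp add: hom_def cst_def)

lemma hom_var [simp]: "var i \<in> hom 1" "var i \<in> hom (Suc 0)"
  by (simp_all add: hom_def var_def)

lemma hom_mult:
  fixes p q :: "'a::comm_semiring_1 tpoly"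
  assumes "p \<in> hom a" "q \<in> hom b"
  shows "p * q \<in> hom (a + b)"
  using keys_mult[of p q] assms by (fastforce simp: hom_def mdeg_add)

lemma hom_cst_mult: "p \<in> hom d \<Longrightarrow> cst c * p \<in> hom d" for p :: "'a::comm_semiring_1 tpoly"
  using hom_mult[of "cst c" 0 p d] by simp

lemma hom_var_mult: "p \<in> hom d \<Longrightarrow> var i * p \<in> hom (Suc d)" for p :: "'a::comm_semiring_1 tpoly"
  using hom_mult[of "var i" 1 p d] by simp

lemma hom_power: "p \<in> hom a \<Longrightarrow> p ^ n \<in> hom (a * n)" for p :: "'a::comm_semiring_1 tpoly"
  using hom_cst[of "1::'a"] by (induction n) (auto intro: hom_mult)

lemma hom_der: "p \<in> hom (Suc d) \<Longrightarrow> der i p \<in> hom d" for p :: "'a::comm_semiring_1 tpoly"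
  by (simp add: hom_iff lookup_der mdeg_add)

lemma hom_zero_eq_cst:
  assumes "p \<in> hom 0" shows "p = cst (coef p 0)"
  using assms by (intro poly_mapping_eqI)
    (auto simp: hom_iff cst_def lookup_single when_def dest: mdeg_eq_0D)

lemma hom_der_zero: "p \<in> hom 0 \<Longrightarrow> der i p = 0"
  by (metis hom_zero_eq_cst der_cst)

text \<open>Each monomial \<open>m\<close> is an eigenvector of \<open>x\<^sub>i \<partial>\<^sub>i\<close> with eigenvalue \<open>m\<^sub>i\<close>.\<close>

lemma euler:
  fixes p :: "'a::comm_semiring_1 tpoly"
  assumes "p \<in> hom d"
  shows "(\<Sum>i\<in>UNIV. var i * der i p) = of_nat d * p"
proof (rule poly_mapping_eqI)
  fix m
  have "coef (var i * der i p) m = of_nat (coef m i) * coef p m" for i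
    using exponent_split[of m i]
    by (auto simp: lookup_var_times lookup_der lookup_minus simp del: of_nat_Suc)
  then have "coef (\<Sum>i\<in>UNIV. var i * der i p) m = of_nat (mdeg m) * coef p m"
    by (simp add: lookup_sum mdeg_def flip: sum_distrib_right)
  also have "\<dots> = of_nat d * coef p m"
    using assms by (cases "mdeg m = d") (auto simp: hom_iff)
  also have "\<dots> = coef (of_nat d * p) m"
    by (simp flip: cst_of_nat)
  finally show "coef (\<Sum>i\<in>UNIV. var i * der i p) m = coef (of_nat d * p) m" .
qed

text \<open>Euler's identity solved for \<open>p\<close>.\<close>

lemma hom_Suc_split:
  fixes p :: "'a::field_char_0 tpoly"
  assumes "p \<in> hom (Suc d)"
  obtains q where "\<And>i. q i \<in> hom d" "p = (\<Sum>i\<in>UNIV. var i * q i)"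
proof
  show "cst (inverse (of_nat (Suc d))) * der i p \<in> hom d" for i
    by (intro hom_cst_mult hom_der assms)
  have "(\<Sum>i\<in>UNIV. var i * (cst (inverse (of_nat (Suc d))) * der i p))
    = cst (inverse (of_nat (Suc d))) * (\<Sum>i\<in>UNIV. var i * der i p)"
    by (simp add: sum_distrib_left mult.left_commute)
  also have "\<dots> = cst (inverse (of_nat (Suc d))) * (cst (of_nat (Suc d)) * p)"
    by (simp only: euler[OF assms] cst_of_nat)
  also have "\<dots> = p"
    by (rule cst_inverse_mult) (simp del: of_nat_Suc)
  finally show "p = (\<Sum>i\<in>UNIV. var i * (cst (inverse (of_nat (Suc d))) * der i p))" by simp
qed

lemma hom_induct [consumes 1, case_names cst add var]:
  fixes p :: "'a::field_char_0 tpoly"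
  assumes "p \<in> hom d"
    and c: "\<And>c. P 0 (cst c)"
    and a: "\<And>d p q. p \<in> hom d \<Longrightarrow> q \<in> hom d \<Longrightarrow> P d p \<Longrightarrow> P d q \<Longrightarrow> P d (p + q)"
    and v: "\<And>d i p. p \<in> hom d \<Longrightarrow> P d p \<Longrightarrow> P (Suc d) (var i * p)"
  shows "P d p"
  using assms(1)
proof (induction d arbitrary: p)
  case 0
  then show ?case using c hom_zero_eq_cst by metis
next
  case (Suc d)
  then obtain q where q: "\<And>i. q i \<in> hom d" "p = (\<Sum>i\<in>UNIV. var i * q i)"
    using hom_Suc_split by blast
  have "P (Suc d) (var 1 * q 1 + var 2 * q 2 + var 3 * q 3)"
    by (intro a v hom_add hom_var_mult Suc.IH q)
  then show ?case by (simp add: q(2) sum_3)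
qed

subsection \<open>Filtration by degree\<close>

definition deg_lt :: "nat \<Rightarrow> 'a::zero tpoly set" where
  "deg_lt n = {p. \<forall>m\<in>Poly_Mapping.keys p. mdeg m < n}"

lemma deg_lt_iff: "p \<in> deg_lt d \<longleftrightarrow> (\<forall>m. mdeg m \<ge> d \<longrightarrow> coef p m = 0)"
  by (force simp: deg_lt_def in_keys_iff)

lemma deg_lt_0: "p \<in> deg_lt 0 \<longleftrightarrow> p = 0"
  by (metis deg_lt_iff poly_mapping_eqI lookup_zero le0)

lemma deg_lt_exists: "\<exists>n. p \<in> deg_lt n"
proof -
  have "p \<in> deg_lt (Suc (Max (mdeg ` Poly_Mapping.keys p)))"
    by (auto simp: deg_lt_def less_Suc_eq_le)
  then show ?thesis ..
qed

lemma deg_lt_add: "p \<in> deg_lt n \<Longrightarrow> q \<in> deg_lt n \<Longrightarrow> p + q \<in> deg_lt n"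
  by (simp add: deg_lt_iff lookup_add)

lemma deg_lt_diff: "p \<in> deg_lt n \<Longrightarrow> q \<in> deg_lt n \<Longrightarrow> p - q \<in> deg_lt n" for p ::
    "'a::ab_group_add tpoly"
  by (simp add: deg_lt_iff lookup_minus)

lemma deg_lt_mono: "p \<in> deg_lt n \<Longrightarrow> n \<le> m \<Longrightarrow> p \<in> deg_lt m"
  by (auto simp: deg_lt_iff)

lemma deg_lt_sum: "(\<And>s. s \<in> S \<Longrightarrow> f s \<in> deg_lt d) \<Longrightarrow> sum f S \<in> deg_lt d"
  by (induction S rule: infinite_finite_induct) (auto intro: deg_lt_add simp: deg_lt_iff lookup_add)

lemma deg_lt_cst_mult: "p \<in> deg_lt n \<Longrightarrow> cst c * p \<in> deg_lt n" for p :: "'a::comm_semiring_1 tpoly"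
  by (simp add: deg_lt_iff)

lemma deg_lt_var_mult: "p \<in> deg_lt n \<Longrightarrow> var i * p \<in> deg_lt (Suc n)" for p ::
    "'a::comm_semiring_1 tpoly"
proof -
  assume p: "p \<in> deg_lt n"
  { fix m :: "3 \<Rightarrow>\<^sub>0 nat" assume "coef m i \<noteq> 0" "mdeg m \<ge> Suc n"
    then have "mdeg (m - Poly_Mapping.single i 1) \<ge> n"
      using exponent_split[of m i] mdeg_add[of "Poly_Mapping.single i 1"
        "m - Poly_Mapping.single i 1"]
      by simp }
  with p show ?thesis by (auto simp: deg_lt_iff lookup_var_times)
qed

lemma deg_lt_der: "p \<in> deg_lt (Suc n) \<Longrightarrow> der i p \<in> deg_lt n" for p :: "'a::comm_semiring_1 tpoly"
  by (simp add: deg_lt_iff lookup_der mdeg_add)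

lemma hom_subset_deg_lt: "p \<in> hom n \<Longrightarrow> p \<in> deg_lt (Suc n)"
  by (auto simp: hom_def deg_lt_def)

lemma hom_deg_lt_zero: "p \<in> hom n \<Longrightarrow> p \<in> deg_lt n \<Longrightarrow> p = 0"
  by (intro poly_mapping_eqI) (metis hom_iff deg_lt_iff lookup_zero order_refl)

lemma deg_lt_Suc_split:
  assumes "p \<in> deg_lt (Suc n)"
  obtains a b where "a \<in> hom n" "b \<in> deg_lt n" "p = a + (b :: 'a::ab_group_add tpoly)"
proof -
  let ?f = "\<lambda>m. Poly_Mapping.single m (coef p m)"
  define a where "a = (\<Sum>m | m \<in> Poly_Mapping.keys p \<and> mdeg m = n. ?f m)"
  have l: "coef a m = (if mdeg m = n then coef p m else 0)" for m
    by (auto simp: a_def lookup_sum lookup_single when_def in_keys_iff)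
  have 1: "a \<in> hom n" by (simp add: hom_iff l)
  have 2: "p - a \<in> deg_lt n" using assms by (auto simp: deg_lt_iff l lookup_minus Suc_le_eq)
  show thesis by (rule that[OF 1 2]) simp
qed

subsection \<open>Linear substitutions\<close>

definition lin_subst :: "'a::comm_semiring_1^3^3 \<Rightarrow> 'a tpoly \<Rightarrow> 'a tpoly" where
  "lin_subst g p = ins cst (\<lambda>i. \<Sum>j\<in>UNIV. cst (g $ j $ i) * var j) p"

lemma lin_subst_simps [simp]:
  fixes g :: "'a::comm_ring_1^3^3"
  shows "lin_subst g 0 = 0" "lin_subst g 1 = 1" "lin_subst g (cst c) = cst c"
  "lin_subst g (var i) = (\<Sum>j\<in>UNIV. cst (g $ j $ i) * var j)"
  "lin_subst g (p + q) = lin_subst g p + lin_subst g q"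
  "lin_subst g (p - q) = lin_subst g p - lin_subst g q"
  "lin_subst g (p * q) = lin_subst g p * lin_subst g q"
  "lin_subst g (p ^ n) = lin_subst g p ^ n"
  "lin_subst g (sum f S) = (\<Sum>s\<in>S. lin_subst g (f s))"
  by (simp_all add: lin_subst_def)

lemma ev_lin_subst: "ev (lin_subst g p) v = ev p (v v* g)" for g :: "'a::comm_ring_1^3^3"
  by (induction p rule: tpoly_induct)
    (auto simp: vector_matrix_mult_def mult.commute)

lemma hom_lin_subst:
  fixes g :: "'a::field_char_0^3^3"
  assumes "p \<in> hom d" shows "lin_subst g p \<in> hom d"
  using assms
proof (induction rule: hom_induct)
  case (var d i p)
  have "(\<Sum>j\<in>UNIV. cst (g $ j $ i) * var j) \<in> hom (Suc 0)"
    by (intro hom_sum hom_cst_mult hom_var)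
  from hom_mult[OF this var(2)] show ?case by simp
qed (auto intro: hom_add)

lemma der_lin_subst:
  fixes g :: "'a::comm_ring_1^3^3"
  shows "der j (lin_subst g p) = (\<Sum>i\<in>UNIV. cst (g $ j $ i) * lin_subst g (der i p))"
proof (induction p rule: tpoly_induct)
  case (add p q)
  then show ?case by (simp add: algebra_simps sum.distrib)
next
  case (var k p)
  let ?v = "\<Sum>l\<in>UNIV. cst (g $ l $ k) * var l :: 'a tpoly"
  have 1: "der j ?v = cst (g $ j $ k)"
    by (simp add: der_var if_distrib[of "\<lambda>x. _ * x"] cong: if_cong)
  have 2: "(\<Sum>i\<in>UNIV. cst (g $ j $ i) * lin_subst g (if i = k then p else 0))
    = cst (g $ j $ k) * lin_subst g p"
    by (subst sum.remove[of _ k]) (auto intro!: sum.neutral)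
  have "der j (lin_subst g (var k * p))
    = cst (g $ j $ k) * lin_subst g p + ?v * der j (lin_subst g p)"
    by (simp only: lin_subst_simps der_mult 1)
  also have "?v * der j (lin_subst g p) = (\<Sum>i\<in>UNIV. cst (g $ j $ i) * (?v * lin_subst g (der i p)))"
    by (simp only: var sum_distrib_left mult.left_commute)
  also have "cst (g $ j $ k) * lin_subst g p + \<dots>
    = (\<Sum>i\<in>UNIV. cst (g $ j $ i) * lin_subst g (der i (var k * p)))"
    by (simp only: der_var_mult lin_subst_simps distrib_left sum.distrib 2)
  finally show ?case .
qed simp

section \<open>Quadratic forms and their Laplacians\<close>

definition quad :: "'a::comm_semiring_1^3^3 \<Rightarrow> 'a tpoly" where
  "quad B = (\<Sum>j\<in>UNIV. \<Sum>k\<in>UNIV. cst (B $ j $ k) * var j * var k)"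

definition lap :: "'a::comm_semiring_1^3^3 \<Rightarrow> 'a tpoly \<Rightarrow> 'a tpoly" where
  "lap C p = (\<Sum>j\<in>UNIV. \<Sum>k\<in>UNIV. cst (C $ j $ k) * der j (der k p))"

definition lin :: "'a::comm_semiring_1^3 \<Rightarrow> 'a tpoly" where
  "lin a = (\<Sum>i\<in>UNIV. cst (a $ i) * var i)"

definition dir_der :: "'a::comm_semiring_1^3 \<Rightarrow> 'a tpoly \<Rightarrow> 'a tpoly" where
  "dir_der u p = (\<Sum>i\<in>UNIV. cst (u $ i) * der i p)"

lemma ev_lin: "ev (lin a) v = (\<Sum>i\<in>UNIV. a $ i * v $ i)" for a :: "'a::comm_ring_1^3"
  by (simp add: lin_def)

lemma ev_quad: "ev (quad B) v = (\<Sum>j\<in>UNIV. \<Sum>k\<in>UNIV. B $ j $ k * v $ j * v $ k)"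
  for B :: "'a::comm_ring_1^3^3"
  by (simp add: quad_def)

lemma lap_add [simp]: "lap C (p + q) = lap C p + lap C q"
  by (simp add: lap_def distrib_left sum.distrib)

lemma lap_cst_mult [simp]: "lap C (cst c * p) = cst c * lap C p"
  by (simp add: lap_def sum_distrib_left mult.left_commute)

lemma lap_of_nat_mult [simp]: "lap C (of_nat n * p) = of_nat n * lap C p"
  using lap_cst_mult[of C "of_nat n" p] by (simp only: cst_of_nat)

lemma lap_0 [simp]: "lap C 0 = 0"
  by (simp add: lap_def)

lemma lap_diff [simp]: "lap C (p - q) = lap C p - lap C q" for C :: "'a::comm_ring_1^3^3"
  by (simp add: lap_def right_diff_distrib sum_subtractf)

lemma lap_hom: "p \<in> hom (Suc (Suc d)) \<Longrightarrow> lap C p \<in> hom d"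
  unfolding lap_def by (intro hom_sum hom_cst_mult hom_der)

lemma lap_hom_less_2:
  assumes "p \<in> hom d" "d < 2" shows "lap C p = 0"
proof -
  have "der j (der k p) = 0" for j k
  proof (cases d)
    case (Suc e)
    then show ?thesis using assms by (auto intro!: hom_der_zero hom_der)
  qed (use assms in \<open>simp add: hom_der_zero\<close>)
  then show ?thesis by (simp add: lap_def)
qed

lemma lap_deg_lt: "p \<in> deg_lt (Suc (Suc d)) \<Longrightarrow> lap C p \<in> deg_lt d"
  unfolding lap_def by (intro deg_lt_sum deg_lt_cst_mult deg_lt_der)

lemma lap_deg_lt': "p \<in> deg_lt (Suc d) \<Longrightarrow> lap C p \<in> deg_lt d"
  by (rule lap_deg_lt) (erule deg_lt_mono, simp)

lemma hom_quad [simp]: "quad B \<in> hom 2"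
proof -
  have "cst c * var j * var k \<in> hom 2" for c :: 'a and j k
    using hom_mult[OF hom_cst_mult[OF hom_var(1)] hom_var(1), of c j k]
      by (simp add: numeral_2_eq_2)
  then show ?thesis unfolding quad_def by (intro hom_sum)
qed

lemma hom_quad_mult: "p \<in> hom d \<Longrightarrow> quad B * p \<in> hom (Suc (Suc d))"
  using hom_mult[OF hom_quad, of p d] by simp

lemma deg_lt_quad_mult: "p \<in> deg_lt d \<Longrightarrow> quad B * p \<in> deg_lt (Suc (Suc d))"
  by (simp add: quad_def sum_distrib_right mult.assoc deg_lt_sum deg_lt_cst_mult deg_lt_var_mult)

lemma hom_lin [simp]: "lin a \<in> hom 1" "lin a \<in> hom (Suc 0)"
  unfolding lin_def by (intro hom_sum hom_cst_mult hom_var)+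

lemma der_lin [simp]: "der i (lin a) = cst (a $ i)"
  by (simp add: lin_def der_var if_distrib[of "\<lambda>x. _ * x"] cong: if_cong)

lemma dir_der_der_commute: "der i (dir_der u p) = dir_der u (der i p)"
  by (simp add: dir_der_def der_commute[of i])

lemma dir_der_add: "dir_der u (p + q) = dir_der u p + dir_der u q"
  by (simp add: dir_der_def distrib_left sum.distrib)

lemma dir_der_cst_mult: "dir_der u (cst c * p) = cst c * dir_der u p"
  by (simp add: dir_der_def sum_distrib_left mult.left_commute)

lemma dir_der_0 [simp]: "dir_der u 0 = 0"
  by (simp add: dir_der_def)

lemma dir_der_sum: "dir_der u (sum f S) = (\<Sum>s\<in>S. dir_der u (f s))"
  by (induction S rule: infinite_finite_induct) (auto simp: dir_der_add)

lemma lap_dir_der: "lap C (dir_der u p) = dir_der u (lap C p)"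
  by (simp add: lap_def dir_der_sum dir_der_cst_mult dir_der_der_commute)

lemma hom_dir_der: "p \<in> hom (Suc d) \<Longrightarrow> dir_der u p \<in> hom d"
  unfolding dir_der_def by (intro hom_sum hom_cst_mult hom_der)

lemma sum_reverse_4:
  fixes f :: "3 \<Rightarrow> 3 \<Rightarrow> 3 \<Rightarrow> 3 \<Rightarrow> 'a::comm_monoid_add"
  shows "(\<Sum>j\<in>UNIV. \<Sum>k\<in>UNIV. \<Sum>b\<in>UNIV. \<Sum>a\<in>UNIV. f j k b a)
    = (\<Sum>a\<in>UNIV. \<Sum>b\<in>UNIV. \<Sum>k\<in>UNIV. \<Sum>j\<in>UNIV. f j k b a)"
  by (simp add: sum_3 add_ac)

text \<open>The chain rule: a linear substitution transforms the matrix of a second order operator by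
  congruence.\<close>

lemma lap_lin_subst:
  fixes g C :: "'a::comm_ring_1^3^3"
  shows "lap C (lin_subst g p) = lin_subst g (lap (transpose g ** C ** g) p)"
proof -
  have "lap C (lin_subst g p) = (\<Sum>j\<in>UNIV. \<Sum>k\<in>UNIV. \<Sum>b\<in>UNIV. \<Sum>a\<in>UNIV.
       cst (C $ j $ k * g $ k $ b * g $ j $ a) * lin_subst g (der a (der b p)))"
    by (simp add: lap_def der_lin_subst sum_distrib_left cst_mult mult.assoc)
  also have "\<dots> = lin_subst g (lap (transpose g ** C ** g) p)"
    by (subst sum_reverse_4) (simp add: lap_def matrix_matrix_mult_def transpose_def cst_sum
        sum_distrib_left sum_distrib_right mult_ac)
  finally show ?thesis .
qed

lemma lin_subst_quad:
  fixes g B :: "'a::comm_ring_1^3^3"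
  shows "lin_subst g (quad B) = quad (g ** B ** transpose g)"
proof -
  have "lin_subst g (quad B) = (\<Sum>j\<in>UNIV. \<Sum>k\<in>UNIV. \<Sum>b\<in>UNIV. \<Sum>a\<in>UNIV.
       cst (B $ j $ k * g $ a $ j * g $ b $ k) * var a * var b)"
    by (simp add: quad_def sum_distrib_left sum_distrib_right cst_mult mult.assoc mult.left_commute)
  also have "\<dots> = quad (g ** B ** transpose g)"
    by (subst sum_reverse_4) (simp add: quad_def matrix_matrix_mult_def transpose_def cst_sum
        sum_distrib_left sum_distrib_right mult_ac)
  finally show ?thesis .
qed

subsection \<open>Non-degenerate forms\<close>

locale nondeg_form =
  fixes B C :: "'a::field_char_0^3^3"
  assumes B_sym: "transpose B = B" and BC: "B ** C = mat 1"
begin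

lemma CB: "C ** B = mat 1"
  using BC by (simp add: matrix_left_right_inverse)

lemma C_sym: "transpose C = C"
proof -
  have "transpose C ** B = mat 1"
    using arg_cong[OF BC, of transpose] by (simp add: matrix_transpose_mul B_sym transpose_mat)
  then have "transpose C ** B ** C = C" by simp
  then show ?thesis by (simp add: BC flip: matrix_mul_assoc)
qed

lemma B_sym': "B $ i $ j = B $ j $ i"
  using arg_cong[OF B_sym, of "\<lambda>M. M $ j $ i"] by (simp add: transpose_def)

lemma C_sym': "C $ i $ j = C $ j $ i"
  using arg_cong[OF C_sym, of "\<lambda>M. M $ j $ i"] by (simp add: transpose_def)

lemma CB_entry: "(\<Sum>j\<in>UNIV. C $ i $ j * B $ j $ k) = (if i = k then 1 else 0)"
  using arg_cong[OF CB, of "\<lambda>M. M $ i $ k"] by (simp add: matrix_matrix_mult_def mat_def)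

lemma der_quad: "der i (quad B) = 2 * lin (B $ i)"
proof -
  have *: "(\<Sum>k\<in>UNIV. cst (B $ j $ k) * var k) = lin (B $ j)" for j
    by (simp add: lin_def)
  have "quad B = (\<Sum>j\<in>UNIV. var j * lin (B $ j))"
    by (simp add: quad_def lin_def sum_distrib_left mult_ac)
  then have "der i (quad B) = (\<Sum>j\<in>UNIV. (if i
    = j then lin (B $ j) else 0) + cst (B $ i $ j) * var j)"
    by (simp add: der_var_mult B_sym'[of _ i] mult.commute)
  then show ?thesis by (simp add: sum.distrib *)
qed

lemma C_lin_B: "(\<Sum>j\<in>UNIV. cst (C $ k $ j) * lin (B $ j)) = var k"
proof -
  have "(\<Sum>j\<in>UNIV. cst (C $ k $ j) * lin (B $ j))
    = (\<Sum>j\<in>UNIV. \<Sum>l\<in>UNIV. cst (C $ k $ j * B $ j $ l) * var l)"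
    by (simp add: lin_def sum_distrib_left cst_mult mult.assoc)
  also have "\<dots> = (\<Sum>l\<in>UNIV. \<Sum>j\<in>UNIV. cst (C $ k $ j * B $ j $ l) * var l)"
    by (rule sum.swap)
  also have "\<dots> = (\<Sum>l\<in>UNIV. if k = l then var l else 0)"
    by (intro sum.cong refl) (simp add: CB_entry flip: sum_distrib_right cst_sum)
  finally show ?thesis by simp
qed

lemma lap_mult:
  "lap C (p * q) = lap C p * q + p * lap C q
     + 2 * (\<Sum>k\<in>UNIV. (\<Sum>j\<in>UNIV. cst (C $ k $ j) * der j p) * der k q)"
proof -
  have sw: "(\<Sum>j\<in>UNIV. \<Sum>k\<in>UNIV. cst (C $ j $ k) * (der k p * der j q))
    = (\<Sum>j\<in>UNIV. \<Sum>k\<in>UNIV. cst (C $ j $ k) * (der j p * der k q))"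
    by (subst sum.swap) (simp add: C_sym'[of _ i for i] C_sym' mult_ac)
  have "lap C (p * q) = (\<Sum>j\<in>UNIV. \<Sum>k\<in>UNIV. cst (C $ j $ k) * (der j (der k p) * q)
     + cst (C $ j $ k) * (p * der j (der k q))
     + (cst (C $ j $ k) * (der k p * der j q) + cst (C $ j $ k) * (der j p * der k q)))"
    unfolding lap_def by (intro sum.cong refl) (simp add: der_mult algebra_simps)
  also have "\<dots> = lap C p * q + p * lap C q
     + 2 * (\<Sum>j\<in>UNIV. \<Sum>k\<in>UNIV. cst (C $ j $ k) * (der k p * der j q))"
    unfolding sum.distrib sw
    by (simp add: lap_def sum_distrib_left sum_distrib_right mult.assoc mult.left_commute)
  finally show ?thesis by (simp add: sum_distrib_right mult.assoc)
qed

lemma lap_quad: "lap C (quad B) = 6"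
proof -
  have "lap C (quad B) = 2 * cst (\<Sum>j\<in>UNIV. \<Sum>k\<in>UNIV. C $ j $ k * B $ k $ j)"
    by (simp add: lap_def der_quad cst_sum cst_mult sum_distrib_left der_mult
        flip: cst_numeral) (simp add: mult_ac)
  then show ?thesis by (simp add: CB_entry cst_numeral)
qed

text \<open>The cross term of \<open>\<Delta> (Q p)\<close> is \<open>2 \<Sum> c\<^sub>j\<^sub>k \<partial>\<^sub>j Q \<partial>\<^sub>k p\<close>, and \<open>\<partial>\<^sub>j Q\<close> is twice a row of \<open>B\<close>
  applied to the variables, so that \<open>C = B\<^sup>-\<^sup>1\<close> leaves four times the Euler operator. The
  constant is \<open>\<Delta> Q = 2 tr (C B) = 6\<close>.\<close>

lemma lap_quad_mult: "lap C (quad B * p)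
    = quad B * lap C p + 6 * p + 4 * (\<Sum>k\<in>UNIV. var k * der k p)"
proof -
  have "(\<Sum>j\<in>UNIV. cst (C $ k $ j) * der j (quad B)) = 2 * var k" for k
    by (simp add: der_quad mult.left_commute C_lin_B flip: sum_distrib_left)
  then have "(\<Sum>k\<in>UNIV. (\<Sum>j\<in>UNIV. cst (C $ k $ j) * der j (quad B)) * der k p)
    = 2 * (\<Sum>k\<in>UNIV. var k * der k p)"
    by (simp add: mult.assoc sum_distrib_left)
  then show ?thesis
    by (simp add: lap_mult lap_quad add_ac)
qed

lemma lap_quad_mult_hom:
  "p \<in> hom m \<Longrightarrow> lap C (quad B * p) = quad B * lap C p + of_nat (4 * m + 6) * p"
  by (simp add: lap_quad_mult euler distrib_right mult.assoc add_ac)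

text \<open>The free parameter \<open>a\<close> makes the induction work: the equation for \<open>\<Delta> p\<close> has \<open>a + 4 e + 6\<close>
  in place of \<open>a\<close>.\<close>

lemma quad_lap_plus_surj:
  assumes "f \<in> hom d" "a > 0"
  shows "\<exists>p\<in>hom d. quad B * lap C p + of_nat a * p = f"
  using assms
proof (induction d arbitrary: a f rule: less_induct)
  case (less d)
  let ?i = "cst (inverse (of_nat a)) :: 'a tpoly"
  have ai: "of_nat a * (?i * q) = q" for q
    using less.prems(2) cst_inverse_mult(1)[of "of_nat a :: 'a" q] by (simp add: cst_of_nat)
  show ?case
  proof (cases "d < 2")
    case True
    have "?i * f \<in> hom d" by (intro hom_cst_mult less.prems)
    then show ?thesis using ai lap_hom_less_2[OF less.prems(1) True]
      by (intro bexI[of _ "?i * f"]) auto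
  next
    case False
    define e where "e = d - 2"
    have d: "d = Suc (Suc e)" using False by (simp add: e_def)
    have "lap C f \<in> hom e" using less.prems(1) lap_hom d by blast
    with less.IH[of e _ "a + 4 * e + 6"] obtain r where r: "r \<in> hom e"
      "quad B * lap C r + of_nat (a + 4 * e + 6) * r = lap C f"
      using d by auto
    \<comment> \<open>\<open>r\<close> is the prospective Laplacian of \<open>p\<close>; the equation then determines \<open>p\<close>.\<close>
    define p where "p = ?i * (f - quad B * r)"
    have p: "p \<in> hom d"
      unfolding p_def d using less.prems(1) d hom_quad_mult[OF r(1), of B]
      by (auto intro!: hom_cst_mult hom_diff)
    have "lap C p = ?i * (lap C f - lap C (quad B * r))"
      by (simp add: p_def)
    also have "lap C f - lap C (quad B * r) = of_nat a * r"
      by (simp add: lap_quad_mult_hom[OF r(1)] distrib_right mult.assoc add_ac flip: r(2))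
    also have "?i * (of_nat a * r) = r" using ai[of r] by (simp add: mult.left_commute)
    finally have "quad B * lap C p + of_nat a * p = f"
      by (simp only: p_def ai) simp
    with p show ?thesis by blast
  qed
qed

lemma quad_lap_plus_inj:
  assumes "p \<in> hom d" "a > 0" "quad B * lap C p + of_nat a * p = 0"
  shows "p = 0"
  using assms
proof (induction d arbitrary: a p rule: less_induct)
  case (less d)
  have ai: "q = 0" if "of_nat a * q = 0" for q :: "'a tpoly"
    using less.prems(2) cst_inverse_mult(2)[of "of_nat a :: 'a" q] that by (simp add: cst_of_nat)
  have "lap C p = 0"
  proof (cases "d < 2")
    case False
    define e where "e = d - 2"
    have d: "d = Suc (Suc e)" using False by (simp add: e_def)
    have r: "lap C p \<in> hom e" using less.prems(1) lap_hom d by blast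
    have "lap C (quad B * lap C p + of_nat a * p) = 0" by (simp add: less.prems)
    then have "quad B * lap C (lap C p) + of_nat (a + 4 * e + 6) * lap C p = 0"
      by (simp add: lap_quad_mult_hom[OF r] distrib_right mult.assoc add_ac)
    then show ?thesis using less.IH[of e "lap C p" "a + 4 * e + 6"] r d by simp
  qed (use lap_hom_less_2 less.prems(1) in blast)
  with less.prems(3) show ?case by (simp add: ai)
qed

lemma lap_quad_mult_surj_hom:
  assumes "f \<in> hom d" shows "\<exists>q\<in>hom d. lap C (quad B * q) = f"
  using quad_lap_plus_surj[OF assms, of "4 * d + 6"]
    by (metis lap_quad_mult_hom add_gr_0 zero_less_numeral)

lemma lap_quad_mult_inj_hom:
  assumes "q \<in> hom d" "lap C (quad B * q) = 0" shows "q = 0"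
  using quad_lap_plus_inj[OF assms(1), of "4 * d + 6"] assms by (simp add: lap_quad_mult_hom)

text \<open>In the highest degree the operator is \<open>\<Delta> (Q _)\<close>, which is onto; what is left over has lower
  degree.\<close>

lemma lap_shift_mult_surj: "\<exists>R. lap C ((quad B - cst c) * R) = f"
proof -
  obtain n where "f \<in> deg_lt n" using deg_lt_exists by blast
  then show ?thesis
  proof (induction n arbitrary: f)
    case 0
    then show ?case by (intro exI[of _ 0]) (simp add: deg_lt_0)
  next
    case (Suc n)
    obtain a b where ab: "a \<in> hom n" "b \<in> deg_lt n" "f = a + b"
      using deg_lt_Suc_split[OF Suc.prems] .
    obtain q where q: "q \<in> hom n" "lap C (quad B * q) = a" using lap_quad_mult_surj_hom[OF ab(1)]
      by blast
    have "cst c * lap C q \<in> deg_lt n"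
      using q(1) by (intro deg_lt_cst_mult lap_deg_lt' hom_subset_deg_lt)
    then obtain R where "lap C ((quad B - cst c) * R) = b + cst c * lap C q"
      using Suc.IH[of "b + cst c * lap C q"] ab deg_lt_add by blast
    then have "lap C ((quad B - cst c) * (q + R)) = f"
      using q ab by (simp add: left_diff_distrib distrib_left diff_eq_eq)
    then show ?case by blast
  qed
qed

text \<open>The highest homogeneous part of \<open>R\<close> lies in the kernel of \<open>\<Delta> (Q _)\<close>.\<close>

lemma lap_shift_mult_inj:
  assumes "lap C ((quad B - cst c) * R) = 0" shows "R = 0"
proof -
  obtain n where "R \<in> deg_lt n" using deg_lt_exists by blast
  then show ?thesis using assms
  proof (induction n arbitrary: R)
    case 0
    then show ?case by (simp add: deg_lt_0)
  next
    case (Suc n)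
    obtain a b where ab: "a \<in> hom n" "b \<in> deg_lt n" "R = a + b"
      using deg_lt_Suc_split[OF Suc.prems(1)] .
    have "lap C (quad B * a) = cst c * lap C a - (lap C (quad B * b) - cst c * lap C b)"
      using Suc.prems(2) ab(3) by (simp add: left_diff_distrib distrib_left)
        (simp add: algebra_simps)
    moreover have "cst c * lap C a - (lap C (quad B * b) - cst c * lap C b) \<in> deg_lt n"
      by (intro deg_lt_diff deg_lt_cst_mult lap_deg_lt' hom_subset_deg_lt ab lap_deg_lt
        deg_lt_quad_mult
          deg_lt_mono[OF ab(2)]) simp_all
    moreover have "lap C (quad B * a) \<in> hom n"
      by (intro lap_hom hom_quad_mult ab)
    ultimately have "lap C (quad B * a) = 0" using hom_deg_lt_zero by metis
    then have "a = 0" using lap_quad_mult_inj_hom ab(1) by blast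
    with Suc ab show ?case by simp
  qed
qed

lemma lap_quad_mult_inj: "lap C (quad B * R) = 0 \<Longrightarrow> R = 0"
  using lap_shift_mult_inj[of 0 R] by simp

subsection \<open>Harmonic decomposition\<close>

lemma harmonic_decomposition_exists:
  assumes "p \<in> hom d"
  shows "\<exists>g. (\<forall>k\<le>d div 2. g k \<in> hom (d - 2 * k) \<and> lap C (g k) = 0) \<and> p
      = (\<Sum>k\<le>d div 2. quad B ^ k * g k)"
  using assms
proof (induction d arbitrary: p rule: less_induct)
  case (less d)
  show ?case
  proof (cases "d < 2")
    case True
    then show ?thesis using less.prems lap_hom_less_2 by (intro exI[of _ "\<lambda>_. p"]) auto
  next
    case False
    define e where "e = d - 2"
    have d: "d = Suc (Suc e)" using False by (simp add: e_def)
    have "lap C p \<in> hom e" using less.prems lap_hom d by blast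
    then obtain q where q: "q \<in> hom e" "lap C (quad B * q) = lap C p"
      using lap_quad_mult_surj_hom by blast
    obtain g where g: "\<And>k. k \<le> e div 2 \<Longrightarrow> g k \<in> hom (e - 2 * k) \<and> lap C (g k) = 0"
      "q = (\<Sum>k\<le>e div 2. quad B ^ k * g k)"
      using less.IH[of e q] q(1) d by auto
    define h where "h = p - quad B * q"
    have h: "h \<in> hom d" "lap C h = 0"
      unfolding h_def using less.prems hom_quad_mult[OF q(1), of B] d q(2) by (auto intro: hom_diff)
    have "p = h + quad B * q" by (simp add: h_def)
    also have "\<dots> = (\<Sum>k\<le>d div 2. quad B ^ k * case_nat h g k)"
      using d by (simp add: g(2) sum.atMost_Suc_shift sum_distrib_left mult.assoc del:
        sum.atMost_Suc)
    finally have "p = (\<Sum>k\<le>d div 2. quad B ^ k * case_nat h g k)" .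
    moreover have "\<forall>k\<le>d div 2. case_nat h g k \<in> hom (d - 2 * k) \<and> lap C (case_nat h g k) = 0"
      using h g(1) d by (auto split: nat.split)
    ultimately show ?thesis by blast
  qed
qed

text \<open>The sum without its first term is \<open>Q S\<close>, and harmonicity of the first term gives \<open>\<Delta> (Q S) =
  0\<close>. As \<open>\<Delta> (Q _)\<close> is injective on all polynomials, \<open>S = 0\<close>.\<close>

lemma harmonic_decomposition_unique:
  assumes "\<And>k. k \<le> n \<Longrightarrow> lap C (g k) = 0" "(\<Sum>k\<le>n. quad B ^ k * g k) = 0" "k \<le> n"
  shows "g k = 0"
  using assms
proof (induction n arbitrary: g k)
  case (Suc n)
  let ?S = "\<Sum>k\<le>n. quad B ^ k * g (Suc k)"
  have eq: "g 0 + quad B * ?S = 0"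
    using Suc.prems(2) by (simp add: sum.atMost_Suc_shift sum_distrib_left mult.assoc del:
      sum.atMost_Suc)
  then have "lap C (g 0 + quad B * ?S) = 0" by simp
  then have S: "?S = 0"
    using Suc.prems(1)[of 0] lap_quad_mult_inj by simp
  then have "g (Suc j) = 0" if "j \<le> n" for j
    using Suc.IH[of "\<lambda>k. g (Suc k)" j] Suc.prems(1) that by auto
  moreover have "g 0 = 0" using eq S by simp
  ultimately show ?case using Suc.prems(3) by (cases k) auto
qed auto

end

subsection \<open>Maxwell polynomials\<close>

text \<open>The numerator of the iterated directional derivative of \<open>Q\<^sup>-\<^sup>1\<^sup>/\<^sup>2\<close>: the quotient rule
  applied to \<open>H / Q\<^sup>m\<^sup>+\<^sup>1\<^sup>/\<^sup>2\<close> gives the recursion, as \<open>\<nabla>\<^sub>u Q = 2 b(u, _)\<close>.\<close>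

fun maxwell_poly :: "'a::comm_ring_1^3^3 \<Rightarrow> ('a^3) list \<Rightarrow> 'a tpoly" where
  "maxwell_poly B [] = 1"
| "maxwell_poly B (u # us) = quad B * dir_der u (maxwell_poly B us)
     - of_nat (2 * length us + 1) * (lin (B *v u) * maxwell_poly B us)"

context nondeg_form
begin

lemma hom_maxwell_poly: "maxwell_poly B us \<in> hom (length us)"
proof (induction us)
  case (Cons u us)
  have "lin (B *v u) * maxwell_poly B us \<in> hom (Suc (length us))"
    using hom_mult[OF hom_lin(1) Cons] by simp
  then have 1: "of_nat (2 * length us + 1) * (lin (B *v u) * maxwell_poly B us) \<in> hom (Suc
    (length us))"
    by (simp only: cst_of_nat[symmetric] hom_cst_mult)
  have 2: "quad B * dir_der u (maxwell_poly B us) \<in> hom (Suc (length us))"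
  proof (cases "length us")
    case 0
    then show ?thesis by (simp add: dir_der_def)
  next
    case (Suc n)
    then show ?thesis using Cons by (auto intro!: hom_quad_mult hom_dir_der)
  qed
  from hom_diff[OF 2 1] show ?case by simp
qed (use hom_cst[of "1::'a"] in simp)

lemma lap_lin_mult: "lap C (lin (B *v u) * p) = lin (B *v u) * lap C p + 2 * dir_der u p"
proof -
  have l: "lap C (lin (B *v u)) = 0" by (simp add: lap_def)
  have "(\<Sum>j\<in>UNIV. cst (C $ k $ j) * der j (lin (B *v u))) = cst ((C *v (B *v u)) $ k)" for k
    by (simp add: matrix_vector_mult_def[of C] cst_sum cst_mult)
  then have "(\<Sum>j\<in>UNIV. cst (C $ k $ j) * der j (lin (B *v u))) = cst (u $ k)" for k
    by (simp add: matrix_vector_mul_assoc CB)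
  then show ?thesis by (simp add: lap_mult l dir_der_def)
qed

text \<open>Both terms of the recursion have a multiple of \<open>\<nabla>\<^sub>u H\<close> as Laplacian, since \<open>H\<close> is harmonic
  by induction; the factor \<open>2 m + 1\<close> is the one for which they cancel.\<close>

lemma lap_maxwell_poly: "lap C (maxwell_poly B us) = 0"
proof (induction us)
  case Nil
  then show ?case by (simp add: lap_def)
next
  case (Cons u us)
  let ?H = "maxwell_poly B us"
  have "lap C (quad B * dir_der u ?H) = of_nat (4 * length us + 2) * dir_der u ?H"
  proof (cases "length us")
    case 0
    then show ?thesis by (simp add: dir_der_def)
  next
    case (Suc n)
    have "dir_der u ?H \<in> hom n" using hom_maxwell_poly[of us] Suc by (intro hom_dir_der) simp
    then show ?thesis using Suc Cons
      by (simp add: lap_quad_mult_hom lap_dir_der algebra_simps)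
  qed
  moreover have "lap C (of_nat (2 * length us + 1) * (lin (B *v u) * ?H))
     = of_nat (2 * length us + 1) * (2 * dir_der u ?H)"
    by (simp only: lap_of_nat_mult lap_lin_mult Cons) simp
  ultimately show ?case by (simp add: algebra_simps)
qed

lemma maxwell_poly_mod_quad:
  "\<exists>R. maxwell_poly B us =
     cst (\<Prod>i<length us. - of_nat (2 * i + 1)) * (\<Prod>u\<leftarrow>us. lin (B *v u)) + quad B * R"
proof (induction us)
  case (Cons u us)
  then obtain R where R: "maxwell_poly B us =
     cst (\<Prod>i<length us. - of_nat (2 * i + 1)) * (\<Prod>u\<leftarrow>us. lin (B *v u)) + quad B * R" ..
  let ?n = "of_nat (2 * length us + 1) :: 'a tpoly" and ?c =
    "cst (\<Prod>i<length us. - of_nat (2 * i + 1)) :: 'a tpoly"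
  have c: "cst (\<Prod>i<length (u # us). - of_nat (2 * i + 1)) = - (?n * ?c)"
    by (simp add: cst_mult cst_minus cst_add cst_of_nat cst_numeral mult.commute del: of_nat_Suc)
  have "maxwell_poly B (u # us) = - (?n * ?c) * (\<Prod>u\<leftarrow>u # us. lin (B *v u))
    + quad B * (dir_der u (maxwell_poly B us) - ?n * lin (B *v u) * R)"
    unfolding maxwell_poly.simps(2) by (subst (2) R) (simp add: algebra_simps)
  then show ?case unfolding c by blast
qed (auto intro: exI[of _ 0])

text \<open>No nonzero multiple of \<open>Q\<close> is harmonic.\<close>

lemma harmonic_eqI:
  assumes "lap C p = 0" "lap C q = 0" "p = q + quad B * R"
  shows "p = q"
proof -
  have "lap C (quad B * R) = 0" using assms(1) unfolding assms(3) by (simp add: assms(2))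
  with assms(3) lap_quad_mult_inj show ?thesis by simp
qed

end

section \<open>Real polynomials as functions\<close>

lemma Const_eq_cst: "Const = cst"
  by (auto simp: Const_def cst_def)

lemma Var_eq_var: "Var = var"
  by (auto simp: Var_def var_def)

lemma pd_eq_der: "pd = der"
  by (intro ext) (simp add: pd_def der_def)

lemma homog_eq_hom: "homog = hom"
  by (intro ext) (simp add: homog_def hom_def mdeg_def)

lemma Qpoly_eq_quad: "Qpoly = quad"
  by (intro ext) (simp add: Qpoly_def quad_def Const_eq_cst Var_eq_var)

lemma Laplace_eq_lap: "Laplace B = lap (matrix_inv B)"
  by (intro ext) (simp add: Laplace_def lap_def Const_eq_cst pd_eq_der)

lemma reval_eq_ev: "reval = ev"
  by (intro ext) (simp add: reval_def ev_def peval_def ins_def)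

lemma psubst_eq_lin_subst: "psubst = lin_subst"
  by (intro ext) (simp add: psubst_def lin_subst_def peval_def ins_def Const_eq_cst Var_eq_var)

lemma matrix_inv_inverse:
  fixes A :: "'a::semiring_1^'n^'n"
  assumes "invertible A"
  shows "A ** matrix_inv A = mat 1" "matrix_inv A ** A = mat 1"
proof -
  have "A ** matrix_inv A = mat 1 \<and> matrix_inv A ** A = mat 1"
    using assms unfolding invertible_def matrix_inv_def by (rule someI_ex)
  then show "A ** matrix_inv A = mat 1" "matrix_inv A ** A = mat 1" by auto
qed

lemma nondeg_form_matrix_inv:
  fixes B :: "real^3^3"
  assumes "transpose B = B" "invertible B"
  shows "nondeg_form B (matrix_inv B)"
  by unfold_locales (use assms in \<open>simp_all add: matrix_inv_inverse\<close>)

lemma ev_has_vector_derivative: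
  fixes \<gamma> :: "real \<Rightarrow> 'a::real_normed_field^3"
  assumes "\<And>i. ((\<lambda>t. \<gamma> t $ i) has_vector_derivative \<gamma>' i) (at t within S)"
  shows "((\<lambda>t. ev p (\<gamma> t)) has_vector_derivative (\<Sum>i\<in>UNIV. \<gamma>' i * ev (der i p) (\<gamma> t)))
      (at t within S)"
proof (induction p rule: tpoly_induct)
  case (add p q)
  from has_vector_derivative_add[OF this] show ?case
    by (simp add: distrib_left sum.distrib)
next
  case (var k p)
  have "(\<Sum>i\<in>UNIV. \<gamma>' i * ev (der i (var k * p)) (\<gamma> t))
     = (\<Sum>i\<in>UNIV. (if i = k then \<gamma>' i * ev p (\<gamma> t) else 0) + \<gamma> t $ k * (\<gamma>' i * ev (der i p) (\<gamma> t)))"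
    by (intro sum.cong refl) (simp add: der_var_mult distrib_left mult.left_commute)
  also have "\<dots> = \<gamma> t $ k * (\<Sum>i\<in>UNIV. \<gamma>' i * ev (der i p) (\<gamma> t)) + \<gamma>' k * ev p (\<gamma> t)"
    by (simp add: sum.distrib sum_distrib_left)
  finally show ?case
    using has_vector_derivative_mult[OF assms[of k] var] by simp
qed (simp add: has_vector_derivative_const)

lemma ev_line_has_real_derivative:
  "((\<lambda>t. ev p (v + t *\<^sub>R axis i 1)) has_real_derivative ev (der i p) v) (at (0::real))"
proof -
  have "((\<lambda>t. (v + t *\<^sub>R axis i 1) $ j) has_vector_derivative (axis i 1 $ j)) (at (0::real))" for j
    by (auto intro!: derivative_eq_intros)
  from ev_has_vector_derivative[OF this, of p]
  show ?thesis
    by (simp add: has_real_derivative_iff_has_vector_derivative axis_def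
        if_distrib[of "\<lambda>x. x * _"] cong: if_cong)
qed

lemma continuous_on_ev [continuous_intros]:
  fixes f :: "'b::topological_space \<Rightarrow> 'a::real_normed_field^3"
  assumes "continuous_on S f" shows "continuous_on S (\<lambda>x. ev p (f x))"
  by (induction p rule: tpoly_induct) (auto intro!: continuous_intros assms)

lemma ev_along_line:
  fixes v w :: "'a::field_char_0^3"
  shows "\<exists>q. \<forall>t. poly q t = ev p (\<chi> i. v $ i + t * w $ i)"
proof (induction p rule: tpoly_induct)
  case (cst c)
  show ?case by (rule exI[of _ "[:c:]"]) simp
next
  case (add p q)
  then obtain a b where "\<forall>t. poly a t = ev p (\<chi> i. v $ i + t * w $ i)" "\<forall>t. poly b t
    = ev q (\<chi> i. v $ i + t * w $ i)"
    by blast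
  then show ?case by (intro exI[of _ "a + b"]) simp
next
  case (var i p)
  then obtain a where "\<forall>t. poly a t = ev p (\<chi> i. v $ i + t * w $ i)" by blast
  then show ?case by (intro exI[of _ "[:v $ i, w $ i:] * a"]) (simp add: distrib_right mult.assoc)
qed

lemma ev_zero_eq_lookup: "ev p 0 = coef p 0" for p :: "'a::comm_ring_1 tpoly"
  by (induction p rule: tpoly_induct) (simp_all add: lookup_add lookup_var_times, simp add: cst_def)

text \<open>The coefficients are, up to factorials, the values at \<open>0\<close> of the iterated derivatives.\<close>

lemma ev_zero_imp_zero:
  fixes p :: "real tpoly"
  assumes "\<And>v. ev p v = 0" shows "p = 0"
proof (rule poly_mapping_eqI)
  fix m
  show "coef p m = coef 0 m"
    using assms
  proof (induction "mdeg m" arbitrary: m p)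
    case 0
    then show ?case using mdeg_eq_0D[of m] ev_zero_eq_lookup[of p] by simp
  next
    case (Suc n)
    then obtain i where i: "coef m i \<noteq> 0"
      by (metis mdeg_def sum.neutral Suc_neq_Zero)
    define k where "k = m - Poly_Mapping.single i 1"
    have m: "m = Poly_Mapping.single i 1 + k"
      using exponent_split[OF i] by (simp add: k_def)
    have "n = mdeg k" using Suc(2) m mdeg_add[of "Poly_Mapping.single i 1" k] by simp
    moreover have "ev (der i p) v = 0" for v
      using ev_line_has_real_derivative[of p v i] Suc.prems DERIV_unique[OF _ DERIV_const[of 0]]
        by simp
    ultimately have "coef (der i p) k = 0"
      using Suc(1)[of k "der i p"] by simp
    then show ?case by (simp add: lookup_der m del: of_nat_Suc)
  qed
qed

lemma ev_zero_on_open_imp_zero: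
  fixes p :: "real tpoly"
  assumes "open U" "U \<noteq> {}" and z: "\<And>v. v \<in> U \<Longrightarrow> ev p v = 0" shows "p = 0"
proof (rule ev_zero_imp_zero)
  fix w
  obtain v where v: "v \<in> U" using assms by blast
  obtain q where q: "\<And>t. poly q t = ev p (\<chi> i. v $ i + t * (w - v) $ i)"
    using ev_along_line[of p v "w - v"] by blast
  have eq: "(\<chi> i. v $ i + t * (w - v) $ i) = v + t *\<^sub>R (w - v)" for t
    by (simp add: vec_eq_iff)
  have "open ((\<lambda>t::real. v + t *\<^sub>R (w - v)) -` U)"
    by (intro open_vimage assms continuous_intros)
  moreover have "0 \<in> (\<lambda>t::real. v + t *\<^sub>R (w - v)) -` U" using v by simp
  ultimately obtain e where e: "e > 0" "ball 0 e \<subseteq> (\<lambda>t::real. v + t *\<^sub>R (w - v)) -` U"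
    using open_contains_ball by metis
  have "q = 0"
  proof (rule ccontr)
    assume "q \<noteq> 0"
    then have "finite {t. poly q t = 0}" by (rule poly_roots_finite)
    moreover have "ball 0 e \<subseteq> {t. poly q t = 0}" using e(2) z by (auto simp only: q eq)
    ultimately have "finite (ball (0::real) e)" by (rule rev_finite_subset)
    then show False using e(1) by (simp add: ball_eq_greaterThanLessThan infinite_Ioo)
  qed
  then have "ev p (v + 1 *\<^sub>R (w - v)) = 0" by (metis q eq poly_0)
  then show "ev p w = 0" by simp
qed

section \<open>Polynomials vanishing on a level surface\<close>

lemma ev_quad_inner: "ev (quad B) v = v \<bullet> (B *v v)" for B :: "real^3^3"
  by (simp add: ev_quad inner_vec_def matrix_vector_mult_def sum_distrib_left mult_ac)

lemma ev_lin_inner: "ev (lin a) v = a \<bullet> v" for a :: "real^3"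
  by (simp add: ev_lin inner_vec_def)

lemma symmetric_form_commute:
  fixes B :: "real^3^3"
  assumes "transpose B = B"
  shows "u \<bullet> (B *v v) = v \<bullet> (B *v u)"
  by (metis assms dot_lmul_matrix inner_commute transpose_matrix_vector)

lemma quad_add_scale:
  fixes B :: "real^3^3"
  assumes "transpose B = B"
  shows "ev (quad B) (v + t *\<^sub>R e) = ev (quad B) v + 2 * t * (v \<bullet> (B *v e)) + t\<^sup>2 * ev (quad B) e"
proof -
  have "B *v (v + t *\<^sub>R e) = B *v v + t *\<^sub>R (B *v e)"
    by (simp add: matrix_vector_right_distrib matrix_vector_mult_scaleR)
  then show ?thesis
    using symmetric_form_commute[OF assms, of e v]
    by (simp add: ev_quad_inner inner_add_left inner_add_right algebra_simps power2_eq_square)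
qed

definition invariant_along :: "real^3 \<Rightarrow> real tpoly \<Rightarrow> bool" where
  "invariant_along e p \<longleftrightarrow> (\<forall>v t. ev p (v + t *\<^sub>R e) = ev p v)"

text \<open>Division with remainder by \<open>Q - c\<close> with respect to the coordinate \<open>l\<close> along \<open>e\<close>. Splitting
  each variable into a part invariant along \<open>e\<close> and a multiple of \<open>l\<close> avoids a change of
  coordinates. The form \<open>Q - Q(e) l\<^sup>2\<close> is invariant along \<open>e\<close>, whence \<open>l\<^sup>2\<close> can be eliminated.\<close>

lemma division_by_level_equation:
  fixes B :: "real^3^3" and e :: "real^3"
  assumes sym: "transpose B = B" and e: "ev (quad B) e \<noteq> 0"
  defines "l \<equiv> cst (inverse (ev (quad B) e)) * lin (B *v e)"
  shows "\<exists>R P0 P1. P = (quad B - cst c) * R + P0 + l * P1 \<and> invariant_along e P0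
      \<and> invariant_along e P1"
proof -
  let ?q = "ev (quad B) e"
  have l: "ev l v = (v \<bullet> (B *v e)) / ?q" for v
    by (simp add: l_def ev_lin_inner inner_commute field_simps)
  have l': "ev l (v + t *\<^sub>R e) = ev l v + t" for v t
    using e by (simp add: l inner_add_left add_divide_distrib) (simp add: ev_quad_inner)
  \<comment> \<open>the part of \<open>Q\<close> that is orthogonal to \<open>e\<close>\<close>
  define K where "K = quad B - cst ?q * (l * l)"
  have K: "invariant_along e K"
    unfolding invariant_along_def
  proof (intro allI)
    fix v t
    have "v \<bullet> (B *v e) = ?q * ev l v" using e by (simp add: l)
    then show "ev K (v + t *\<^sub>R e) = ev K v"
      by (simp add: K_def l' quad_add_scale[OF sym]) (simp add: algebra_simps power2_eq_square)
  qed
  have ll: "l * l = cst (inverse ?q) * ((quad B - cst c) + (cst c - K))"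
    using e by (simp add: K_def)
  define y where "y i = var i - cst (e $ i) * l" for i
  have y: "invariant_along e (y i)" for i
    by (auto simp: invariant_along_def y_def l' algebra_simps)
  have v: "var i = y i + cst (e $ i) * l" for i by (simp add: y_def)
  show ?thesis
  proof (induction P rule: tpoly_induct)
    case (cst a)
    show ?case
      by (rule exI[of _ 0], rule exI[of _
        "cst a"], rule exI[of _ 0]) (simp add: invariant_along_def)
  next
    case (add p q)
    then obtain R P0 P1 R' P0' P1' where *:
      "p = (quad B - cst c) * R + P0 + l * P1" "invariant_along e P0" "invariant_along e P1"
      "q = (quad B - cst c) * R' + P0' + l * P1'" "invariant_along e P0'" "invariant_along e P1'"
      by blast
    show ?case
      by (rule exI[of _ "R + R'"], rule exI[of _ "P0 + P0'"], rule exI[of _ "P1 + P1'"])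
        (use *(2,3,5,6) in \<open>simp add: *(1,4) invariant_along_def distrib_left add_ac\<close>)
  next
    case (var i p)
    then obtain R P0 P1 where *:
      "p = (quad B - cst c) * R + P0 + l * P1" "invariant_along e P0" "invariant_along e P1"
        by blast
    let ?k = "cst (e $ i) * cst (inverse ?q)"
    have "var i * p = (quad B - cst c) * (var i * R) + y i * P0 + l * (y i * P1 + cst (e $ i) * P0)
       + cst (e $ i) * (l * l) * P1"
      unfolding *(1) v[of i] by (simp add: algebra_simps)
    also have "\<dots> = (quad B - cst c) * (var i * R + ?k * P1)
       + (y i * P0 + ?k * (cst c - K) * P1) + l * (y i * P1 + cst (e $ i) * P0)"
      unfolding ll by (simp add: algebra_simps)
    finally show ?case
      by (intro exI[of _ "var i * R + ?k * P1"] exI[of _ "y i * P0 + ?k * (cst c - K) * P1"]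
            exI[of _ "y i * P1 + cst (e $ i) * P0"] conjI)
        (use *(2,3) y[of i] K in \<open>simp_all add: invariant_along_def\<close>)
  qed
qed

text \<open>Along \<open>e\<close> the equation of the level set of \<open>v0\<close> is a quadratic equation of which \<open>v0\<close> is a
  simple root, so that nearby lines in direction \<open>e\<close> meet the level set in two points. The two
  conditions are generic, but a vector that meets one of them may have to be perturbed to meet
  the other.\<close>

lemma transversal_direction:
  fixes B :: "real^3^3"
  assumes sym: "transpose B = B" and inv: "invertible B" and "v0 \<noteq> 0"
  obtains e where "ev (quad B) e \<noteq> 0" "v0 \<bullet> (B *v e) \<noteq> 0"
proof -
  let ?Q = "ev (quad B)"
  define e1 where "e1 = B *v v0"
  have "e1 \<noteq> 0"
    using inv \<open>v0 \<noteq> 0\<close> unfolding e1_def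
    by (metis invertible_def matrix_vector_mul_assoc matrix_vector_mul_lid
      matrix_vector_mult_0_right)
  then have b1: "v0 \<bullet> (B *v e1) > 0"
    using symmetric_form_commute[OF sym, of v0 e1] by (simp add: e1_def)
  have "?Q (v0 + 1 *\<^sub>R e1) - ?Q v0 - ?Q e1 \<noteq> 0"
    using b1 by (subst quad_add_scale[OF sym]) simp
  then have "?Q (v0 + 1 *\<^sub>R e1) \<noteq> 0 \<or> ?Q v0 \<noteq> 0 \<or> ?Q e1 \<noteq> 0" by linarith
  then obtain f where f: "?Q f \<noteq> 0" by blast
  show thesis
  proof (cases "?Q e1 \<noteq> 0 \<or> v0 \<bullet> (B *v f) \<noteq> 0")
    case True
    then show ?thesis using that b1 f by auto
  next
    case False
    have "?Q (f + 1 *\<^sub>R e1) + ?Q (f + (-1) *\<^sub>R e1) = 2 * ?Q f"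
      using False by (simp only: quad_add_scale[OF sym]) simp
    then obtain s :: real where s: "s \<noteq> 0" "?Q (f + s *\<^sub>R e1) \<noteq> 0"
      using f that[of 1] that[of "-1"] by fastforce
    have "v0 \<bullet> (B *v (f + s *\<^sub>R e1)) = s * (v0 \<bullet> (B *v e1))"
      using False by (simp add: matrix_vector_right_distrib matrix_vector_mult_scaleR
        inner_add_right)
    then show ?thesis using that[of "f + s *\<^sub>R e1"] s b1 by auto
  qed
qed

text \<open>The remainder of the division is affine along every line in direction \<open>e\<close>. On all lines
  near \<open>v0\<close> it vanishes at two points, so both of its coefficients vanish on an open set. The
  point \<open>v0 \<noteq> 0\<close> excludes the definite form with the single zero \<open>0\<close>.\<close>

lemma vanishing_on_level_set_imp_multiple:
  fixes B :: "real^3^3"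
  assumes sym: "transpose B = B" and inv: "invertible B"
    and v0: "v0 \<noteq> 0" "ev (quad B) v0 = c"
    and P: "\<And>v. ev (quad B) v = c \<Longrightarrow> ev P v = 0"
  shows "\<exists>R. P = (quad B - cst c) * R"
proof -
  obtain e where e: "ev (quad B) e \<noteq> 0" "v0 \<bullet> (B *v e) \<noteq> 0"
    using transversal_direction[OF sym inv v0(1)] .
  let ?q = "ev (quad B) e"
  define l where "l = cst (inverse ?q) * lin (B *v e)"
  obtain R P0 P1 where dec: "P = (quad B - cst c) * R + P0 + l * P1"
    and i: "invariant_along e P0" "invariant_along e P1"
    using division_by_level_equation[OF sym e(1), folded l_def] by blast
  have l': "ev l (v + t *\<^sub>R e) = ev l v + t" for v t
    using e by (simp add: l_def ev_lin_inner inner_add_right distrib_left)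
      (simp add: ev_quad_inner inner_commute)
  \<comment> \<open>a quarter of the discriminant of the equation \<open>Q(v + t e) = c\<close> in \<open>t\<close>\<close>
  define D where "D v = (v \<bullet> (B *v e))\<^sup>2 - ?q * (ev (quad B) v - c)" for v
  have "D v0 > 0" using e v0 by (simp add: D_def)
  have op: "open {v. D v > 0}"
    unfolding D_def by (intro open_Collect_less continuous_intros)
  have "ev P0 v = 0 \<and> ev P1 v = 0" if v: "D v > 0" for v
  proof -
    define t where "t s = (s * sqrt (D v) - v \<bullet> (B *v e)) / ?q" for s
    have "ev P0 v + (ev l v + t s) * ev P1 v = 0" if s: "s\<^sup>2 = 1" for s
    proof -
      have "(?q * t s + v \<bullet> (B *v e))\<^sup>2 = D v"
        using e v s by (simp add: t_def power_mult_distrib)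
      then have "?q * (ev (quad B) v + 2 * t s * (v \<bullet> (B *v e)) + (t s)\<^sup>2 * ?q - c) = 0"
        by (simp add: D_def power2_eq_square algebra_simps)
      then have "ev (quad B) (v + t s *\<^sub>R e) = c"
        using e by (simp add: quad_add_scale[OF sym])
      from P[OF this] this show ?thesis
        using i by (simp add: dec invariant_along_def l')
    qed
    from this[of 1] this[of "-1"]
    have *: "ev P0 v + (ev l v + t 1) * ev P1 v = 0" "ev P0 v + (ev l v + t (-1)) * ev P1 v = 0"
      by auto
    then have "(t 1 - t (-1)) * ev P1 v = 0" unfolding left_diff_distrib distrib_right by linarith
    moreover have "t 1 - t (-1) \<noteq> 0"
      using v e by (simp add: t_def flip: diff_divide_distrib)
    ultimately show ?thesis using * by simp
  qed
  then have "P0 = 0" "P1 = 0"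
    using ev_zero_on_open_imp_zero[OF op] \<open>D v0 > 0\<close> by blast+
  then show ?thesis using dec by auto
qed

text \<open>A nonempty open subset of the plane is infinite.\<close>

lemma two_dimensional_nonzero_point:
  assumes "two_dimensional S" obtains v where "v \<in> S" "v \<noteq> 0"
proof -
  obtain U and W :: "(real^2) set"
    where U: "openin (top_of_set S) U" "U \<noteq> {}" "open W" "U homeomorphic W"
    using assms unfolding two_dimensional_def by blast
  have "infinite W"
  proof
    assume "finite W"
    moreover have "W \<noteq> {}" using U by auto
    ultimately show False using U(3) finite_imp_not_open by blast
  qed
  then have "infinite U"
    using U(4) homeomorphic_finite[of U W] homeomorphic_sym[of U W] by blast
  then have "\<not> U \<subseteq> {0}" using infinite_super by blast
  then show thesis using that U(1) by (auto dest: openin_imp_subset)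
qed

section \<open>The Dirichlet problem\<close>

lemma dirichlet_unique_solution:
  fixes B :: "real^3^3"
  assumes sym: "transpose B = B" and inv: "invertible B"
    and v0: "v0 \<noteq> 0" "ev (quad B) v0 = c"
  shows "\<exists>!P. lap (matrix_inv B) P = M \<and> (\<forall>v. ev (quad B) v = c \<longrightarrow> ev P v = ev N v)"
proof -
  interpret nondeg_form B "matrix_inv B"
    by (rule nondeg_form_matrix_inv[OF sym inv])
  obtain R where "lap (matrix_inv B) ((quad B - cst c) * R) = M - lap (matrix_inv B) N"
    using lap_shift_mult_surj by blast
  then have "lap (matrix_inv B) (N + (quad B - cst c) * R) = M \<and>
     (\<forall>v. ev (quad B) v = c \<longrightarrow> ev (N + (quad B - cst c) * R) v = ev N v)"
    by simp
  moreover have "P = P'" if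
    "lap (matrix_inv B) P = M \<and> (\<forall>v. ev (quad B) v = c \<longrightarrow> ev P v = ev N v)"
    "lap (matrix_inv B) P' = M \<and> (\<forall>v. ev (quad B) v = c \<longrightarrow> ev P' v = ev N v)" for P P'
  proof -
    have "\<exists>S. P - P' = (quad B - cst c) * S"
      by (rule vanishing_on_level_set_imp_multiple[OF sym inv v0]) (use that in simp)
    then obtain S where S: "P - P' = (quad B - cst c) * S" ..
    have "lap (matrix_inv B) ((quad B - cst c) * S) = 0"
      using that by (simp flip: S)
    then show ?thesis using lap_shift_mult_inj S by fastforce
  qed
  ultimately show ?thesis by blast
qed

section \<open>Orthogonal frames\<close>

lemma lin_add: "lin (a + b) = lin a + lin b"
  by (simp add: lin_def cst_add distrib_right sum.distrib)

lemma lin_scale: "lin (c *s a) = cst c * lin a"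
  by (simp add: lin_def cst_mult sum_distrib_left mult.assoc)

text \<open>The coordinate of a vector along the \<open>j\<close>-th row of an orthogonal frame \<open>F\<close>.\<close>

definition frame_coord :: "'a::field^3^3 \<Rightarrow> 'a^3^3 \<Rightarrow> (3 \<Rightarrow> 'a) \<Rightarrow> 3 \<Rightarrow> 'a tpoly" where
  "frame_coord B F d j = lin (inverse (d j) *s (B *v (F $ j)))"

locale orthogonal_frame =
  fixes B F :: "'a::field_char_0^3^3" and d :: "3 \<Rightarrow> 'a"
  assumes frame: "F ** B ** transpose F = (\<chi> i j. if i = j then d i else 0)"
    and d_nz: "d j \<noteq> 0"
begin

abbreviation \<xi> :: "3 \<Rightarrow> 'a tpoly" where "\<xi> \<equiv> frame_coord B F d"

text \<open>A right inverse of \<open>F\<close> can be read off from the orthogonality relations; it is a left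
  inverse too.\<close>

lemma frame_dual: "(\<Sum>j\<in>UNIV. (inverse (d j) *s (B *v (F $ j))) $ a * F $ j $ i) = (if a
    = i then 1 else 0)"
proof -
  define G where "G = (\<chi> a j. (inverse (d j) *s (B *v (F $ j))) $ a)"
  have "(F ** G) $ i $ j = (if i = j then 1 else 0)" for i j
  proof -
    have "(F ** G) $ i $ j = inverse (d j) * (F ** B ** transpose F) $ i $ j"
      unfolding matrix_mul_assoc[symmetric]
      by (simp add: G_def matrix_matrix_mult_def matrix_vector_mult_def transpose_def
          sum_distrib_left mult_ac)
    then show ?thesis using d_nz by (simp add: frame)
  qed
  then have "F ** G = mat 1" by (simp add: vec_eq_iff mat_def)
  then have "G ** F = mat 1" by (simp add: matrix_left_right_inverse)
  then have "(G ** F) $ a $ i = (if a = i then 1 else 0)" by (simp add: mat_def)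
  then show ?thesis by (simp add: G_def matrix_matrix_mult_def)
qed

lemma var_frame: "var i = (\<Sum>j\<in>UNIV. cst (F $ j $ i) * \<xi> j)"
proof -
  have "(\<Sum>j\<in>UNIV. cst (F $ j $ i) * \<xi> j)
    = (\<Sum>j\<in>UNIV. \<Sum>a\<in>UNIV. cst ((inverse (d j) *s (B *v (F $ j))) $ a * F $ j $ i) * var a)"
    by (simp add: frame_coord_def lin_def sum_distrib_left cst_mult mult_ac)
  also have "\<dots> = (\<Sum>a\<in>UNIV. \<Sum>j\<in>UNIV. cst ((inverse (d j) *s (B *v (F $ j))) $ a * F $ j $ i)
    * var a)"
    by (rule sum.swap)
  also have "\<dots> = (\<Sum>a\<in>UNIV. if a = i then var a else 0)"
    unfolding sum_distrib_right[symmetric] cst_sum[symmetric] frame_dual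
      by (intro sum.cong refl) simp
  finally show ?thesis by simp
qed

lemma quad_frame: "transpose B = B \<Longrightarrow> quad B = (\<Sum>j\<in>UNIV. cst (d j) * \<xi> j ^ 2)"
proof -
  assume sym: "transpose B = B"
  have B: "B $ i $ j = B $ j $ i" for i j
    using arg_cong[OF sym, of "\<lambda>M. M $ j $ i"] by (simp add: transpose_def)
  have "quad B = (\<Sum>i\<in>UNIV. var i * lin (B $ i))"
    by (simp add: quad_def lin_def sum_distrib_left mult_ac)
  also have "\<dots> = (\<Sum>i\<in>UNIV. \<Sum>j\<in>UNIV. cst (F $ j $ i) * \<xi> j * lin (B $ i))"
    by (subst var_frame) (simp add: sum_distrib_right)
  also have "\<dots> = (\<Sum>j\<in>UNIV. \<Sum>i\<in>UNIV. cst (F $ j $ i) * \<xi> j * lin (B $ i))"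
    by (rule sum.swap)
  also have "\<dots> = (\<Sum>j\<in>UNIV. \<xi> j * lin (B *v (F $ j)))"
  proof (intro sum.cong refl)
    fix j
    have "(\<Sum>i\<in>UNIV. cst (F $ j $ i) * lin (B $ i)) = lin (B *v (F $ j))"
    proof -
      have "(\<Sum>i\<in>UNIV. cst (F $ j $ i) * lin (B $ i))
        = (\<Sum>i\<in>UNIV. \<Sum>k\<in>UNIV. cst (F $ j $ i * B $ i $ k) * var k)"
        by (simp add: lin_def sum_distrib_left cst_mult mult.assoc)
      also have "\<dots> = (\<Sum>k\<in>UNIV. \<Sum>i\<in>UNIV. cst (F $ j $ i * B $ i $ k) * var k)"
        by (rule sum.swap)
      also have "\<dots> = (\<Sum>k\<in>UNIV. \<Sum>i\<in>UNIV. cst (B $ k $ i * F $ j $ i) * var k)"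
        by (intro sum.cong refl) (metis B mult.commute)
      also have "\<dots> = lin (B *v (F $ j))"
        by (simp add: lin_def matrix_vector_mult_def cst_sum sum_distrib_right)
      finally show ?thesis .
    qed
    from this[symmetric] show "(\<Sum>i\<in>UNIV. cst (F $ j $ i) * \<xi> j * lin (B $ i))
      = \<xi> j * lin (B *v (F $ j))"
      by (simp add: sum_distrib_left mult_ac)
  qed
  also have "\<dots> = (\<Sum>j\<in>UNIV. cst (d j) * \<xi> j ^ 2)"
    using d_nz by (intro sum.cong refl)
      (simp add: frame_coord_def lin_scale power2_eq_square mult.left_commute)
  finally show ?thesis .
qed

lemma frame_separates:
  assumes "\<And>k. (\<Sum>i\<in>UNIV. a $ i * F $ k $ i) = 0" shows "a = 0"
proof -
  have "a $ b = 0" for b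
  proof -
    let ?G = "\<lambda>j. (inverse (d j) *s (B *v (F $ j))) $ b"
    have "a $ b = (\<Sum>i\<in>UNIV. a $ i * (\<Sum>j\<in>UNIV. ?G j * F $ j $ i))"
      unfolding frame_dual by (simp add: if_distrib[of "\<lambda>x. _ * x"] cong: if_cong)
    also have "\<dots> = (\<Sum>i\<in>UNIV. \<Sum>j\<in>UNIV. ?G j * (a $ i * F $ j $ i))"
      by (simp add: sum_distrib_left mult.left_commute)
    also have "\<dots> = (\<Sum>j\<in>UNIV. \<Sum>i\<in>UNIV. ?G j * (a $ i * F $ j $ i))"
      by (rule sum.swap)
    finally show ?thesis using assms by (simp flip: sum_distrib_left)
  qed
  then show ?thesis by (simp add: vec_eq_iff)
qed

lemma ev_\<xi>: "ev (\<xi> j) (\<chi> i. \<Sum>k\<in>UNIV. t k * F $ k $ i) = t j"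
proof -
  have "ev (\<xi> j) (\<chi> i. \<Sum>k\<in>UNIV. t k * F $ k $ i)
    = inverse (d j) * (\<Sum>i\<in>UNIV. \<Sum>k\<in>UNIV. t k * ((B *v (F $ j)) $ i * F $ k $ i))"
    by (simp add: frame_coord_def ev_lin sum_distrib_left mult_ac)
  also have "(\<Sum>i\<in>UNIV. \<Sum>k\<in>UNIV. t k * ((B *v (F $ j)) $ i * F $ k $ i))
    = (\<Sum>k\<in>UNIV. \<Sum>i\<in>UNIV. t k * ((B *v (F $ j)) $ i * F $ k $ i))"
    by (rule sum.swap)
  also have "\<dots> = (\<Sum>k\<in>UNIV. t k * (F ** B ** transpose F) $ k $ j)"
    unfolding matrix_mul_assoc[symmetric]
    by (simp add: matrix_matrix_mult_def matrix_vector_mult_def transpose_def mult_ac flip: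
      sum_distrib_left)
  also have "\<dots> = t j * d j"
    by (simp add: frame if_distrib[of "\<lambda>x. _ * x"] cong: if_cong)
  finally show ?thesis using d_nz by simp
qed

end

text \<open>Fewer than three vectors leave some \<open>u \<noteq> 0\<close> orthogonal to \<open>E\<close>. Non-degeneracy provides \<open>w\<close>,
  also orthogonal to \<open>E\<close>, with \<open>b(u, w) \<noteq> 0\<close>, and by polarisation \<open>Q\<close> is nonzero at \<open>u\<close>, at \<open>w\<close>
  or at \<open>u + w\<close>.\<close>

lemma polar_nonzero_vector:
  fixes B :: "real^3^3"
  assumes sym: "transpose B = B" and inv: "invertible B" and "finite E"
    and E: "\<And>e. e \<in> E \<Longrightarrow> e \<bullet> (B *v e) \<noteq> 0"
    "\<And>e e'. e \<in> E \<Longrightarrow> e' \<in> E \<Longrightarrow> e \<noteq> e' \<Longrightarrow> e \<bullet> (B *v e') = 0"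
    and "card E < 3"
  obtains w where "w \<bullet> (B *v w) \<noteq> 0" "\<And>e. e \<in> E \<Longrightarrow> e \<bullet> (B *v w) = 0"
proof -
  have "dim ((*v) B ` E) < DIM(real^3)"
    using dim_le_card[of "(*v) B ` E" "(*v) B ` E"] card_image_le[OF \<open>finite E\<close>, of "(*v) B"] assms
    by (auto simp: span_superset)
  then obtain u where u: "u \<noteq> 0" "\<And>y. y \<in> span ((*v) B ` E) \<Longrightarrow> orthogonal u y"
    using orthogonal_to_subspace_exists by blast
  have uE: "e \<bullet> (B *v u) = 0" if "e \<in> E" for e
    using u(2)[of "B *v e"] that
    by (simp add: orthogonal_def span_base symmetric_form_commute[OF sym, of e u])
  define v where "v = B *v u"
  define w where "w = v - (\<Sum>e\<in>E. ((v \<bullet> (B *v e)) / (e \<bullet> (B *v e))) *\<^sub>R e)"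
  have "v \<noteq> 0"
    using inv u(1) unfolding v_def
    by (metis invertible_def matrix_vector_mul_assoc matrix_vector_mul_lid
      matrix_vector_mult_0_right)
  then have uv: "w \<bullet> (B *v u) \<noteq> 0"
    using uE by (simp add: w_def inner_diff_left inner_sum_left v_def)
  have wE: "w \<bullet> (B *v e) = 0" if "e \<in> E" for e
  proof -
    have "(\<Sum>e'\<in>E. ((v \<bullet> (B *v e')) / (e' \<bullet> (B *v e'))) * (e' \<bullet> (B *v e)))
      = (\<Sum>e'\<in>E. if e' = e then v \<bullet> (B *v e) else 0)"
      using E that by (intro sum.cong refl) auto
    then show ?thesis using that \<open>finite E\<close> by (simp add: w_def inner_diff_left inner_sum_left)
  qed
  have *: "e \<bullet> (B *v w) = 0" "e \<bullet> (B *v (u + w)) = 0" if "e \<in> E" for e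
    using wE[OF that] uE[OF that]
    by (simp_all add: symmetric_form_commute[OF sym, of e w] matrix_vector_right_distrib
      inner_add_right)
  have "(u + w) \<bullet> (B *v (u + w)) = u \<bullet> (B *v u) + w \<bullet> (B *v w) + 2 * (w \<bullet> (B *v u))"
    by (simp add: matrix_vector_right_distrib inner_add_left inner_add_right
        symmetric_form_commute[OF sym, of u w])
  then have "u \<bullet> (B *v u) \<noteq> 0 \<or> w \<bullet> (B *v w) \<noteq> 0 \<or> (u + w) \<bullet> (B *v (u + w)) \<noteq> 0"
    using uv by auto
  then show thesis using that[of u] that[of w] that[of "u + w"] uE * by metis
qed

definition frame_of :: "'a^3 \<Rightarrow> 'a^3 \<Rightarrow> 'a^3 \<Rightarrow> 'a^3^3" where
  "frame_of x y z = (\<chi> i. if i = 1 then x else if i = 2 then y else z)"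

lemma frame_of_nth [simp]: "frame_of x y z $ 1 = x" "frame_of x y z $ 2 = y" "frame_of x y z $ 3
    = z"
  by (simp_all add: frame_of_def)

lemma real_frame_entry: "(F ** B ** transpose F) $ i $ j = F $ i \<bullet> (B *v (F $ j))"
  for B F :: "real^3^3"
  unfolding matrix_mul_assoc[symmetric]
  by (simp add: matrix_matrix_mult_def matrix_vector_mult_def transpose_def inner_vec_def)

lemma orthogonal_frame_of:
  fixes B :: "real^3^3"
  assumes sym: "transpose B = B"
    and "x \<bullet> (B *v y) = 0" "x \<bullet> (B *v z) = 0" "y \<bullet> (B *v z) = 0"
    and "x \<bullet> (B *v x) \<noteq> 0" "y \<bullet> (B *v y) \<noteq> 0" "z \<bullet> (B *v z) \<noteq> 0"
  shows "orthogonal_frame B (frame_of x y z) (\<lambda>i. frame_of x y z $ i \<bullet> (B *v (frame_of x y z $ i)))"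
proof
  let ?F = "frame_of x y z"
  have o: "?F $ i \<bullet> (B *v (?F $ j)) = 0" if "i \<noteq> j" for i j
    using exhaust_3[of i] exhaust_3[of j] that assms symmetric_form_commute[OF sym, of x y]
      symmetric_form_commute[OF sym, of x z] symmetric_form_commute[OF sym, of y z]
    by (elim disjE) simp_all
  show "?F ** B ** transpose ?F = (\<chi> i j. if i = j then ?F $ i \<bullet> (B *v (?F $ i)) else 0)"
    using o by (simp add: vec_eq_iff real_frame_entry)
  show "?F $ j \<bullet> (B *v (?F $ j)) \<noteq> 0" for j
    using exhaust_3[of j] assms by (elim disjE) simp_all
qed

lemma orthogonal_frame_exists:
  fixes B :: "real^3^3"
  assumes sym: "transpose B = B" and inv: "invertible B"
  obtains F where "orthogonal_frame B F (\<lambda>i. F $ i \<bullet> (B *v (F $ i)))"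
proof -
  obtain x where x: "x \<bullet> (B *v x) \<noteq> 0"
    by (rule polar_nonzero_vector[OF sym inv, of "{}"]) auto
  obtain y where y: "y \<bullet> (B *v y) \<noteq> 0" "x \<bullet> (B *v y) = 0"
    by (rule polar_nonzero_vector[OF sym inv, of "{x}"]) (use x in auto)
  have yx: "y \<bullet> (B *v x) = 0" using symmetric_form_commute[OF sym, of x y] y by simp
  obtain z where z: "z \<bullet> (B *v z) \<noteq> 0" "x \<bullet> (B *v z) = 0" "y \<bullet> (B *v z) = 0"
    by (rule polar_nonzero_vector[OF sym inv, of "{x, y}"]) (use x y yx
      in \<open>auto simp: card_insert_if\<close>)
  show thesis by (rule that[OF orthogonal_frame_of[OF sym y(2) z(2,3) x y(1) z(1)]])
qed

section \<open>Complexification\<close>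

abbreviation cmat :: "real^3^3 \<Rightarrow> complex^3^3" where
  "cmat \<equiv> map_matrix of_real"

definition complexify :: "real tpoly \<Rightarrow> complex tpoly" where
  "complexify p = ins (\<lambda>c. cst (of_real c)) var p"

interpretation complexify_hom: coeff_hom "\<lambda>c. cst (complex_of_real c)"
  by unfold_locales (auto simp: cst_add cst_mult)

interpretation of_real_hom: coeff_hom complex_of_real
  by unfold_locales auto

lemma complexify_simps [simp]:
  "complexify 0 = 0" "complexify 1 = 1" "complexify (cst c) = cst (of_real c)" "complexify (var i)
    = var i"
  "complexify (p + q) = complexify p + complexify q" "complexify (p - q)
    = complexify p - complexify q"
  "complexify (- p) = - complexify p" "complexify (p * q) = complexify p * complexify q"
  "complexify (p ^ n) = complexify p ^ n"
  "complexify (sum f S) = (\<Sum>s\<in>S. complexify (f s))" "complexify (prod g T)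
    = (\<Prod>s\<in>T. complexify (g s))"
  "complexify (of_nat n) = of_nat n"
  by (simp_all add: complexify_def)

lemma ceval_eq_ev: "ceval p v = ev (complexify p) v"
proof -
  have "ins of_real (\<lambda>i. v $ i) p = ev (complexify p) v"
    by (induction p rule: tpoly_induct) simp_all
  then show ?thesis by (simp add: ceval_def peval_def ins_def)
qed

lemma ev_complexify_cvec: "ev (complexify p) (cvec v) = of_real (ev p v)"
  by (induction p rule: tpoly_induct) (simp_all add: cvec_def)

lemma der_complexify: "der i (complexify p) = complexify (der i p)"
  by (induction p rule: tpoly_induct) (simp_all add: der_var_mult)

lemma hom_complexify: "p \<in> hom d \<Longrightarrow> complexify p \<in> hom d"
  by (induction rule: hom_induct) (simp_all add: hom_add hom_var_mult)

lemma complexify_quad: "complexify (quad B) = quad (cmat B)"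
  by (simp add: quad_def map_matrix_def)

lemma complexify_lin: "complexify (lin a) = lin (cvec a)"
  by (simp add: lin_def cvec_def)

lemma complexify_lap: "complexify (lap C p) = lap (cmat C) (complexify p)"
  by (simp add: lap_def map_matrix_def der_complexify)

lemma cvec_matrix_vector_mult: "cmat B *v cvec u = cvec (B *v u)"
  by (simp add: vec_eq_iff cvec_def matrix_vector_mult_def map_matrix_def)

lemma complexify_maxwell_poly:
  "complexify (maxwell_poly B us) = maxwell_poly (cmat B) (map cvec us)"
proof (induction us)
  case (Cons u us)
  have "complexify (dir_der u p) = dir_der (cvec u) (complexify p)" for p
    by (simp add: dir_der_def cvec_def der_complexify)
  then show ?case using Cons
    by (simp add: complexify_quad complexify_lin cvec_matrix_vector_mult del: of_nat_add
      of_nat_mult)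
qed simp

lemma map_matrix_mult: "map_matrix complex_of_real (A ** B) = map_matrix of_real A ** cmat B"
  by (simp add: vec_eq_iff map_matrix_def matrix_matrix_mult_def)

lemma map_matrix_transpose: "map_matrix f (transpose A) = transpose (map_matrix f A)"
  by (simp add: vec_eq_iff map_matrix_def transpose_def)

lemma map_matrix_mat_1: "map_matrix complex_of_real (mat 1) = mat 1"
  by (simp add: vec_eq_iff map_matrix_def mat_def)

lemma nondeg_form_complexify:
  assumes "nondeg_form B C"
  shows "nondeg_form (cmat B) (cmat C)"
proof -
  interpret nondeg_form B C by fact
  show ?thesis
    by unfold_locales
      (simp_all add: B_sym BC map_matrix_mat_1 flip: map_matrix_transpose map_matrix_mult)
qed

lemma orthogonal_frame_complexify:
  assumes "orthogonal_frame B F d"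
  shows "orthogonal_frame (cmat B) (cmat F) (\<lambda>j. of_real (d j))"
proof -
  interpret orthogonal_frame B F d by fact
  show ?thesis
    by unfold_locales
      (simp_all add: d_nz frame flip: map_matrix_transpose map_matrix_mult, simp add:
        map_matrix_def vec_eq_iff)
qed

section \<open>Binary forms on the conic\<close>

text \<open>Modulo \<open>X Z - Y\<^sup>2\<close> the ratio \<open>X : Y : Z\<close> is \<open>s\<^sup>2 : s : 1\<close>. This is the monomial of degree
  \<open>m\<close> that represents \<open>s\<^sup>j\<close>, with exponent at most one at \<open>Y\<close>.\<close>

definition conic_monomial :: "'a::field_char_0 tpoly \<Rightarrow> 'a tpoly \<Rightarrow> 'a tpoly \<Rightarrow> nat \<Rightarrow> nat \<Rightarrow> 'a tpoly"
  where
  "conic_monomial X Y Z m j = X ^ (j div 2) * Y ^ (j mod 2) * Z ^ (m - Suc j div 2)"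

definition conic_lift :: "'a::field_char_0 tpoly \<Rightarrow> 'a tpoly \<Rightarrow> 'a tpoly \<Rightarrow> nat \<Rightarrow> 'a poly \<Rightarrow> 'a tpoly"
  where
  "conic_lift X Y Z m f = (\<Sum>j\<le>2 * m. cst (coeff f j) * conic_monomial X Y Z m j)"

lemma conic_lift_add: "conic_lift X Y Z m (f + g) = conic_lift X Y Z m f + conic_lift X Y Z m g"
  by (simp add: conic_lift_def cst_add distrib_right sum.distrib)

lemma conic_lift_smult: "conic_lift X Y Z m (smult c f) = cst c * conic_lift X Y Z m f"
  by (simp add: conic_lift_def cst_mult sum_distrib_left mult.assoc)

lemma conic_lift_X:
  "conic_lift X Y Z (Suc m) (pCons 0 (pCons 0 f)) = X * conic_lift X Y Z m f"
proof -
  have X: "conic_monomial X Y Z (Suc m) (Suc (Suc j)) = X * conic_monomial X Y Z m j" for j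
    by (simp add: conic_monomial_def mult.assoc)
  have "2 * Suc m = Suc (Suc (2 * m))" by simp
  then show ?thesis
    by (simp add: conic_lift_def sum.atMost_Suc_shift X sum_distrib_left mult.left_commute
        del: sum.atMost_Suc)
qed

lemma conic_lift_Z:
  assumes "degree f \<le> 2 * m"
  shows "conic_lift X Y Z (Suc m) f = Z * conic_lift X Y Z m f"
proof -
  have Z: "conic_monomial X Y Z (Suc m) j = Z * conic_monomial X Y Z m j" if "j \<le> 2 * m" for j
  proof -
    have "Suc m - Suc j div 2 = Suc (m - Suc j div 2)" using that by linarith
    then show ?thesis by (simp add: conic_monomial_def mult_ac)
  qed
  have "2 * Suc m = Suc (Suc (2 * m))" by simp
  then show ?thesis using assms
    by (simp add: conic_lift_def coeff_eq_0 Z sum_distrib_left mult.left_commute)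
qed

lemma conic_lift_Y:
  assumes "degree f \<le> 2 * m"
  shows "X * Z - Y ^ 2 dvd Y * conic_lift X Y Z m f - conic_lift X Y Z (Suc m) (pCons 0 f)"
proof -
  have Y: "X * Z - Y ^ 2 dvd Y * conic_monomial X Y Z m j - conic_monomial X Y Z (Suc m) (Suc j)"
    if j: "j \<le> 2 * m" for j
  proof (cases "even j")
    case True
    then have "Suc j div 2 = j div 2" "j mod 2 = 0" "Suc j mod 2 = 1"
      by presburger+
    then show ?thesis by (simp add: conic_monomial_def mult_ac)
  next
    case False
    then obtain i where i: "j = 2 * i + 1" using oddE by blast
    then have "m - i = Suc (m - Suc i)" using j by linarith
    moreover have "Suc (i * 2) mod 2 = 1" by presburger
    ultimately have "Y * conic_monomial X Y Z m j - conic_monomial X Y Z (Suc m) (Suc j)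
      = (X * Z - Y ^ 2) * (- (X ^ i * Z ^ (m - Suc i)))"
      by (simp add: conic_monomial_def i power2_eq_square algebra_simps)
    then show ?thesis by simp
  qed
  have "2 * Suc m = Suc (Suc (2 * m))" by simp
  then have "conic_lift X Y Z (Suc m) (pCons 0 f)
    = (\<Sum>j\<le>Suc (2 * m). cst (coeff f j) * conic_monomial X Y Z (Suc m) (Suc j))"
    by (simp add: conic_lift_def sum.atMost_Suc_shift del: sum.atMost_Suc)
  also have "\<dots> = (\<Sum>j\<le>2 * m. cst (coeff f j) * conic_monomial X Y Z (Suc m) (Suc j))"
    using assms by (simp add: coeff_eq_0)
  finally have "Y * conic_lift X Y Z m f - conic_lift X Y Z (Suc m) (pCons 0 f) = (\<Sum>j\<le>2 * m.
     cst (coeff f j) * (Y * conic_monomial X Y Z m j - conic_monomial X Y Z (Suc m) (Suc j)))"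
    by (simp add: conic_lift_def sum_distrib_left right_diff_distrib sum_subtractf
      mult.left_commute)
  also have "X * Z - Y ^ 2 dvd \<dots>"
    using Y by (intro dvd_sum) auto
  finally show ?thesis .
qed

text \<open>The lift turns multiplication by a quadratic polynomial into multiplication by a linear
  form.\<close>

lemma conic_lift_linear_mult:
  assumes "degree f \<le> 2 * m"
  shows "X * Z - Y ^ 2 dvd (cst a * X + cst b * Y + cst c * Z) * conic_lift X Y Z m f
     - conic_lift X Y Z (Suc m) ([:c, b, a:] * f)"
proof -
  have "[:c, b, a:] * f = smult c f + smult b (pCons 0 f) + smult a (pCons 0 (pCons 0 f))"
    by simp
  then have "(cst a * X + cst b * Y + cst c * Z) * conic_lift X Y Z m f
     - conic_lift X Y Z (Suc m) ([:c, b, a:] * f)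
     = cst b * (Y * conic_lift X Y Z m f - conic_lift X Y Z (Suc m) (pCons 0 f))"
    by (simp only: conic_lift_add conic_lift_smult conic_lift_X conic_lift_Z[OF assms])
      (simp add: algebra_simps)
  then show ?thesis using conic_lift_Y[OF assms] by (metis dvd_mult)
qed

text \<open>Forms of degree \<open>m\<close> on the conic are polynomials of degree at most \<open>2 m\<close> in its parameter.\<close>

lemma hom_congruent_conic_lift:
  assumes v: "\<And>i. \<exists>a b c. var i = cst a * X + cst b * Y + cst c * Z"
    and "G \<in> hom m"
  shows "\<exists>f. degree f \<le> 2 * m \<and> X * Z - Y ^ 2 dvd G - conic_lift X Y Z m f"
  using assms(2)
proof (induction rule: hom_induct)
  case (cst c)
  show ?case by (rule exI[of _ "[:c:]"]) (simp add: conic_lift_def conic_monomial_def)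
next
  case (add d p q)
  then obtain f g where "degree f \<le> 2 * d" "X * Z - Y ^ 2 dvd p - conic_lift X Y Z d f"
    "degree g \<le> 2 * d" "X * Z - Y ^ 2 dvd q - conic_lift X Y Z d g" by blast
  then show ?case
    by (intro exI[of _ "f + g"]) (auto simp: conic_lift_add add_diff_add degree_add_le)
next
  case (var d i p)
  then obtain f where f: "degree f \<le> 2 * d" "X * Z - Y ^ 2 dvd p - conic_lift X Y Z d f" by blast
  obtain a b c where abc: "var i = cst a * X + cst b * Y + cst c * Z" using v by blast
  have "X * Z - Y ^ 2 dvd var i * (p - conic_lift X Y Z d f)
     + (var i * conic_lift X Y Z d f - conic_lift X Y Z (Suc d) ([:c, b, a:] * f))"
    unfolding abc by (intro dvd_add dvd_mult f conic_lift_linear_mult)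
  then have "X * Z - Y ^ 2 dvd var i * p - conic_lift X Y Z (Suc d) ([:c, b, a:] * f)"
    by (simp only: right_diff_distrib) simp
  moreover have "degree ([:c, b, a:] * f) \<le> 2 * Suc d"
  proof -
    have "degree ([:c, b, a:] * f) \<le> degree [:c, b, a:] + degree f" by (rule degree_mult_le)
    also have "\<dots> \<le> 2 + 2 * d" by (intro add_mono f(1)) simp
    finally show ?thesis by simp
  qed
  ultimately show ?case by blast
qed

lemma poly_degree_2_expand: "degree q \<le> 2 \<Longrightarrow> q = [:coeff q 0, coeff q 1, coeff q 2:]"
  by (rule poly_eqI) (auto simp: coeff_pCons coeff_eq_0 numeral_2_eq_2 split: nat.split)

text \<open>Factors of degree less than two stand for roots at infinity of the parameter.\<close>

lemma complex_poly_factor_quadratics: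
  fixes f :: "complex poly"
  assumes "degree f \<le> 2 * m"
  shows "\<exists>c qs. length qs = m \<and> (\<forall>q\<in>set qs. degree q \<le> 2) \<and> f = smult c (prod_list qs)"
  using assms
proof (induction m arbitrary: f)
  case 0
  then obtain c where "f = [:c:]" using degree_0_id by (metis le_zero_eq mult_0_right)
  then show ?case by (intro exI[of _ c] exI[of _ "[]"]) simp
next
  case (Suc m)
  have root: "\<exists>a g. p = [:-a, 1:] * g \<and> degree p = Suc (degree g)" if "degree p > 0" for p ::
    "complex poly"
  proof -
    have "\<exists>a. poly p a = 0"
      using fundamental_theorem_of_algebra[of p] that by (simp add: constant_degree)
    then obtain a where "poly p a = 0" ..
    then obtain g where g: "p = [:-a, 1:] * g" by (metis poly_eq_0_iff_dvd dvdE)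
    with that have "g \<noteq> 0" by auto
    then have "degree p = Suc (degree g)" using g degree_mult_eq[of "[:-a, 1:]" g] by simp
    with g show ?thesis by blast
  qed
  have "\<exists>q g. degree q \<le> 2 \<and> degree g \<le> 2 * m \<and> f = q * g"
  proof (cases "degree f \<le> 2 * m")
    case True
    then show ?thesis by (intro exI[of _ 1] exI[of _ f]) simp
  next
    case False
    then obtain a g where g: "f = [:-a, 1:] * g" "degree f = Suc (degree g)" using root[of f]
      by auto
    show ?thesis
    proof (cases "degree g \<le> 2 * m")
      case True
      then show ?thesis using g by (intro exI[of _ "[:-a, 1:]"] exI[of _ g]) simp
    next
      case False
      then obtain b h where h: "g = [:-b, 1:] * h" "degree g = Suc (degree h)" using root[of g]
        by auto
      have "degree ([:-a, 1:] * [:-b, 1:]) \<le> 2" by (rule order_trans[OF degree_mult_le]) simp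
      moreover have "f = [:-a, 1:] * [:-b, 1:] * h" using g h by (simp only: mult.assoc)
      moreover have "degree h \<le> 2 * m" using Suc.prems g h by simp
      ultimately show ?thesis by blast
    qed
  qed
  then obtain q g where q: "degree q \<le> 2" "degree g \<le> 2 * m" "f = q * g" by blast
  obtain c qs where "length qs = m" "\<forall>q\<in>set qs. degree q \<le> 2" "g = smult c (prod_list qs)"
    using Suc.IH[OF q(2)] by blast
  then show ?case using q by (intro exI[of _ c] exI[of _ "q # qs"]) auto
qed

lemma degree_prod_list_quadratics:
  fixes qs :: "'a::field poly list"
  assumes "\<forall>q\<in>set qs. degree q \<le> 2" shows "degree (prod_list qs) \<le> 2 * length qs"
  using assms
proof (induction qs)
  case (Cons q qs)
  then show ?case using degree_mult_le[of q "prod_list qs"] by simp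
qed simp

lemma conic_lift_prod_list:
  fixes x y z :: "'a::field_char_0^3"
  assumes "\<forall>q\<in>set qs. degree q \<le> 2"
  shows "lin x * lin z - lin y ^ 2 dvd
    (\<Prod>q\<leftarrow>qs. lin (coeff q 2 *s x + coeff q 1 *s y + coeff q 0 *s z))
      - conic_lift (lin x) (lin y) (lin z) (length qs) (prod_list qs)"
  using assms
proof (induction qs)
  case Nil
  then show ?case by (simp add: conic_lift_def conic_monomial_def)
next
  case (Cons q qs)
  let ?K = "lin x * lin z - lin y ^ 2" and ?L = "conic_lift (lin x) (lin y) (lin z)"
  let ?l = "lin (coeff q 2 *s x + coeff q 1 *s y + coeff q 0 *s z)"
  let ?P = "\<Prod>q\<leftarrow>qs. lin (coeff q 2 *s x + coeff q 1 *s y + coeff q 0 *s z)"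
  have q: "q = [:coeff q 0, coeff q 1, coeff q 2:]" using Cons.prems
    by (intro poly_degree_2_expand) simp
  have "?K dvd ?l * ?L (length qs) (prod_list qs) - ?L (Suc (length qs))
    ([:coeff q 0, coeff q 1, coeff q 2:] * prod_list qs)"
    unfolding lin_add lin_scale
    by (intro conic_lift_linear_mult degree_prod_list_quadratics) (use Cons.prems in simp)
  then have 1: "?K dvd ?l * ?L (length qs) (prod_list qs) - ?L (Suc (length qs)) (q * prod_list qs)"
    by (simp only: q[symmetric])
  have "?K dvd ?l * (?P - ?L (length qs) (prod_list qs))"
    using Cons by (intro dvd_mult) simp
  from dvd_add[OF this 1] show ?case by (simp add: right_diff_distrib)
qed

section \<open>Sylvester's theorem over the complex numbers\<close>

locale complex_frame = orthogonal_frame B F d for B F :: "complex^3^3" and d +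
  assumes sym: "transpose B = B"
begin

text \<open>Rescaled frame coordinates in which the form is a sum of three squares.\<close>

definition unit_form :: "3 \<Rightarrow> complex^3" where
  "unit_form j = csqrt (d j) *s (inverse (d j) *s (B *v (F $ j)))"

lemma quad_unit_forms: "quad B = lin (unit_form 1) ^ 2 + lin (unit_form 2) ^ 2 + lin
    (unit_form 3) ^ 2"
proof -
  have "lin (unit_form j) ^ 2 = cst (d j) * \<xi> j ^ 2" for j
    unfolding unit_form_def lin_scale[of "csqrt (d j)"] power_mult_distrib cst_power[symmetric]
    by (simp add: frame_coord_def)
  then show ?thesis by (simp add: quad_frame[OF sym] sum_3)
qed

lemma var_unit_forms: "\<exists>f. var i
    = lin (f 1 *s unit_form 1 + f 2 *s unit_form 2 + f (3::3) *s unit_form 3)"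
proof -
  have i: "inverse (csqrt (d j)) * (csqrt (d j) * inverse (d j)) = inverse (d j)" for j
    using d_nz[of j] by (simp add: field_simps)
  have "\<xi> j = lin (inverse (csqrt (d j)) *s unit_form j)" for j
    unfolding frame_coord_def unit_form_def vector_smult_assoc i ..
  then show ?thesis
    by (intro exI[of _ "\<lambda>j. F $ j $ i * inverse (csqrt (d j))"])
      (simp add: var_frame[of i] sum_3 lin_add lin_scale cst_mult mult.assoc)
qed

text \<open>A sum of three squares is \<open>(\<eta>\<^sub>1 + \<i> \<eta>\<^sub>2) (\<eta>\<^sub>1 - \<i> \<eta>\<^sub>2) - (\<i> \<eta>\<^sub>3)\<^sup>2\<close>.\<close>

lemma conic_coordinates:
  "\<exists>x y z :: complex^3. quad B = lin x * lin z - lin y ^ 2 \<and>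
    (\<forall>i. \<exists>a b c. var i = cst a * lin x + cst b * lin y + cst c * lin z)"
proof -
  define x y z where "x = unit_form 1 + \<i> *s unit_form 2" and "y = \<i> *s unit_form 3"
    and "z = unit_form 1 + (- \<i>) *s unit_form 2"
  have i: "cst \<i> * cst \<i> = (-1 :: complex tpoly)"
    by (simp add: cst_minus flip: cst_mult)
  have i': "cst \<i> * (cst \<i> * p) = - p" for p :: "complex tpoly"
    by (simp add: i flip: mult.assoc)
  have "quad B = lin x * lin z - lin y ^ 2"
    unfolding quad_unit_forms x_def y_def z_def lin_add lin_scale cst_minus
    by (simp add: power2_eq_square algebra_simps i i')
  moreover have "\<exists>a b c. var i = cst a * lin x + cst b * lin y + cst c * lin z" for i
  proof -
    obtain f where f: "var i = lin (f 1 *s unit_form 1 + f 2 *s unit_form 2 + f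
      (3::3) *s unit_form 3)"
      using var_unit_forms by blast
    have "f 1 *s unit_form 1 + f 2 *s unit_form 2 + f (3::3) *s unit_form 3
      = (f 1 / 2 - \<i> * f 2 / 2) *s x + (- \<i> * f 3) *s y + (f 1 / 2 + \<i> * f 2 / 2) *s z"
      by (simp add: vec_eq_iff x_def y_def z_def algebra_simps)
    then have "var i = cst (f 1 / 2 - \<i> * f 2 / 2) * lin x + cst (- \<i> * f 3) * lin y
        + cst (f 1 / 2 + \<i> * f 2 / 2) * lin z"
      by (simp only: f lin_add lin_scale)
    then show ?thesis by blast
  qed
  ultimately show ?thesis by blast
qed

lemma complex_sylvester:
  assumes "h \<in> hom m"
  shows "\<exists>c as. length as = m \<and> quad B dvd h - cst c * (\<Prod>a\<leftarrow>as. lin a)"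
proof -
  obtain x y z :: "complex^3" where K: "quad B = lin x * lin z - lin y ^ 2"
    and v: "\<And>i. \<exists>a b c. var i = cst a * lin x + cst b * lin y + cst c * lin z"
    using conic_coordinates by (elim exE conjE) simp
  have "\<exists>f. degree f \<le> 2 * m \<and> quad B dvd h - conic_lift (lin x) (lin y) (lin z) m f"
    unfolding K by (rule hom_congruent_conic_lift[OF v assms])
  then obtain f where f: "degree f \<le> 2 * m" "quad B dvd h - conic_lift (lin x) (lin y) (lin z) m f"
    by (elim exE conjE)
  obtain c qs where qs: "length qs = m" "\<forall>q\<in>set qs. degree q \<le> 2" "f = smult c (prod_list qs)"
    using complex_poly_factor_quadratics[OF f(1)] by blast
  let ?as = "map (\<lambda>q. coeff q 2 *s x + coeff q 1 *s y + coeff q 0 *s z) qs"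
  have "quad B dvd (\<Prod>a\<leftarrow>?as. lin a) - conic_lift (lin x) (lin y) (lin z) m (prod_list qs)"
    using conic_lift_prod_list[OF qs(2), of x z y] qs(1) by (simp add: K comp_def)
  then have "quad B dvd (h - conic_lift (lin x) (lin y) (lin z) m f)
    - cst c * ((\<Prod>a\<leftarrow>?as. lin a) - conic_lift (lin x) (lin y) (lin z) m (prod_list qs))"
    by (rule dvd_diff[OF f(2) dvd_mult])
  also have "\<dots> = h - cst c * (\<Prod>a\<leftarrow>?as. lin a)"
    by (simp add: qs(3) conic_lift_smult right_diff_distrib)
  finally show ?thesis using qs(1) by (intro exI[of _ c] exI[of _ ?as]) simp
qed

text \<open>The identity \<open>(s\<^sup>2 - 1)\<^sup>2 + (2 s)\<^sup>2 = (s\<^sup>2 + 1)\<^sup>2\<close> parametrises isotropic vectors of a sum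
  of three squares.\<close>

definition conic_point :: "complex \<Rightarrow> complex^3" where
  "conic_point s = (\<chi> i. \<Sum>k\<in>UNIV. (if k = 1 then (s\<^sup>2 - 1) / csqrt (d 1) else
     if k = 2 then 2 * s / csqrt (d 2) else \<i> * (s\<^sup>2 + 1) / csqrt (d 3)) * F $ k $ i)"

text \<open>The restriction of the linear form \<open>a\<close> to the parametrised conic.\<close>

definition conic_quadratic :: "complex^3 \<Rightarrow> complex poly" where
  "conic_quadratic a = (let \<alpha> = (\<lambda>k. (\<Sum>i\<in>UNIV. a $ i * F $ k $ i) / csqrt (d k))
     in [:- \<alpha> 1 + \<i> * \<alpha> 3, 2 * \<alpha> 2, \<alpha> 1 + \<i> * \<alpha> 3:])"

lemma ev_\<xi>_conic_point: "ev (\<xi> k) (conic_point s) = (if k = 1 then (s\<^sup>2 - 1) / csqrt (d 1) else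
     if k = 2 then 2 * s / csqrt (d 2) else \<i> * (s\<^sup>2 + 1) / csqrt (d 3))"
  unfolding conic_point_def by (rule ev_\<xi>)

lemma ev_quad_conic_point: "ev (quad B) (conic_point s) = 0"
proof -
  have "((s\<^sup>2 - 1) / csqrt (d 1))\<^sup>2 * d 1 + (2 * s / csqrt (d 2))\<^sup>2 * d 2 + (\<i> * (s\<^sup>2 + 1) / csqrt
    (d 3))\<^sup>2 * d 3
    = (s\<^sup>2 - 1)\<^sup>2 + (2 * s)\<^sup>2 + (\<i> * (s\<^sup>2 + 1))\<^sup>2"
    using d_nz by (simp add: power_divide)
  also have "\<dots> = 0" by (simp add: power_mult_distrib) (simp add: power2_eq_square algebra_simps)
  finally show ?thesis
    by (simp add: quad_frame[OF sym] ev_\<xi>_conic_point sum_3 mult.commute[of "d _"])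
qed

lemma ev_lin_conic_point: "ev (lin a) (conic_point s) = poly (conic_quadratic a) s"
  by (simp add: ev_lin conic_point_def conic_quadratic_def Let_def sum_3 power2_eq_square
      divide_inverse algebra_simps)

lemma conic_point_nonzero: "conic_point s \<noteq> 0"
proof
  assume "conic_point s = 0"
  then have z: "ev (\<xi> k) (conic_point s) = 0" for k by (simp add: frame_coord_def ev_lin)
  from z[of 1] z[of 3] have "s\<^sup>2 - 1 = 0" "s\<^sup>2 + 1 = 0"
    using d_nz by (simp_all add: ev_\<xi>_conic_point)
  then have "(2::complex) = 0" by algebra
  then show False by simp
qed

text \<open>If the leading coefficient of the restriction of \<open>a\<close> vanishes, then \<open>a\<close> vanishes at the
  limit of the parametrisation for \<open>s \<rightarrow> \<infinity>\<close>; otherwise the restriction has a root.\<close>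

lemma isotropic_zero_of_linear_form:
  obtains w where "w \<noteq> 0" "ev (quad B) w = 0" "ev (lin a) w = 0"
proof (cases "coeff (conic_quadratic a) 2 = 0")
  case False
  then have "degree (conic_quadratic a) > 0"
    using coeff_eq_0[of "conic_quadratic a" 2] by (cases "degree (conic_quadratic a)") auto
  then have "\<exists>s. poly (conic_quadratic a) s = 0"
    using fundamental_theorem_of_algebra[of "conic_quadratic a"] by (simp add: constant_degree)
  then obtain s where "poly (conic_quadratic a) s = 0" ..
  then show thesis
    by (intro that[OF conic_point_nonzero[of s] ev_quad_conic_point]) (simp add: ev_lin_conic_point)
next
  case True
  define w where "w = (\<chi> i. \<Sum>k\<in>UNIV. (if k = 1 then 1 / csqrt (d 1) else
     if k = 2 then 0 else \<i> / csqrt (d 3)) * F $ k $ i)"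
  have \<xi>: "ev (\<xi> 1) w = 1 / csqrt (d 1)" "ev (\<xi> 2) w = 0" "ev (\<xi> 3) w = \<i> / csqrt (d 3)"
    unfolding w_def ev_\<xi> by auto
  have "w \<noteq> 0"
  proof
    assume "w = 0"
    then have "ev (\<xi> 1) w = 0" by (simp add: frame_coord_def ev_lin)
    then show False using \<xi> d_nz by simp
  qed
  moreover have "ev (quad B) w = 0"
    using d_nz by (simp add: quad_frame[OF sym] sum_3 \<xi> power_divide)
  moreover have "ev (lin a) w = 0"
    using True by (simp add: conic_quadratic_def Let_def numeral_2_eq_2 ev_lin w_def sum_3
        divide_inverse algebra_simps)
  ultimately show thesis by (rule that)
qed

end

section \<open>Sylvester's theorem for positive definite forms\<close>

definition re_part :: "complex^3 \<Rightarrow> real^3" where "re_part w = (\<chi> i. Re (w $ i))"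
definition im_part :: "complex^3 \<Rightarrow> real^3" where "im_part w = (\<chi> i. Im (w $ i))"

lemma ev_lin_cvec: "ev (lin (cvec a)) w = Complex (a \<bullet> re_part w) (a \<bullet> im_part w)"
  by (simp add: ev_lin cvec_def re_part_def im_part_def inner_vec_def complex_eq_iff)

lemma ev_quad_complex:
  fixes B :: "real^3^3"
  assumes "transpose B = B"
  shows "ev (quad (cmat B)) w =
    Complex (ev (quad B) (re_part w) - ev (quad B) (im_part w)) (2 * (re_part w \<bullet>
      (B *v im_part w)))"
proof -
  have "ev (quad (cmat B)) w = (\<Sum>j\<in>UNIV. w $ j * ev (lin (cvec (B $ j))) w)"
    by (simp add: ev_quad ev_lin cvec_def sum_distrib_left mult_ac)
  also have "\<dots> = Complex (re_part w \<bullet> (B *v re_part w) - im_part w \<bullet> (B *v im_part w))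
     (re_part w \<bullet> (B *v im_part w) + im_part w \<bullet> (B *v re_part w))"
    by (simp add: complex_eq_iff ev_lin_cvec inner_vec_def[of "re_part w"] inner_vec_def[of
      "im_part w"]
        matrix_mult_dot sum_subtractf sum.distrib)
      (simp add: re_part_def im_part_def)
  finally show ?thesis
    using symmetric_form_commute[OF assms, of "im_part w" "re_part w"] by (simp add: ev_quad_inner)
qed

locale pos_def_form =
  fixes B :: "real^3^3"
  assumes sym: "transpose B = B" and pos: "v \<noteq> 0 \<Longrightarrow> v \<bullet> (B *v v) > 0"
begin

lemma B_inj: "B *v u = B *v v \<Longrightarrow> u = v"
  using pos[of "u - v"] by (auto simp: matrix_vector_mult_diff_distrib)

lemma inv: "invertible B"
proof -
  have "inj ((*v) B)" using B_inj by (auto intro: injI)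
  then show ?thesis
    by (metis matrix_left_invertible_injective invertible_left_inverse)
qed

text \<open>These are the real and imaginary parts of \<open>Q(w) = 0\<close>; as \<open>Q\<close> takes the same value at both
  parts, neither can vanish without the other.\<close>

lemma isotropic_parts:
  assumes "w \<noteq> 0" "ev (quad (cmat B)) w = 0"
  shows "re_part w \<noteq> 0" "im_part w \<noteq> 0" "re_part w \<bullet> (B *v im_part w) = 0"
    "re_part w \<bullet> (B *v re_part w) = im_part w \<bullet> (B *v im_part w)"
proof -
  have *: "re_part w \<bullet> (B *v im_part w) = 0"
    "re_part w \<bullet> (B *v re_part w) = im_part w \<bullet> (B *v im_part w)"
    using assms(2) unfolding ev_quad_complex[OF sym] by (simp_all add: complex_eq_iff ev_quad_inner)
  then show "re_part w \<bullet> (B *v im_part w) = 0"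
    "re_part w \<bullet> (B *v re_part w) = im_part w \<bullet> (B *v im_part w)" by auto
  have "re_part w \<noteq> 0 \<or> im_part w \<noteq> 0"
    using assms(1) by (auto simp: re_part_def im_part_def vec_eq_iff complex_eq_iff)
  then show "re_part w \<noteq> 0" "im_part w \<noteq> 0" using *(2) pos[of "re_part w"] pos[of "im_part w"]
    by auto
qed

text \<open>A real linear form that vanishes at \<open>w\<close> vanishes at the real and at the imaginary part of
  \<open>w\<close>. They are linearly independent, so the form is a multiple of their cross product.\<close>

lemma real_forms_with_common_isotropic_zero:
  assumes w: "w \<noteq> 0" "ev (quad (cmat B)) w = 0"
    and "ev (lin (cvec a)) w = 0" "ev (lin (cvec b)) w = 0" "a \<noteq> 0" "b \<noteq> 0"
  shows "\<exists>c. c \<noteq> 0 \<and> b = c *\<^sub>R a"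
proof -
  let ?x = "re_part w" and ?y = "im_part w"
  let ?n = "cross3 ?x ?y"
  have o: "a \<bullet> ?x = 0" "a \<bullet> ?y = 0" "b \<bullet> ?x = 0" "b \<bullet> ?y = 0"
    using assms by (simp_all add: ev_lin_cvec complex_eq_iff)
  note p = isotropic_parts[OF w]
  have "?n \<noteq> 0"
  proof
    assume "?n = 0"
    then have "collinear {0, ?x, ?y}" by (simp add: cross_eq_0)
    then obtain t where t: "?y = t *\<^sub>R ?x" using p(1) by (auto simp: collinear_lemma)
    then have "t * (?x \<bullet> (B *v ?x)) = 0" using p(3) by (simp add: matrix_vector_mult_scaleR)
    then have "t = 0" using pos[OF p(1)] by simp
    then show False using t p(2) by simp
  qed
  moreover have "\<exists>c. e = c *\<^sub>R ?n" if "e \<bullet> ?x = 0" "e \<bullet> ?y = 0" for e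
  proof -
    have "cross3 e ?n = 0" using Lagrange[of e ?x ?y] that by simp
    then have "collinear {0, ?n, e}" by (simp add: cross_eq_0 insert_commute)
    then show ?thesis using \<open>?n \<noteq> 0\<close> by (auto simp: collinear_lemma intro: exI[of _ 0])
  qed
  ultimately obtain \<alpha> \<beta> where ab: "a = \<alpha> *\<^sub>R ?n" "b = \<beta> *\<^sub>R ?n" using o by metis
  then have "\<alpha> \<noteq> 0" "\<beta> \<noteq> 0" using assms by auto
  then show ?thesis using ab by (intro exI[of _ "\<beta> / \<alpha>"]) simp
qed

end

context orthogonal_frame
begin

text \<open>Modulo the third coordinate the form \<open>Q\<close> is a multiple of \<open>\<xi>\<^sub>1\<^sup>2 + \<xi>\<^sub>2\<^sup>2\<close>, which removes
  all powers of \<open>\<xi>\<^sub>2\<close> beyond the first.\<close>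

lemma reduce_mod_quad_and_third_form:
  assumes sym: "transpose B = B" and d: "d 1 = d 2" and "p \<in> hom (Suc m)"
  shows "\<exists>h'\<in>hom m. \<exists>\<alpha> \<beta>. quad B dvd p - (\<xi> 3 * h' + cst \<alpha> * \<xi> 1 ^ Suc m + cst \<beta> * (\<xi> 1 ^ m * \<xi> 2))"
proof -
  define S where "S m = {p. \<exists>h'\<in>hom m. \<exists>\<alpha> \<beta>.
    quad B dvd p - (\<xi> 3 * h' + cst \<alpha> * \<xi> 1 ^ Suc m + cst \<beta> * (\<xi> 1 ^ m * \<xi> 2))}" for m
  have SI: "p \<in> S m" if "h' \<in> hom m"
    "p - (\<xi> 3 * h' + cst \<alpha> * \<xi> 1 ^ Suc m + cst \<beta> * (\<xi> 1 ^ m * \<xi> 2)) = quad B * R" for p h' \<alpha> \<beta> R m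
    unfolding S_def mem_Collect_eq that(2)[symmetric]
    by (intro bexI[OF _ that(1)] exI[of _ \<alpha>] exI[of _ \<beta>]) (simp only: that(2) dvd_triv_left)
  have SE: "\<exists>h'\<in>hom m. \<exists>\<alpha> \<beta> R. p
    = \<xi> 3 * h' + cst \<alpha> * \<xi> 1 ^ Suc m + cst \<beta> * (\<xi> 1 ^ m * \<xi> 2) + quad B * R"
    if "p \<in> S m" for p m
    using that unfolding S_def dvd_def by (auto simp: diff_eq_eq add_ac)
  have \<xi>h: "\<xi> j \<in> hom 1" "\<xi> j \<in> hom (Suc 0)" for j by (simp_all add: frame_coord_def)
  have add: "p + q \<in> S m" if "p \<in> S m" "q \<in> S m" for p q m
  proof -
    obtain h \<alpha> \<beta> R where 1: "h \<in> hom m" "p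
      = \<xi> 3 * h + cst \<alpha> * \<xi> 1 ^ Suc m + cst \<beta> * (\<xi> 1 ^ m * \<xi> 2) + quad B * R"
      using SE[OF \<open>p \<in> S m\<close>] by blast
    obtain h' \<alpha>' \<beta>' R'
      where 2: "h' \<in> hom m" "q = \<xi> 3 * h' + cst \<alpha>' * \<xi> 1 ^ Suc m + cst \<beta>' * (\<xi> 1 ^ m * \<xi> 2)
        + quad B * R'"
      using SE[OF \<open>q \<in> S m\<close>] by blast
    show ?thesis
      by (rule SI[of "h + h'" m _ "\<alpha> + \<alpha>'" "\<beta> + \<beta>'" "R + R'"])
        (use 1 2 in \<open>simp_all add: hom_add cst_add distrib_left distrib_right\<close>)
  qed
  have sc: "cst c * p \<in> S m" if p: "p \<in> S m" for p c m
  proof -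
    obtain h \<alpha> \<beta> R where 1: "h \<in> hom m" "p
      = \<xi> 3 * h + cst \<alpha> * \<xi> 1 ^ Suc m + cst \<beta> * (\<xi> 1 ^ m * \<xi> 2) + quad B * R"
      using SE[OF p] by blast
    show ?thesis
      by (rule SI[of "cst c * h" m _ "c * \<alpha>" "c * \<beta>" "cst c * R"])
        (use 1 in \<open>simp_all add: hom_cst_mult cst_mult distrib_left mult.left_commute mult.assoc\<close>)
  qed
  have var: "var i * p \<in> S m" if "\<And>j. \<xi> j * p \<in> S m" for i p m
  proof -
    have "var i * p = cst (F $ 1 $ i) * (\<xi> 1 * p) + cst (F $ 2 $ i) * (\<xi> 2 * p) + cst (F $ 3 $ i)
      * (\<xi> 3 * p)"
      by (simp add: var_frame[of i] sum_3 algebra_simps)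
    then show ?thesis by (simp add: add sc that)
  qed
  have split: "p \<in> S m" if p: "p \<in> hom (Suc m)" and s: "\<And>q j. q \<in> hom m \<Longrightarrow> \<xi> j * q \<in> S m" for p m
  proof -
    obtain q where q: "\<And>i. q i \<in> hom m" "p = (\<Sum>i\<in>UNIV. var i * q i)"
      using hom_Suc_split[OF p] by blast
    have "var 1 * q 1 + var 2 * q 2 + var 3 * q 3 \<in> S m"
      by (intro add var s q)
    then show ?thesis by (simp add: q(2) sum_3)
  qed
  have "p \<in> S m" if "p \<in> hom (Suc m)" for p m
    using that
  proof (induction m arbitrary: p)
    case 0
    show ?case
    proof (rule split[OF 0])
      fix q :: "'a tpoly" and j :: 3
      assume "q \<in> hom 0"
      then obtain c where q: "q = cst c" using hom_zero_eq_cst by blast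
      consider "j = 1" | "j = 2" | "j = 3" using exhaust_3 by blast
      then show "\<xi> j * q \<in> S 0"
      proof cases
        case 1
        then show ?thesis unfolding q by (intro SI[of 0 0 _ c 0 0]) (simp_all add: mult.commute)
      next
        case 2
        then show ?thesis unfolding q by (intro SI[of 0 0 _ 0 c 0]) (simp_all add: mult.commute)
      next
        case 3
        then show ?thesis unfolding q by (intro SI[of "cst c" 0 _ 0 0 0]) simp_all
      qed
    qed
  next
    case (Suc m)
    show ?case
    proof (rule split[OF Suc.prems])
      fix q :: "'a tpoly" and j :: 3
      assume q: "q \<in> hom (Suc m)"
      obtain h \<alpha> \<beta> R where h: "h \<in> hom m"
        "q = \<xi> 3 * h + cst \<alpha> * \<xi> 1 ^ Suc m + cst \<beta> * (\<xi> 1 ^ m * \<xi> 2) + quad B * R"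
        using SE[OF Suc.IH[OF q]] by blast
      have h\<xi>: "\<xi> i * h \<in> hom (Suc m)" for i using hom_mult[OF \<xi>h(1) h(1)] by simp
      consider "j = 1" | "j = 2" | "j = 3" using exhaust_3 by blast
      then show "\<xi> j * q \<in> S (Suc m)"
      proof cases
        case 1
        show ?thesis unfolding 1
          by (rule SI[OF h\<xi>[of 1], of _ \<alpha> \<beta> "\<xi> 1 * R"]) (simp add: h(2) algebra_simps)
      next
        case 2
        have "cst (inverse (d 1)) * quad B
          = \<xi> 1 ^ 2 + \<xi> 2 ^ 2 + cst (inverse (d 1) * d 3) * \<xi> 3 ^ 2"
          using d_nz[of 2] by (simp add: quad_frame[OF sym] sum_3 d distrib_left cst_mult
            mult.assoc)
        then have s: "\<xi> 2 * \<xi> 2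
          = cst (inverse (d 1)) * quad B - \<xi> 1 * \<xi> 1 - cst (inverse (d 1) * d 3) * (\<xi> 3 * \<xi> 3)"
          by (simp add: power2_eq_square)
        let ?h = "\<xi> 2 * h - cst (\<beta> * (inverse (d 1) * d 3)) * (\<xi> 1 ^ m * \<xi> 3)"
        have "\<xi> 1 ^ m * \<xi> 3 \<in> hom (Suc m)"
          using hom_mult[OF hom_power[OF \<xi>h(1), of 1 m] \<xi>h(1), of 3] by simp
        then have H: "?h \<in> hom (Suc m)" by (intro hom_diff h\<xi> hom_cst_mult)
        have e1: "\<xi> 2 * q = \<xi> 3 * (\<xi> 2 * h) + cst \<alpha> * (\<xi> 1 ^ Suc m * \<xi> 2) + cst \<beta> * (\<xi> 1 ^ m *
          (\<xi> 2 * \<xi> 2)) + quad B * (\<xi> 2 * R)"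
          by (simp add: h(2) algebra_simps)
        have "\<xi> 2 * q - (\<xi> 3 * ?h + cst (- \<beta>) * \<xi> 1 ^ Suc (Suc m) + cst \<alpha> * (\<xi> 1 ^ Suc m * \<xi> 2))
          = quad B * (\<xi> 2 * R + cst \<beta> * cst (inverse (d 1)) * \<xi> 1 ^ m)"
          unfolding e1 s by (simp add: cst_minus cst_mult algebra_simps)
        then show ?thesis unfolding 2 by (rule SI[OF H])
      next
        case 3
        show ?thesis unfolding 3 by (rule SI[OF q, of _ 0 0 0]) simp
      qed
    qed
  qed
  then show ?thesis using assms(3) unfolding S_def by blast
qed

end

lemma complexify_frame_coord:
  "complexify (frame_coord B F d j) = frame_coord (cmat B) (cmat F) (\<lambda>j. of_real (d j)) j"
proof -
  have "cvec (inverse (d j) *s (B *v (F $ j))) =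
    inverse (of_real (d j)) *s (cmat B *v (cmat F $ j))"
    by (simp add: vec_eq_iff cvec_def matrix_vector_mult_def)
  then show ?thesis by (simp add: frame_coord_def complexify_lin)
qed

lemma complex_frame_complexify:
  fixes B :: "real^3^3"
  assumes "transpose B = B" "orthogonal_frame B F d"
  shows "complex_frame (cmat B) (cmat F) (\<lambda>j. of_real (d j))"
proof -
  interpret orthogonal_frame "cmat B" "cmat F" "\<lambda>j. of_real (d j)"
    by (rule orthogonal_frame_complexify) fact
  show ?thesis by unfold_locales (simp add: assms(1) flip: map_matrix_transpose)
qed

context pos_def_form
begin

text \<open>By the complex theorem \<open>h\<close> is, on the conic, a product of linear forms, each of which has a
  zero there.\<close>

lemma isotropic_zero_of_hom:
  assumes "h \<in> hom (Suc m)"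
  obtains w where "w \<noteq> 0" "ev (quad (cmat B)) w = 0" "ev (complexify h) w = 0"
proof -
  obtain F where F: "orthogonal_frame B F (\<lambda>i. F $ i \<bullet> (B *v (F $ i)))"
    using orthogonal_frame_exists[OF sym inv] .
  interpret complex_frame "cmat B" "cmat F"
    "\<lambda>i. of_real (F $ i \<bullet> (B *v (F $ i)))"
    by (rule complex_frame_complexify[OF sym F])
  obtain c as where as: "length as = Suc m"
    "quad (cmat B) dvd complexify h - cst c * (\<Prod>a\<leftarrow>as. lin a)"
    using complex_sylvester[OF hom_complexify[OF assms]] by blast
  obtain a as' where a: "as = a # as'" using as(1) by (cases as) auto
  obtain w where w: "w \<noteq> 0" "ev (quad (cmat B)) w = 0" "ev (lin a) w = 0"
    using isotropic_zero_of_linear_form .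
  obtain R where "complexify h - cst c * (\<Prod>a\<leftarrow>as. lin a) = quad (cmat B) * R"
    using as(2) by (auto simp: dvd_def)
  then have "complexify h = cst c * (lin a * (\<Prod>a\<leftarrow>as'. lin a)) + quad (cmat B) * R"
    by (simp add: a diff_eq_eq)
  then have "ev (complexify h) w = 0" using w by simp
  with w show thesis by (intro that)
qed

text \<open>Take an isotropic zero \<open>w = x + \<i> y\<close> of \<open>h\<close> and complete \<open>x, y\<close> to an orthogonal frame. The
  remainder of \<open>h\<close> modulo \<open>Q\<close> and the third coordinate is \<open>\<alpha> \<xi>\<^sub>1\<^sup>m\<^sup>+\<^sup>1 + \<beta> \<xi>\<^sub>1\<^sup>m \<xi>\<^sub>2\<close> with real
  \<open>\<alpha>, \<beta>\<close>, and its value at \<open>w\<close> is \<open>\<alpha> + \<i> \<beta>\<close>. So the remainder is zero and the third coordinate is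
  a factor of \<open>h\<close> modulo \<open>Q\<close>.\<close>

lemma real_sylvester:
  assumes "h \<in> hom m"
  shows "\<exists>c as. length as = m \<and> quad B dvd h - cst c * (\<Prod>a\<leftarrow>as. lin a)"
  using assms
proof (induction m arbitrary: h)
  case 0
  then obtain c where "h = cst c" using hom_zero_eq_cst by blast
  then show ?case by (intro exI[of _ c] exI[of _ "[]"]) simp
next
  case (Suc m)
  obtain w where w: "w \<noteq> 0" "ev (quad (cmat B)) w = 0" "ev (complexify h) w = 0"
    using isotropic_zero_of_hom[OF Suc.prems] .
  define x y where "x = re_part w" and "y = im_part w"
  have xy: "x \<noteq> 0" "y \<noteq> 0" "x \<bullet> (B *v y) = 0" "x \<bullet> (B *v x) = y \<bullet> (B *v y)"
    using isotropic_parts[OF w(1,2)] by (simp_all add: x_def y_def)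
  have yx: "y \<bullet> (B *v x) = 0" using symmetric_form_commute[OF sym, of x y] xy by simp
  obtain z where z: "z \<bullet> (B *v z) \<noteq> 0" "x \<bullet> (B *v z) = 0" "y \<bullet> (B *v z) = 0"
    by (rule polar_nonzero_vector[OF sym inv, of "{x, y}"])
      (use xy yx pos[OF xy(1)] pos[OF xy(2)] in \<open>auto simp: card_insert_if\<close>)
  define F where "F = frame_of x y z"
  define d where "d = (\<lambda>i. F $ i \<bullet> (B *v (F $ i)))"
  interpret orthogonal_frame B F d
    unfolding d_def F_def using pos[OF xy(1)] pos[OF xy(2)] xy z
    by (intro orthogonal_frame_of[OF sym]) simp_all
  have "d 1 = d 2" by (simp add: d_def F_def xy)
  then obtain h' \<alpha> \<beta> where h': "h' \<in> hom m"
    "quad B dvd h - (\<xi> 3 * h' + cst \<alpha> * \<xi> 1 ^ Suc m + cst \<beta> * (\<xi> 1 ^ m * \<xi> 2))"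
    using reduce_mod_quad_and_third_form[OF sym _ Suc.prems] by blast
  then obtain R where R: "h - (\<xi> 3 * h' + cst \<alpha> * \<xi> 1 ^ Suc m + cst \<beta> * (\<xi> 1 ^ m * \<xi> 2))
    = quad B * R"
    by (auto simp: dvd_def)
  interpret C: orthogonal_frame "cmat B" "cmat F" "\<lambda>j. of_real (d j)"
    by (rule orthogonal_frame_complexify) unfold_locales
  have w': "w = (\<chi> i. \<Sum>k\<in>UNIV. (if k = 1 then 1 else if k = 2 then \<i> else 0) * cmat F $ k $ i)"
    by (simp add: vec_eq_iff sum_3 F_def x_def y_def re_part_def im_part_def complex_eq_iff)
  have \<xi>w: "ev (complexify (\<xi> k)) w = (if k = 1 then 1 else if k = 2 then \<i> else 0)" for k
    unfolding complexify_frame_coord w' by (rule C.ev_\<xi>)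
  have "ev (complexify (h - (\<xi> 3 * h' + cst \<alpha> * \<xi> 1 ^ Suc m + cst \<beta> * (\<xi> 1 ^ m * \<xi> 2)))) w = 0"
    unfolding R by (simp add: complexify_quad w)
  then have "of_real \<alpha> + \<i> * of_real \<beta> = (0 :: complex)"
    by (simp add: w \<xi>w eq_neg_iff_add_eq_0 mult.commute)
  then have "\<alpha> = 0" "\<beta> = 0" by (simp_all add: complex_eq_iff)
  with R have hR: "h - \<xi> 3 * h' = quad B * R" by simp
  obtain c as where as: "length as = m" "quad B dvd h' - cst c * (\<Prod>a\<leftarrow>as. lin a)"
    using Suc.IH[OF h'(1)] by blast
  let ?a = "inverse (d 3) *s (B *v (F $ 3))"
  have "quad B dvd (h - \<xi> 3 * h') + \<xi> 3 * (h' - cst c * (\<Prod>a\<leftarrow>as. lin a))"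
    by (intro dvd_add dvd_mult as) (simp add: hR)
  also have "\<dots> = h - cst c * (\<Prod>a\<leftarrow>?a # as. lin a)"
    by (simp add: frame_coord_def algebra_simps)
  finally show ?case using as(1) by (intro exI[of _ c] exI[of _ "?a # as"]) simp
qed

end

section \<open>Harmonic polynomials as Maxwell polynomials\<close>

context nondeg_form
begin

text \<open>The constants are absorbed into the first direction, which is possible as \<open>m > 0\<close>.\<close>

lemma harmonic_eq_maxwell_poly:
  assumes h: "lap C h = 0" and "m > 0" "length as = m"
    and dv: "quad B dvd h - cst c * (\<Prod>a\<leftarrow>as. lin a)"
  shows "\<exists>us. length us = m \<and> maxwell_poly B us = h"
proof -
  obtain a as' where as: "as = a # as'" using assms by (cases as) auto
  define k where "k = (\<Prod>i<m. - of_nat (2 * i + 1) :: 'a)"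
  have k: "k \<noteq> 0" unfolding k_def by (simp add: prod_zero_iff del: of_nat_add of_nat_Suc)
  define us where "us = map ((*v) C) (((c / k) *s a) # as')"
  have len: "length us = m" using assms(3) by (simp add: us_def as)
  have "map ((*v) B) us = ((c / k) *s a) # as'"
    by (simp add: us_def comp_def matrix_vector_mul_assoc BC)
  from arg_cong[OF this, of "\<lambda>l. prod_list (map lin l)"]
  have "(\<Prod>u\<leftarrow>us. lin (B *v u)) = (\<Prod>a\<leftarrow>((c / k) *s a) # as'. lin a)"
    by (simp only: map_map comp_def)
  then have P: "cst k * (\<Prod>u\<leftarrow>us. lin (B *v u)) = cst c * (\<Prod>a\<leftarrow>as. lin a)"
    using k by (simp add: as lin_scale flip: cst_mult mult.assoc)
  obtain R where R: "maxwell_poly B us = cst k * (\<Prod>u\<leftarrow>us. lin (B *v u)) + quad B * R"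
    using maxwell_poly_mod_quad[of us] by (auto simp: len k_def)
  obtain R' where R': "h - cst c * (\<Prod>a\<leftarrow>as. lin a) = quad B * R'"
    using dv by (auto simp: dvd_def)
  have "maxwell_poly B us = h + quad B * (R - R')"
    unfolding R P using R' by (simp add: algebra_simps)
  from harmonic_eqI[OF lap_maxwell_poly h this] len show ?thesis by blast
qed

end

section \<open>Uniqueness of the directions\<close>

context pos_def_form
begin

text \<open>For a real form the coefficients of \<open>s\<close> and \<open>s\<^sup>2\<close> in its restriction to the conic are \<open>2
  \<beta>\<^sub>2\<close> and \<open>\<beta>\<^sub>1 + \<i> \<beta>\<^sub>3\<close> with real \<open>\<beta>\<^sub>k\<close>. A nonzero real form therefore always has a zero at a
  finite parameter.\<close>

lemma real_form_eq_0_if_conic_quadratic_constant: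
  assumes F: "complex_frame (cmat B) (cmat F) (\<lambda>j. of_real (d j))"
    and d: "\<And>j. d j > 0"
    and const: "coeff (complex_frame.conic_quadratic (cmat F) (\<lambda>j. of_real (d j)) (cvec a)) 1 = 0"
      "coeff (complex_frame.conic_quadratic (cmat F) (\<lambda>j. of_real (d j)) (cvec a)) 2 = 0"
  shows "a = 0"
proof -
  interpret complex_frame "cmat B" "cmat F" "\<lambda>j. of_real (d j)" by fact
  let ?q = "\<lambda>a. conic_quadratic (cvec a)"
  define \<beta> where "\<beta> k = (a \<bullet> F $ k) / sqrt (d k)" for k
  have \<alpha>: "(\<Sum>i\<in>UNIV. cvec a $ i * cmat F $ k $ i) / csqrt (of_real (d k))
     = of_real (\<beta> k)" for k
    using d[of k] by (simp add: \<beta>_def cvec_def inner_vec_def less_imp_le)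
  have "?q a = [:- of_real (\<beta> 1) + \<i> * of_real (\<beta> 3), 2 * of_real (\<beta> 2), of_real (\<beta> 1) + \<i>
    * of_real (\<beta> 3):]"
    by (simp only: conic_quadratic_def Let_def \<alpha>)
  with const have "\<beta> 1 = 0" "\<beta> 2 = 0" "\<beta> 3 = 0"
    by (simp_all add: numeral_2_eq_2 complex_eq_iff)
  then have \<beta>: "\<beta> k = 0" for k using exhaust_3[of k] by auto
  have "a \<bullet> F $ k = 0" for k using \<beta>[of k] d[of k] by (simp add: \<beta>_def)
  then have "cvec a = 0"
    using frame_separates[of "cvec a"]
      by (simp add: cvec_def inner_vec_def flip: of_real_mult of_real_sum)
  then show ?thesis by (simp add: cvec_def vec_eq_iff)
qed

text \<open>A root of the first factor on the left is a root of some factor on the right. These two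
  real forms share an isotropic zero and are proportional; cancel them and continue with one
  factor less. The constant \<open>\<kappa>\<close> collects the scalars.\<close>

lemma match_real_forms:
  fixes a :: "'i \<Rightarrow> real^3" and b :: "'j \<Rightarrow> real^3"
  assumes F: "complex_frame (cmat B) (cmat F) (\<lambda>j. of_real (d j))"
    and d: "\<And>j. d j > 0"
    and "finite I" "finite J" "card I = card J" "\<kappa> \<noteq> 0"
    and "\<And>i. i \<in> I \<Longrightarrow> a i \<noteq> 0" "\<And>j. j \<in> J \<Longrightarrow> b j \<noteq> 0"
    and "(\<Prod>i\<in>I. complex_frame.conic_quadratic (cmat F) (\<lambda>j. of_real (d j)) (cvec (a i)))
       = smult (of_real \<kappa>) (\<Prod>j\<in>J. complex_frame.conic_quadratic (cmat F) (\<lambda>j. of_real (d j)) (cvec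
         (b j)))"
  shows "\<exists>\<pi> c. bij_betw \<pi> J I \<and> (\<forall>j\<in>J. b j = c j *\<^sub>R a (\<pi> j)) \<and> \<kappa> * (\<Prod>j\<in>J. c j) = 1"
proof -
  interpret complex_frame "cmat B" "cmat F" "\<lambda>j. of_real (d j)" by fact
  let ?q = "\<lambda>a. conic_quadratic (cvec a)"
  note zero = real_form_eq_0_if_conic_quadratic_constant[OF F d]
  have root: "\<exists>s. poly (?q a) s = 0" if "a \<noteq> 0" for a
  proof (cases "degree (?q a) = 0")
    case False
    then show ?thesis using fundamental_theorem_of_algebra[of "?q a"] by (simp add: constant_degree)
  next
    case True
    then show ?thesis using zero[of a] that by (simp add: coeff_eq_0)
  qed
  have nz: "?q a \<noteq> 0" if "a \<noteq> 0" for a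
    using zero[of a] that by auto
  show ?thesis
    using assms(3-9)
  proof (induction I arbitrary: J \<kappa> rule: finite_induct)
    case empty
    then have "J = {}" by simp
    from empty.prems(6) have "1 = smult (complex_of_real \<kappa>) 1"
      unfolding \<open>J = {}\<close> by (simp only: prod.empty)
    from arg_cong[OF this, of "\<lambda>p. coeff p 0"] have "complex_of_real \<kappa> = of_real 1"
      unfolding coeff_smult by simp
    then have "\<kappa> = 1" by (simp only: of_real_eq_iff)
    with \<open>J = {}\<close> show ?case by (simp add: bij_betw_def)
  next
    case (insert i I)
    obtain s where s: "poly (?q (a i)) s = 0" using root insert.prems(4) by blast
    have "poly (\<Prod>i\<in>insert i I. ?q (a i)) s = 0" using s insert.hyps by simp
    then have "poly (\<Prod>j\<in>J. ?q (b j)) s = 0"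
      unfolding insert.prems(6) using insert.prems(3) by simp
    then obtain j where j: "j \<in> J" "poly (?q (b j)) s = 0"
      using insert.prems(1) by (auto simp: poly_prod prod_zero_iff)
    have "\<exists>c. c \<noteq> 0 \<and> b j = c *\<^sub>R a i"
      by (rule real_forms_with_common_isotropic_zero[OF conic_point_nonzero[of s]
        ev_quad_conic_point])
        (use s j insert.prems(4,5) in \<open>simp_all add: ev_lin_conic_point\<close>)
    then obtain c where c: "c \<noteq> 0" "b j = c *\<^sub>R a i" by blast
    have "poly (?q (b j)) t = poly (smult (of_real c) (?q (a i))) t" for t
      by (simp add: c(2) ev_lin cvec_def sum_distrib_left mult.assoc flip: ev_lin_conic_point)
    then have qb: "?q (b j) = smult (of_real c) (?q (a i))"
      by (simp add: poly_eq_poly_eq_iff[symmetric] fun_eq_iff)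
    have "?q (a i) * (\<Prod>i\<in>I. ?q (a i)) = (\<Prod>i\<in>insert i I. ?q (a i))"
      using insert.hyps by simp
    also have "\<dots> = smult (of_real \<kappa>) (?q (b j) * (\<Prod>j\<in>J - {j}. ?q (b j)))"
      unfolding insert.prems(6) using insert.prems(1) j(1) by (simp add: prod.remove)
    also have "\<dots> = ?q (a i) * smult (of_real (\<kappa> * c)) (\<Prod>j\<in>J - {j}. ?q (b j))"
      by (simp add: qb)
    finally have can: "?q (a i) * (\<Prod>i\<in>I. ?q (a i)) =
      ?q (a i) * smult (of_real (\<kappa> * c)) (\<Prod>j\<in>J - {j}. ?q (b j))" .
    have "?q (a i) \<noteq> 0" using nz[of "a i"] insert.prems(4) by simp
    with can have "(\<Prod>i\<in>I. ?q (a i)) = smult (of_real (\<kappa> * c)) (\<Prod>j\<in>J - {j}. ?q (b j))"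
      by (simp only: mult_cancel_left simp_thms)
    moreover have "card I = card (J - {j})" "finite (J - {j})" "\<kappa> * c \<noteq> 0"
      using insert.prems(1-3) insert.hyps c(1) j(1) by simp_all
    ultimately have "\<exists>\<pi> e. bij_betw \<pi> (J - {j}) I \<and> (\<forall>j\<in>J - {j}. b j = e j *\<^sub>R a (\<pi> j)) \<and>
      \<kappa> * c * (\<Prod>j\<in>J - {j}. e j) = 1"
      using insert.prems(4,5) by (intro insert.IH) blast+
    then obtain \<pi> e where p: "bij_betw \<pi> (J - {j}) I" "\<forall>j\<in>J - {j}. b j = e j *\<^sub>R a (\<pi> j)"
      "\<kappa> * c * (\<Prod>j\<in>J - {j}. e j) = 1"
      by (elim exE conjE)
    have "bij_betw (\<pi>(j := i)) (J - {j}) I"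
      using p(1) by (subst bij_betw_cong[of _ _ \<pi>]) auto
    moreover have "bij_betw (\<pi>(j := i)) {j} {i}" by (simp add: bij_betw_def)
    ultimately have "bij_betw (\<pi>(j := i)) ((J - {j}) \<union> {j}) (I \<union> {i})"
      using insert.hyps by (intro bij_betw_combine) auto
    moreover have "(J - {j}) \<union> {j} = J" "I \<union> {i} = insert i I" using j(1) by auto
    ultimately have "bij_betw (\<pi>(j := i)) J (insert i I)" by simp
    moreover have "\<forall>j'\<in>J. b j' = (e(j := c)) j' *\<^sub>R a ((\<pi>(j := i)) j')" using p(2) c(2) by auto
    moreover have "(\<Prod>j'\<in>J. (e(j := c)) j') = c * (\<Prod>j\<in>J - {j}. e j)"
      using insert.prems(1) j(1) by (subst prod.remove[of _ j]) auto
    with p(3) have "\<kappa> * (\<Prod>j'\<in>J. (e(j := c)) j') = 1" by (simp only: mult.assoc)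
    ultimately show ?case
      by (intro exI[of _ "\<pi>(j := i)"] exI[of _ "e(j := c)"] conjI)
  qed
qed

lemma maxwell_poly_eq_imp_same_directions:
  assumes eq: "maxwell_poly B (map u [1..<Suc m]) = maxwell_poly B (map u' [1..<Suc m])"
  shows "same_directions m u u'"
proof -
  interpret nondeg_form B "matrix_inv B"
    by (rule nondeg_form_matrix_inv[OF sym inv])
  obtain F where F: "orthogonal_frame B F (\<lambda>i. F $ i \<bullet> (B *v (F $ i)))"
    using orthogonal_frame_exists[OF sym inv] .
  define d where "d = (\<lambda>i. F $ i \<bullet> (B *v (F $ i)))"
  have d: "d j > 0" for j
    using orthogonal_frame.d_nz[OF F, of j] pos[of "F $ j"]
    by (cases "F $ j = 0") (simp_all add: d_def)
  have cf: "complex_frame (cmat B) (cmat F) (\<lambda>j. of_real (d j))"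
    unfolding d_def by (rule complex_frame_complexify[OF sym F])
  interpret complex_frame "cmat B" "cmat F" "\<lambda>j. of_real (d j)" by fact
  let ?q = "\<lambda>u. conic_quadratic (cvec (B *v u))"
  define k where "k = (\<Prod>i<m. - of_nat (2 * i + 1) :: real)"
  have k: "k \<noteq> 0" unfolding k_def by (simp add: prod_zero_iff del: of_nat_add of_nat_Suc)
  have val: "ev (complexify (maxwell_poly B (map u [1..<Suc m]))) (conic_point s)
     = of_real k * poly (\<Prod>j\<in>{1..m}. ?q (u j)) s" for u s
  proof -
    have len: "length (map u [1..<Suc m]) = m" by simp
    obtain R where R: "maxwell_poly B (map u [1..<Suc m])
      = cst k * (\<Prod>u\<leftarrow>map u [1..<Suc m]. lin (B *v u)) + quad B * R"
      using maxwell_poly_mod_quad[of "map u [1..<Suc m]"] unfolding len k_def[symmetric]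
        by (elim exE)
    have "(\<Prod>u\<leftarrow>map u [1..<Suc m]. lin (B *v u)) = (\<Prod>j\<in>{1..m}. lin (B *v u j))"
      using prod.distinct_set_conv_list[of "[1..<Suc m]" "\<lambda>j. lin (B *v u j)"]
      by (simp add: comp_def atLeastLessThanSuc_atLeastAtMost del: upt_Suc)
    then show ?thesis
      unfolding R by (simp add: complexify_quad complexify_lin ev_quad_conic_point
        ev_lin_conic_point poly_prod)
  qed
  have "poly (\<Prod>j\<in>{1..m}. ?q (u j)) s = poly (\<Prod>j\<in>{1..m}. ?q (u' j)) s" for s
    using val[of u s] val[of u' s] k unfolding eq by simp
  then have P: "(\<Prod>j\<in>{1..m}. ?q (u j)) = (\<Prod>j\<in>{1..m}. ?q (u' j))"
    by (simp add: poly_eq_poly_eq_iff[symmetric] fun_eq_iff)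
  have B0: "B *v v = 0 \<longleftrightarrow> v = 0" for v using B_inj[of v 0] by auto
  have q0: "?q v = 0 \<Longrightarrow> v = 0" for v
    using real_form_eq_0_if_conic_quadratic_constant[OF cf d, of "B *v v"] B0 by simp
  have cz: "conic_quadratic (cvec 0) = 0" by (simp add: conic_quadratic_def Let_def cvec_def)
  \<comment> \<open>the polynomials in the parameter form an integral domain, so a vanishing term has a vanishing
    direction\<close>
  have zero: "(\<Prod>j\<in>{1..m}. ?q (w j)) = 0 \<longleftrightarrow> (\<exists>j\<in>{1..m}. w j = 0)" for w
  proof -
    have "?q v = 0 \<longleftrightarrow> v = 0" for v using q0[of v] cz by auto
    then show ?thesis by (simp add: prod_zero_iff)
  qed
  show ?thesis
  proof (cases "(\<exists>j\<in>{1..m}. u j = 0) \<or> (\<exists>j\<in>{1..m}. u' j = 0)")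
    case True
    then have "(\<exists>j\<in>{1..m}. u j = 0) \<and> (\<exists>j\<in>{1..m}. u' j = 0)"
      using zero[of u] zero[of u'] unfolding P by linarith
    then show ?thesis unfolding same_directions_def by (rule disjI1)
  next
    case False
    have "\<exists>\<pi> c. bij_betw \<pi> {1..m} {1..m} \<and> (\<forall>j\<in>{1..m}. B *v u' j = c j *\<^sub>R (B *v u (\<pi> j))) \<and>
      1 * (\<Prod>j\<in>{1..m}. c j) = (1::real)"
      by (rule match_real_forms[OF cf d]) (use False P in \<open>simp_all add: B0\<close>)
    then obtain \<pi> c where p: "bij_betw \<pi> {1..m} {1..m}"
      "\<forall>j\<in>{1..m}. B *v u' j = c j *\<^sub>R (B *v u (\<pi> j))" "(\<Prod>j\<in>{1..m}. c j) = (1::real)"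
      by auto
    \<comment> \<open>\<open>permutes\<close> also prescribes the values outside of the index set\<close>
    define \<rho> where "\<rho> j = (if j \<in> {1..m} then \<pi> j else j)" for j
    have \<rho>: "\<rho> permutes {1..m}"
    proof (rule bij_imp_permutes)
      show "bij_betw \<rho> {1..m} {1..m}"
        using p(1) by (subst bij_betw_cong[of _ _ \<pi>]) (auto simp: \<rho>_def)
    qed (auto simp: \<rho>_def)
    have "u' j = c j *\<^sub>R u (\<rho> j)" if "j \<in> {1..m}" for j
    proof (rule B_inj)
      have "\<rho> j = \<pi> j" using that by (simp add: \<rho>_def)
      then show "B *v u' j = B *v (c j *\<^sub>R u (\<rho> j))"
        using bspec[OF p(2) that] by (simp only: matrix_vector_mult_scaleR)
    qed
    with \<rho> p(3) have "\<rho> permutes {1..m} \<and> (\<Prod>j\<in>{1..m}. c j) = 1 \<and> (\<forall>j\<in>{1..m}. u' j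
      = c j *\<^sub>R u (\<rho> j))"
      by (intro conjI ballI)
    then show ?thesis unfolding same_directions_def by (intro disjI2 exI)
  qed
qed

end

section \<open>Iterated directional derivatives of the inverse square root\<close>

text \<open>A continuous branch of the square root agrees near \<open>v\<close> with \<open>c csqrt (Q / c\<^sup>2)\<close>, where \<open>c\<close>
  is its value at \<open>v\<close>: by continuity the quotient of the branch by \<open>c\<close> has positive real part.
  The chain rule does the rest.\<close>

lemma sqrt_branch_has_vector_derivative:
  assumes s: "sqrt_branch B s" and v: "reval (Qpoly B) v \<noteq> 0" and sym: "transpose B = B"
  shows "((\<lambda>t. s (v + t *\<^sub>R w)) has_vector_derivative of_real (v \<bullet> (B *v w)) / s v) (at 0)"
proof -
  let ?Q = "\<lambda>v. reval (Qpoly B) v"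
  have Q: "?Q = ev (quad B)" by (simp add: reval_eq_ev Qpoly_eq_quad)
  have op: "open {v. ?Q v \<noteq> 0}"
    unfolding Q by (intro open_Collect_neq continuous_intros)
  have cont: "continuous_on {v. ?Q v \<noteq> 0} s" and s2: "?Q v \<noteq> 0 \<Longrightarrow> (s v)\<^sup>2 = of_real (?Q v)" for v
    using s by (auto simp: sqrt_branch_def)
  define c where "c = s v"
  have c2: "c\<^sup>2 = of_real (?Q v)" and c0: "c \<noteq> 0" using s2[OF v] v by (auto simp: c_def)
  define A where "A = (\<lambda>t::real. v + t *\<^sub>R w) -` {v. ?Q v \<noteq> 0}"
  \<comment> \<open>near \<open>t = 0\<close> the branch is on the same side as \<open>c\<close>, where it must be the principal square root\<close>
  define T where "T = A \<inter> (\<lambda>t. Re (s (v + t *\<^sub>R w) / c)) -` {0<..}"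
  have "open A" unfolding A_def by (intro open_vimage op continuous_intros)
  moreover have "continuous_on A (\<lambda>t. Re (s (v + t *\<^sub>R w) / c))"
    unfolding A_def using c0
    by (intro continuous_intros continuous_on_compose2[OF cont]) auto
  ultimately have T: "open T" unfolding T_def
    by (intro continuous_open_preimage) auto
  have T0: "0 \<in> T" using v c0 by (simp add: T_def A_def c_def)
  have eq: "c * csqrt (of_real (?Q (v + t *\<^sub>R w)) / c\<^sup>2) = s (v + t *\<^sub>R w)" if "t \<in> T" for t
  proof -
    have "csqrt (of_real (?Q (v + t *\<^sub>R w)) / c\<^sup>2) = s (v + t *\<^sub>R w) / c"
      using that by (intro csqrt_unique) (auto simp: T_def A_def power_divide s2)
    then show ?thesis using c0 by simp
  qed
  have Qd: "((\<lambda>t. of_real (?Q (v + t *\<^sub>R w)) / c\<^sup>2) has_vector_derivative of_real (2 * (v \<bullet>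
    (B *v w))) / c\<^sup>2) (at 0)"
  proof -
    have "((\<lambda>t. ?Q (v + t *\<^sub>R w)) has_real_derivative 2 * (v \<bullet> (B *v w))) (at 0)"
      unfolding Q quad_add_scale[OF sym] by (auto intro!: derivative_eq_intros)
    from has_vector_derivative_mult_left[OF has_vector_derivative_of_real[OF this], of
      "inverse (c\<^sup>2)"]
    show ?thesis by (simp only: divide_inverse)
  qed
  have c1: "of_real (?Q (v + 0 *\<^sub>R w)) / c\<^sup>2 = 1" using c2 v by simp
  have "((\<lambda>t. csqrt (of_real (?Q (v + t *\<^sub>R w)) / c\<^sup>2)) has_vector_derivative
     of_real (2 * (v \<bullet> (B *v w))) / c\<^sup>2 * (1 / 2)) (at 0)"
    using field_vector_diff_chain_at[OF Qd, of csqrt "1/2"] has_field_derivative_csqrt[of 1] c1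
    by (simp add: o_def inverse_eq_divide)
  then have "((\<lambda>t. c * csqrt (of_real (?Q (v + t *\<^sub>R w)) / c\<^sup>2)) has_vector_derivative
     c * (of_real (2 * (v \<bullet> (B *v w))) / c\<^sup>2 * (1 / 2))) (at 0)"
    by (intro has_vector_derivative_mult_right)
  moreover have "c * (of_real (2 * (v \<bullet> (B *v w))) / c\<^sup>2 * (1 / 2)) = of_real (v \<bullet> (B *v w)) / s v"
    using c0 by (simp add: c_def power2_eq_square field_simps)
  ultimately have "((\<lambda>t. c * csqrt (of_real (?Q (v + t *\<^sub>R w)) / c\<^sup>2)) has_vector_derivative
     of_real (v \<bullet> (B *v w)) / s v) (at 0)" by simp
  then show ?thesis
    by (rule has_vector_derivative_transform_within_open[OF _ T T0]) (rule eq)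
qed

lemma nabla_of_known:
  assumes "\<And>w. ((\<lambda>t. f (v + t *\<^sub>R w)) has_vector_derivative D w) (at (0::real))"
  shows "nabla u f v = D (re_part u) + \<i> * D (im_part u)"
  unfolding nabla_def re_part_def[symmetric] im_part_def[symmetric] vector_derivative_at[OF assms]
    ..

lemma cvec_parts: "u = cvec (re_part u) + \<i> *s cvec (im_part u)"
  by (simp add: vec_eq_iff cvec_def re_part_def im_part_def complex_eq_iff)

lemma dir_der_add_left: "dir_der (u + v) p = dir_der u p + dir_der v p"
  by (simp add: dir_der_def cst_add distrib_right sum.distrib)

lemma dir_der_scale_left: "dir_der (c *s u) p = cst c * dir_der u p"
  by (simp add: dir_der_def cst_mult sum_distrib_left mult.assoc)

text \<open>With \<open>s\<^sup>2 = Q\<close> all half-integral powers of \<open>Q\<close> are odd powers of \<open>s\<close>, which avoids powers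
  with real exponents and treats all branches alike.\<close>

lemma foldr_nabla_inverse_sqrt:
  assumes s: "sqrt_branch B s" and sym: "transpose B = B" and v: "reval (Qpoly B) v \<noteq> 0"
  shows "foldr nabla us (\<lambda>w. inverse (s w)) v =
    ev (maxwell_poly (cmat B) us) (cvec v) * inverse (s v) ^ (2 * length us + 1)"
  using v
proof (induction us arbitrary: v)
  case Nil
  then show ?case by simp
next
  case (Cons u us)
  let ?B = "cmat B"
  let ?H = "maxwell_poly ?B us" and ?m = "length us"
  let ?f = "foldr nabla us (\<lambda>w. inverse (s w))"
  let ?g = "\<lambda>v. ev ?H (cvec v) * inverse (s v) ^ (2 * ?m + 1)"
  have s2: "(s v)\<^sup>2 = of_real (reval (Qpoly B) v)" using s Cons.prems
    by (auto simp: sqrt_branch_def)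
  then have s0: "s v \<noteq> 0" using Cons.prems by auto
  define D where "D w = (ev (quad ?B) (cvec v) * ev (dir_der (cvec w) ?H) (cvec v)
    - of_nat (2 * ?m + 1) * (ev (lin (?B *v cvec w)) (cvec v) * ev ?H (cvec v))) * inverse (s v) ^
      (2 * ?m + 3)" for w
  have der: "((\<lambda>t. ?f (v + t *\<^sub>R w)) has_vector_derivative D w) (at (0::real))" for w
  proof -
    have op: "open ((\<lambda>t::real. v + t *\<^sub>R w) -` {v. reval (Qpoly B) v \<noteq> 0})"
      unfolding reval_eq_ev by (intro open_vimage open_Collect_neq continuous_intros)
    have H: "((\<lambda>t. ev ?H (cvec (v + t *\<^sub>R w))) has_vector_derivative ev (dir_der (cvec w) ?H)
      (cvec v)) (at 0)"
    proof -
      have "((\<lambda>t. cvec (v + t *\<^sub>R w) $ i) has_vector_derivative of_real (w $ i)) (at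
        (0::real))" for i
        by (auto intro!: derivative_eq_intros simp: cvec_def has_vector_derivative_complex_iff)
      from ev_has_vector_derivative[OF this, of ?H] show ?thesis
        by (simp add: dir_der_def) (simp add: cvec_def)
    qed
    let ?s' = "of_real (v \<bullet> (B *v w)) / s v"
    have S: "((\<lambda>t. s (v + t *\<^sub>R w)) has_vector_derivative ?s') (at 0)"
      by (rule sqrt_branch_has_vector_derivative[OF s Cons.prems sym])
    have "((\<lambda>z. inverse z ^ (2 * ?m + 1)) has_field_derivative
       of_nat (2 * ?m + 1) * (- (inverse (s v) ^ Suc (Suc 0)) * inverse (s v) ^ (2 * ?m + 1
         - Suc 0))) (at (s (v + 0 *\<^sub>R w)))"
      using DERIV_power[OF DERIV_inverse[OF s0], of "2 * ?m + 1"] by simp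
    from field_vector_diff_chain_at[OF S this] have I:
      "((\<lambda>t. inverse (s (v + t *\<^sub>R w)) ^ (2 * ?m + 1)) has_vector_derivative
       ?s' * (of_nat (2 * ?m + 1) * (- (inverse (s v) ^ Suc (Suc 0)) * inverse (s v) ^ (2 * ?m + 1
         - Suc 0)))) (at 0)"
      by (simp only: o_def)
    have b: "ev (lin (?B *v cvec w)) (cvec v) = of_real (v \<bullet> (B *v w))"
      by (simp add: cvec_matrix_vector_mult flip: complexify_lin)
        (simp add: ev_complexify_cvec ev_lin_inner inner_commute)
    have q: "ev (quad ?B) (cvec v) = (s v)\<^sup>2"
      by (simp add: s2 reval_eq_ev Qpoly_eq_quad ev_complexify_cvec flip: complexify_quad)
    have "((\<lambda>t. ?g (v + t *\<^sub>R w)) has_vector_derivative D w) (at 0)"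
      by (rule has_vector_derivative_eq_rhs[OF has_vector_derivative_mult[OF H I]])
        (use s0 in \<open>simp add: D_def b q field_simps power2_eq_square power_add numeral_3_eq_3\<close>)
    then show ?thesis
      by (rule has_vector_derivative_transform_within_open[OF _ op]) (use Cons in simp_all)
  qed
  have "foldr nabla (u # us) (\<lambda>w. inverse (s w)) v = D (re_part u) + \<i> * D (im_part u)"
    using nabla_of_known[OF der] by simp
  also have "\<dots> = ev (maxwell_poly ?B (u # us)) (cvec v) * inverse (s v) ^ (2 * length (u # us) + 1)"
  proof -
    have 1: "dir_der u ?H = dir_der (cvec (re_part u)) ?H + cst \<i> * dir_der (cvec (im_part u)) ?H"
      by (subst cvec_parts[of u]) (simp add: dir_der_add_left dir_der_scale_left)
    have 2: "lin (?B *v u) = lin (?B *v cvec (re_part u)) + cst \<i> * lin (?B *v cvec (im_part u))"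
      by (subst cvec_parts[of u]) (simp add: matrix_vector_right_distrib vector_scalar_commute
        lin_add lin_scale)
    have 3: "2 * length (u # us) + 1 = 2 * ?m + 3" by simp
    show ?thesis
      unfolding maxwell_poly.simps 1 2 3 D_def
      by (simp del: of_nat_add of_nat_mult of_nat_Suc) (simp only: algebra_simps)
  qed
  finally show ?case .
qed

lemma maxwell_term_eq:
  assumes s: "sqrt_branch B s" and sym: "transpose B = B" and v: "reval (Qpoly B) v \<noteq> 0" and k:
      "2 * k \<le> d"
  shows "maxwell_term B s d u \<mu> k v = of_real (reval (Qpoly B) v) ^ k *
    (if 2 * k = d then \<mu> else ev (maxwell_poly (cmat B) (map (u k) [1..<Suc (d - 2 * k)]))
      (cvec v))"
proof (cases "2 * k = d")
  case False
  define m where "m = d - 2 * k"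
  have s2: "(s v)\<^sup>2 = of_real (reval (Qpoly B) v)" using s v by (auto simp: sqrt_branch_def)
  then have s0: "s v \<noteq> 0" using v by auto
  have dk: "d - k = k + m" using k by (simp add: m_def)
  have "of_real (reval (Qpoly B) v) ^ (d - k) * s v * inverse (s v) ^ (2 * m + 1)
    = of_real (reval (Qpoly B) v) ^ k"
    unfolding dk s2[symmetric] using s0
    by (simp add: power_add power_mult power_inverse field_simps flip: power_mult)
  moreover have "maxwell_term B s d u \<mu> k v = of_real (reval (Qpoly B) v) ^ (d - k) * s v *
    (ev (maxwell_poly (cmat B) (map (u k) [1..<Suc m])) (cvec v) * inverse (s v) ^ (2 * m + 1))"
    using foldr_nabla_inverse_sqrt[OF s sym v, of "map (u k) [1..<Suc m]"] False
    by (simp only: maxwell_term_def m_def[symmetric] if_False length_map length_upt diff_Suc_1)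
  moreover have "x * y * (e * z) = (x * y * z) * e" for x y z e :: complex by simp
  ultimately show ?thesis
    unfolding m_def[symmetric] using False by (simp only: if_False)
qed (simp add: maxwell_term_def mult.commute)

section \<open>Maxwell representations\<close>

lemma double_le_set: "{k. 2 * k \<le> d} = {..d div (2::nat)}"
  by auto

lemma maxwell_repI:
  assumes sym: "transpose B = B"
    and P: "P = (\<Sum>k\<le>d div 2. quad B ^ k * g k)"
    and u: "\<And>k. 2 * k < d \<Longrightarrow>
      maxwell_poly (cmat B) (map (u k) [1..<Suc (d - 2 * k)]) = complexify (g k)"
    and \<mu>: "\<And>k. 2 * k = d \<Longrightarrow> g k = cst r \<and> \<mu> = of_real r"
  shows "maxwell_rep B d P u \<mu>"
  unfolding maxwell_rep_def
proof (intro allI impI)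
  fix s v assume s: "sqrt_branch B s" and v: "reval (Qpoly B) v \<noteq> 0"
  have t: "maxwell_term B s d u \<mu> k v = of_real (ev (quad B ^ k * g k) v)" if "2 * k \<le> d" for k
  proof (cases "2 * k = d")
    case True
    then show ?thesis
      using \<mu>[OF True] by (simp add: maxwell_term_eq[OF s sym v that] reval_eq_ev Qpoly_eq_quad)
  next
    case False
    then show ?thesis using u[of k] that
      by (simp add: maxwell_term_eq[OF s sym v that] reval_eq_ev Qpoly_eq_quad ev_complexify_cvec
        del: upt_Suc)
  qed
  have "(\<Sum>k | 2 * k \<le> d. maxwell_term B s d u \<mu> k v)
    = of_real (\<Sum>k | 2 * k \<le> d. ev (quad B ^ k * g k) v)"
    by (simp only: of_real_sum) (intro sum.cong refl, simp only: mem_Collect_eq t)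
  then show "reval P v = Re (\<Sum>k | 2 * k \<le> d. maxwell_term B s d u \<mu> k v)"
    by (simp add: P reval_eq_ev double_le_set)
qed

lemma list_as_indexed: "length us = m \<Longrightarrow> map (\<lambda>j. us ! (j - 1)) [1..<Suc m] = us"
  by (intro nth_equalityI) (auto simp del: upt_Suc)

lemma maxwell_rep_exists:
  fixes B :: "real^3^3"
  assumes Bsym: "transpose B = B" and inv: "invertible B" and P: "P \<in> hom d"
  shows "\<exists>u \<mu>. maxwell_rep B d P u \<mu>"
proof -
  interpret R: nondeg_form B "matrix_inv B"
    by (rule nondeg_form_matrix_inv[OF Bsym inv])
  interpret C: nondeg_form "cmat B" "cmat (matrix_inv B)"
    by (rule nondeg_form_complexify) unfold_locales
  obtain F where F: "orthogonal_frame B F (\<lambda>i. F $ i \<bullet> (B *v (F $ i)))"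
    using orthogonal_frame_exists[OF Bsym inv] .
  interpret complex_frame "cmat B" "cmat F"
    "\<lambda>i. of_real (F $ i \<bullet> (B *v (F $ i)))"
    by (rule complex_frame_complexify[OF Bsym F])
  obtain g where g: "\<And>k. k \<le> d div 2 \<Longrightarrow> g k \<in> hom (d - 2 * k) \<and> lap (matrix_inv B) (g k) = 0"
    "P = (\<Sum>k\<le>d div 2. quad B ^ k * g k)"
    using R.harmonic_decomposition_exists[OF P] by blast
  have "\<exists>us. length us = d - 2 * k \<and> maxwell_poly (cmat B) us = complexify (g k)" if k:
    "2 * k < d" for k
  proof -
    have gk: "g k \<in> hom (d - 2 * k)" "lap (matrix_inv B) (g k) = 0" using g(1)[of k] k by auto
    obtain c as where as: "length as = d - 2 * k"
      "quad (cmat B) dvd complexify (g k) - cst c * (\<Prod>a\<leftarrow>as. lin a)"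
      using complex_sylvester[OF hom_complexify[OF gk(1)]] by blast
    show ?thesis
      by (rule C.harmonic_eq_maxwell_poly[OF _ _ as]) (use gk k in \<open>simp_all flip: complexify_lap\<close>)
  qed
  then obtain U where U: "\<And>k. 2 * k < d \<Longrightarrow> length (U k) = d - 2 * k \<and>
     maxwell_poly (cmat B) (U k) = complexify (g k)" by metis
  define u where "u k j = U k ! (j - 1)" for k j
  define r where "r = coef (g (d div 2)) 0"
  have "maxwell_rep B d P u (of_real r)"
  proof (rule maxwell_repI[OF Bsym g(2)])
    fix k assume k: "2 * k < d"
    show "maxwell_poly (cmat B) (map (u k) [1..<Suc (d - 2 * k)]) = complexify (g k)"
      unfolding u_def using U[OF k] list_as_indexed[of "U k" "d - 2 * k"] by (simp del: upt_Suc)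
  next
    fix k assume "2 * k = d"
    then have "k = d div 2" "d - 2 * k = 0" by auto
    then show "g k = cst r \<and> complex_of_real r = of_real r"
      using g(1)[of k] hom_zero_eq_cst[of "g k"] by (simp add: r_def)
  qed
  then show ?thesis by blast
qed

context pos_def_form
begin

lemma real_maxwell_rep_exists:
  assumes P: "P \<in> hom d"
  shows "\<exists>(u :: nat \<Rightarrow> nat \<Rightarrow> real^3) \<mu>. maxwell_rep B d P (\<lambda>k j. cvec (u k j)) (of_real \<mu>)"
proof -
  interpret R: nondeg_form B "matrix_inv B"
    by (rule nondeg_form_matrix_inv[OF sym inv])
  obtain g where g: "\<And>k. k \<le> d div 2 \<Longrightarrow> g k \<in> hom (d - 2 * k) \<and> lap (matrix_inv B) (g k) = 0"
    "P = (\<Sum>k\<le>d div 2. quad B ^ k * g k)"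
    using R.harmonic_decomposition_exists[OF P] by blast
  have "\<exists>us. length us = d - 2 * k \<and> maxwell_poly B us = g k" if k: "2 * k < d" for k
  proof -
    have gk: "g k \<in> hom (d - 2 * k)" "lap (matrix_inv B) (g k) = 0" using g(1)[of k] k by auto
    obtain c as where as: "length as = d - 2 * k" "quad B dvd g k - cst c * (\<Prod>a\<leftarrow>as. lin a)"
      using real_sylvester[OF gk(1)] by blast
    show ?thesis by (rule R.harmonic_eq_maxwell_poly[OF gk(2) _ as]) (use k in simp)
  qed
  then obtain U where U: "\<And>k. 2 * k < d \<Longrightarrow> length (U k) = d - 2 * k \<and> maxwell_poly B (U k) = g k"
    by metis
  define u where "u k j = U k ! (j - 1)" for k j
  define r where "r = coef (g (d div 2)) 0"
  have "maxwell_rep B d P (\<lambda>k j. cvec (u k j)) (of_real r)"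
  proof (rule maxwell_repI[OF sym g(2)])
    fix k assume k: "2 * k < d"
    have "map (\<lambda>j. cvec (u k j)) [1..<Suc (d - 2 * k)] = map cvec (map (u k) [1..<Suc (d - 2 * k)])"
      by simp
    also have "map (u k) [1..<Suc (d - 2 * k)] = U k"
      unfolding u_def using U[OF k] list_as_indexed[of "U k" "d - 2 * k"] by (simp del: upt_Suc)
    finally show "maxwell_poly (cmat B) (map (\<lambda>j. cvec (u k j)) [1..<Suc (d - 2 * k)])
      = complexify (g k)"
      using U[OF k] by (simp only: complexify_maxwell_poly[symmetric])
  next
    fix k assume "2 * k = d"
    then have "k = d div 2" "d - 2 * k = 0" by auto
    then show "g k = cst r \<and> complex_of_real r = of_real r"
      using g(1)[of k] hom_zero_eq_cst[of "g k"] by (simp add: r_def)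
  qed
  then show ?thesis by blast
qed

text \<open>On a positive definite form the branch of the square root can be taken real, which makes
  all terms real. The identity then holds on an open set and is an identity of polynomials.\<close>

lemma real_maxwell_rep_decomposition:
  fixes u :: "nat \<Rightarrow> nat \<Rightarrow> real^3" and \<mu> :: real
  assumes "maxwell_rep B d P (\<lambda>k j. cvec (u k j)) (of_real \<mu>)"
  shows "P = (\<Sum>k\<le>d div 2. quad B ^ k *
    (if 2 * k = d then cst \<mu> else maxwell_poly B (map (u k) [1..<Suc (d - 2 * k)])))" (is "P = ?R")
proof -
  have Qpos: "reval (Qpoly B) v > 0" if "v \<noteq> 0" for v
    using pos[OF that] by (simp add: reval_eq_ev Qpoly_eq_quad ev_quad_inner)
  have Q0: "reval (Qpoly B) v \<noteq> 0 \<longleftrightarrow> v \<noteq> 0" for v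
    using Qpos[of v] by (cases "v = 0") (auto simp: reval_eq_ev Qpoly_eq_quad ev_quad_inner)
  define s where "s v = complex_of_real (sqrt (reval (Qpoly B) v))" for v
  have s: "sqrt_branch B s"
    unfolding sqrt_branch_def
  proof (intro conjI allI impI)
    show "continuous_on {v. reval (Qpoly B) v \<noteq> 0} s"
      unfolding s_def reval_eq_ev by (intro continuous_intros)
    fix v assume "reval (Qpoly B) v \<noteq> 0"
    then have "reval (Qpoly B) v \<ge> 0" using Q0 Qpos less_imp_le by blast
    then show "(s v)\<^sup>2 = of_real (reval (Qpoly B) v)"
      by (simp add: s_def flip: of_real_power)
  qed
  have "ev (P - ?R) v = 0" if "v \<in> - {0}" for v
  proof -
    have v: "reval (Qpoly B) v \<noteq> 0" using that Q0 by simp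
    have t: "maxwell_term B s d (\<lambda>k j. cvec (u k j)) (of_real \<mu>) k v
      = of_real (ev (quad B ^ k * (if 2 * k
        = d then cst \<mu> else maxwell_poly B (map (u k) [1..<Suc (d - 2 * k)]))) v)"
      if "2 * k \<le> d" for k
    proof -
      have "map (\<lambda>j. cvec (u k j)) [1..<Suc (d - 2 * k)]
        = map cvec (map (u k) [1..<Suc (d - 2 * k)])" by simp
      then have "ev (maxwell_poly (cmat B) (map (\<lambda>j. cvec (u k j)) [1..<Suc (d - 2 * k)])) (cvec v)
        = of_real (ev (maxwell_poly B (map (u k) [1..<Suc (d - 2 * k)])) v)"
        by (simp only: complexify_maxwell_poly[symmetric] ev_complexify_cvec)
      then show ?thesis
        by (simp add: maxwell_term_eq[OF s sym v that] reval_eq_ev Qpoly_eq_quad del: upt_Suc)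
    qed
    have "reval P v = Re (\<Sum>k | 2 * k \<le> d. maxwell_term B s d (\<lambda>k j. cvec (u k j)) (of_real \<mu>) k v)"
      using assms s v unfolding maxwell_rep_def by blast
    also have "(\<Sum>k | 2 * k \<le> d. maxwell_term B s d (\<lambda>k j. cvec (u k j)) (of_real \<mu>) k v)
      = (\<Sum>k | 2 * k \<le> d. of_real (ev (quad B ^ k * (if 2 * k
        = d then cst \<mu> else maxwell_poly B (map (u k) [1..<Suc (d - 2 * k)]))) v))"
      by (intro sum.cong refl t) simp
    also have "\<dots> = of_real (ev ?R v)"
      by (simp only: double_le_set of_real_sum ev_simps)
    finally show ?thesis by (simp add: reval_eq_ev del: upt_Suc)
  qed
  moreover have "open (- {0 :: real^3})" "- {0 :: real^3} \<noteq> {}"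
    using UNIV_not_singleton[where 'a = "real^3"] by auto
  ultimately have "P - ?R = 0" by (intro ev_zero_on_open_imp_zero)
  then show ?thesis by (simp only: right_minus_eq)
qed

lemma real_maxwell_rep_unique:
  fixes u u' :: "nat \<Rightarrow> nat \<Rightarrow> real^3" and \<mu> \<mu>' :: real
  assumes 1: "maxwell_rep B d P (\<lambda>k j. cvec (u k j)) (of_real \<mu>)"
    and 2: "maxwell_rep B d P (\<lambda>k j. cvec (u' k j)) (of_real \<mu>')"
  shows "(\<forall>k. 2 * k < d \<longrightarrow> same_directions (d - 2 * k) (u k) (u' k)) \<and> (even d \<longrightarrow> \<mu> = \<mu>')"
proof -
  interpret R: nondeg_form B "matrix_inv B"
    by (rule nondeg_form_matrix_inv[OF sym inv])
  let ?g = "\<lambda>u \<mu> k. if 2 * k = d then cst \<mu> else maxwell_poly B (map (u k) [1..<Suc (d - 2 * k)])"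
  have h: "lap (matrix_inv B) (?g u \<mu> k) = 0" for u \<mu> k
    by (simp add: R.lap_maxwell_poly lap_hom_less_2[OF hom_cst] del: upt_Suc)
  have "(\<Sum>k\<le>d div 2. quad B ^ k * (?g u \<mu> k - ?g u' \<mu>' k)) = P - P"
    unfolding right_diff_distrib sum_subtractf
    by (simp only: real_maxwell_rep_decomposition[OF 1, symmetric]
      real_maxwell_rep_decomposition[OF 2, symmetric])
  then have z: "(\<Sum>k\<le>d div 2. quad B ^ k * (?g u \<mu> k - ?g u' \<mu>' k)) = 0" by simp
  have eq: "?g u \<mu> k = ?g u' \<mu>' k" if "k \<le> d div 2" for k
  proof -
    have "?g u \<mu> k - ?g u' \<mu>' k = 0"
      by (rule R.harmonic_decomposition_unique[OF _ z that]) (simp only: lap_diff h diff_self)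
    then show ?thesis by (simp only: right_minus_eq)
  qed
  show ?thesis
  proof (intro conjI allI impI)
    fix k assume "2 * k < d"
    then show "same_directions (d - 2 * k) (u k) (u' k)"
      using eq[of k] by (intro maxwell_poly_eq_imp_same_directions) (simp del: upt_Suc)
  next
    assume "even d"
    then have "cst \<mu> = cst \<mu>'" using eq[of "d div 2"] by (simp del: upt_Suc)
    from arg_cong[OF this, of "\<lambda>p. ev p 0"] show "\<mu> = \<mu>'" by simp
  qed
qed

end

section \<open>Rotations and the surface measure of the sphere\<close>

definition rot :: "3 \<Rightarrow> 3 \<Rightarrow> real \<Rightarrow> real^3 \<Rightarrow> real^3" where
  "rot i j t w = (\<chi> k. if k = i then cos t * w $ i - sin t * w $ j
     else if k = j then sin t * w $ i + cos t * w $ j else w $ k)"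

text \<open>The infinitesimal generator of the rotations in the plane of the coordinates \<open>i\<close> and \<open>j\<close>.\<close>

definition angular :: "3 \<Rightarrow> 3 \<Rightarrow> 'a::comm_ring_1 tpoly \<Rightarrow> 'a tpoly" where
  "angular i j p = var i * der j p - var j * der i p"

lemma orthogonal_transformation_rot:
  assumes "i \<noteq> j" shows "orthogonal_transformation (rot i j t)"
proof -
  have "linear (rot i j t)"
    by (rule linearI) (simp_all add: rot_def vec_eq_iff algebra_simps)
  moreover have "norm (rot i j t v) = norm v" for v
  proof -
    have cs: "(cos t * a - sin t * b)\<^sup>2 + (sin t * a + cos t * b)\<^sup>2 = a\<^sup>2 + b\<^sup>2" for a b :: real
    proof -
      have "(sin t)\<^sup>2 + (cos t)\<^sup>2 = 1" by simp
      then show ?thesis by algebra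
    qed
    have N: "(norm x)\<^sup>2 = (x $ 1)\<^sup>2 + (x $ 2)\<^sup>2 + (x $ 3)\<^sup>2" for x :: "real^3"
      by (simp add: power2_norm_eq_inner inner_vec_def sum_3) (simp add: power2_eq_square)
    have "(norm (rot i j t v))\<^sup>2 = (norm v)\<^sup>2"
      using exhaust_3[of i] exhaust_3[of j] assms cs[of "v $ i" "v $ j"]
      unfolding N by (elim disjE) (simp_all add: rot_def)
    then show ?thesis by (simp add: power2_eq_iff_nonneg)
  qed
  ultimately show ?thesis by (simp add: orthogonal_transformation)
qed

lemma cone_density_measurable [measurable]:
  "(\<lambda>x :: real^3. 3 * indicator (ball 0 1) x :: ennreal) \<in> borel_measurable borel"
proof -
  have [measurable]: "ball (0 :: real^3) 1 \<in> sets borel" by simp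
  show ?thesis by measurable
qed

text \<open>Orthogonal maps preserve the unit ball and Lebesgue measure.\<close>

lemma distr_cone_density_orthogonal:
  fixes f :: "real^3 \<Rightarrow> real^3"
  assumes f: "orthogonal_transformation f"
  shows "distr (density lborel (\<lambda>x. 3 * indicator (ball 0 1) x)) borel f
    = density lborel (\<lambda>x. 3 * indicator (ball 0 1) x)" (is "distr ?N borel f = ?N")
proof (rule measure_eqI)
  have "continuous_on UNIV f"
    using f by (simp add: orthogonal_transformation_def linear_continuous_on linear_linear)
  then have fm [measurable]: "f \<in> borel_measurable borel" by (rule borel_measurable_continuous_onI)
  have N: "emeasure ?N X = 3 * emeasure lborel (ball 0 1 \<inter> X)" if [measurable]:
    "X \<in> sets borel" for X
  proof -
    have "emeasure ?N X = (\<integral>\<^sup>+ x. 3 * indicator (ball 0 1 \<inter> X) x \<partial>lborel)"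
      by (subst emeasure_density) (auto intro!: nn_integral_cong simp: indicator_def)
    then show ?thesis by (simp add: nn_integral_cmult_indicator)
  qed
  fix X assume "X \<in> sets (distr ?N borel f)"
  then have X [measurable]: "X \<in> sets borel" by simp
  let ?S = "ball 0 1 \<inter> f -` X"
  have S [measurable]: "?S \<in> sets borel" using measurable_sets[OF fm X] by auto
  have img: "f ` ?S = ball 0 1 \<inter> X"
  proof -
    have "surj f" by (rule orthogonal_transformation_surj[OF f])
    moreover have "f x \<in> ball 0 1 \<longleftrightarrow> x \<in> ball 0 1" for x
      using f by (simp add: orthogonal_transformation)
    then have "?S = f -` (ball 0 1 \<inter> X)" by (intro set_eqI) (simp only: Int_iff vimage_eq)
    ultimately show ?thesis by (simp only: surj_image_vimage_eq)
  qed
  have lm: "Y \<in> lmeasurable" if "Y \<in> sets borel" "Y \<subseteq> ball 0 1" for Y :: "(real^3) set"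
    using that bounded_set_imp_lmeasurable[of Y] bounded_subset[OF bounded_ball] by auto
  have e: "emeasure lborel Y = ennreal (measure lebesgue Y)" if "Y \<in> sets borel"
    "Y \<subseteq> ball 0 1" for Y :: "(real^3) set"
  proof -
    have "emeasure lborel Y = emeasure lebesgue Y" using that(1) by (simp add: emeasure_completion)
    also have "\<dots> = ennreal (measure lebesgue Y)" by (rule emeasure_eq_measure2[OF lm[OF that]])
    finally show ?thesis .
  qed
  have "emeasure lborel ?S = emeasure lborel (ball 0 1 \<inter> X)"
    using measure_orthogonal_image[OF f lm[OF S]] by (simp add: e img)
  moreover have "emeasure (distr ?N borel f) X = emeasure ?N (f -` X)"
    by (subst emeasure_distr) auto
  moreover have "f -` X \<in> sets borel" using measurable_sets[OF fm X] by simp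
  ultimately show "emeasure (distr ?N borel f) X = emeasure ?N X"
    by (simp add: N)
qed simp

lemma radial_measurable [measurable]: "(\<lambda>x :: real^3. x /\<^sub>R norm x) \<in> borel_measurable borel"
  by measurable

lemma sets_sphere_measure [simp, measurable_cong]: "sets sphere_measure = sets borel"
  by (simp add: sphere_measure_def)

lemma space_sphere_measure [simp]: "space sphere_measure = UNIV"
  by (simp add: sphere_measure_def)

lemma finite_measure_sphere_measure: "finite_measure sphere_measure"
proof (rule finite_measureI)
  have "emeasure sphere_measure UNIV
    = (\<integral>\<^sup>+ x. 3 * indicator (ball 0 1) x \<partial>(lborel :: (real^3) measure))"
    unfolding sphere_measure_def by (subst emeasure_distr)
      (simp_all add: emeasure_density cone_density_measurable)
  also have "\<dots> = 3 * emeasure (lborel :: (real^3) measure) (ball 0 1)"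
    by (simp add: nn_integral_cmult_indicator)
  also have "\<dots> < \<infinity>"
    using emeasure_bounded_finite[OF bounded_ball, of "0 :: real^3" 1]
      by (simp add: ennreal_mult_less_top)
  finally show "emeasure sphere_measure (space sphere_measure) \<noteq> \<infinity>" by simp
qed

lemma AE_sphere_measure_norm: "AE w in sphere_measure. norm w = 1"
proof -
  have "AE x in density lborel (\<lambda>x. 3 * indicator (ball 0 1) x). norm (x /\<^sub>R norm (x :: real^3))
    = 1"
    by (subst AE_density) (use AE_lborel_singleton[of "0 :: real^3"]
      in \<open>auto simp: cone_density_measurable elim!: eventually_mono\<close>)
  then show ?thesis unfolding sphere_measure_def by (subst AE_distr_iff) auto
qed

lemma distr_sphere_measure_orthogonal:
  assumes f: "orthogonal_transformation f"
  shows "distr sphere_measure borel f = sphere_measure"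
proof -
  let ?N = "density lborel (\<lambda>x :: real^3. 3 * indicator (ball 0 1) x)" and ?r =
    "\<lambda>x :: real^3. x /\<^sub>R norm x"
  have "continuous_on UNIV f"
    using f by (simp add: orthogonal_transformation_def linear_continuous_on linear_linear)
  then have fm [measurable]: "f \<in> borel_measurable borel" by (rule borel_measurable_continuous_onI)
  have "f \<circ> ?r = ?r \<circ> f"
    using f by (auto simp: fun_eq_iff orthogonal_transformation linear_cmul)
  then have "distr sphere_measure borel f = distr (distr ?N borel f) borel ?r"
    unfolding sphere_measure_def by (simp add: distr_distr)
  then show ?thesis by (simp add: distr_cone_density_orthogonal[OF f] sphere_measure_def)
qed

section \<open>Integrals of polynomials over the sphere\<close>

definition sphere_integral :: "complex tpoly \<Rightarrow> complex" where
  "sphere_integral p = (\<integral>w. ev p (cvec w) \<partial>sphere_measure)"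

lemma continuous_on_ev_cvec: "continuous_on S (\<lambda>w. ev p (cvec w))"
  unfolding cvec_def by (intro continuous_intros)

lemma ev_cvec_measurable [measurable]: "(\<lambda>w. ev p (cvec w)) \<in> borel_measurable borel"
  by (intro borel_measurable_continuous_onI continuous_on_ev_cvec)

lemma ev_cvec_bounded: "\<exists>K\<ge>0. \<forall>w. norm w \<le> 1 \<longrightarrow> norm (ev p (cvec w)) \<le> K"
proof -
  have "bounded ((\<lambda>w. ev p (cvec w)) ` cball 0 1)"
    by (intro compact_imp_bounded compact_continuous_image continuous_on_ev_cvec compact_cball)
  then obtain K where "\<forall>w\<in>cball 0 1. norm (ev p (cvec w)) \<le> K" by (auto simp: bounded_iff)
  then show ?thesis by (intro exI[of _ "max K 0"]) (auto simp: le_max_iff_disj)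
qed

lemma integrable_ev_cvec: "integrable sphere_measure (\<lambda>w. ev p (cvec w))"
proof -
  obtain K where "\<And>w. norm w \<le> 1 \<Longrightarrow> norm (ev p (cvec w)) \<le> K" using ev_cvec_bounded by blast
  then show ?thesis
    by (intro finite_measure.integrable_const_bound[OF finite_measure_sphere_measure, of _ K])
      (use AE_sphere_measure_norm in \<open>auto elim!: eventually_mono\<close>)
qed

lemma sphere_integral_add: "sphere_integral (p + q) = sphere_integral p + sphere_integral q"
  by (simp add: sphere_integral_def integrable_ev_cvec)

lemma sphere_integral_cst_mult: "sphere_integral (cst c * p) = c * sphere_integral p"
  by (simp add: sphere_integral_def)

lemma ev_rot_has_vector_derivative:
  assumes "i \<noteq> j"
  shows "((\<lambda>t. ev p (cvec (rot i j t w))) has_vector_derivative ev (angular i j p) (cvec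
      (rot i j t w))) (at t within S)"
proof -
  let ?d = "\<lambda>k. if k = i then - rot i j t w $ j else if k = j then rot i j t w $ i else 0"
  have r: "((\<lambda>t. rot i j t w $ k) has_real_derivative ?d k) (at t within S)" for k
    using assms by (auto simp: rot_def intro!: derivative_eq_intros)
  have "((\<lambda>t. cvec (rot i j t w) $ k) has_vector_derivative of_real (?d k)) (at t within S)" for k
    using has_vector_derivative_of_real[OF r[of k]] by (simp add: cvec_def)
  from ev_has_vector_derivative[OF this, of p]
  have "((\<lambda>t. ev p (cvec (rot i j t w))) has_vector_derivative
    (\<Sum>k\<in>UNIV. of_real (?d k) * ev (der k p) (cvec (rot i j t w)))) (at t within S)" .
  also have "(\<Sum>k\<in>UNIV. of_real (?d k) * ev (der k p) (cvec (rot i j t w)))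
    = ev (angular i j p) (cvec (rot i j t w))"
    using exhaust_3[of i] exhaust_3[of j] assms by (auto simp: sum_3 angular_def cvec_def)
  finally show ?thesis .
qed

lemma norm_rot: "i \<noteq> j \<Longrightarrow> norm (rot i j t w) = norm w"
  using orthogonal_transformation_rot by (auto simp: orthogonal_transformation)

lemma rot_0 [simp]: "rot i j 0 w = w"
  by (simp add: rot_def vec_eq_iff)

lemma ev_rot_lipschitz:
  assumes "i \<noteq> j" "t \<ge> 0" "norm w \<le> 1" and K:
      "\<And>w. norm w \<le> 1 \<Longrightarrow> norm (ev (angular i j p) (cvec w)) \<le> K"
  shows "norm (ev p (cvec (rot i j t w)) - ev p (cvec w)) \<le> K * t"
proof -
  have "norm (ev p (cvec (rot i j t w)) - ev p (cvec (rot i j 0 w))) \<le> K * norm (t - 0)"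
  proof (rule differentiable_bound[of "{0..t}" _
    "\<lambda>s h. h *\<^sub>R ev (angular i j p) (cvec (rot i j s w))"])
    show "((\<lambda>t. ev p (cvec (rot i j t w))) has_derivative (\<lambda>h. h *\<^sub>R ev (angular i j p) (cvec
      (rot i j s w)))) (at s within {0..t})" for s
      using ev_rot_has_vector_derivative[OF assms(1), of p w s]
        by (simp add: has_vector_derivative_def)
    show "onorm (\<lambda>h. h *\<^sub>R ev (angular i j p) (cvec (rot i j s w))) \<le> K" for s
      by (rule onorm_le) (use K[of "rot i j s w"] norm_rot[OF assms(1)] assms(3)
        in \<open>simp add: mult.commute[of "\<bar>_\<bar>"] mult_right_mono\<close>)
  qed (use assms in auto)
  then show ?thesis using assms(2) by simp
qed

text \<open>The integral of \<open>p\<close> along a rotation is constant in the angle \<open>t\<close>. The second order Taylor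
  estimate is uniform on the sphere, whence \<open>t\<close> times the integral of the derivative is \<open>O(t\<^sup>2)\<close>.\<close>

lemma sphere_integral_angular:
  assumes "i \<noteq> j" shows "sphere_integral (angular i j p) = 0"
proof -
  interpret finite_measure sphere_measure by (rule finite_measure_sphere_measure)
  obtain K where K: "K \<ge> 0" "\<And>w. norm w \<le> 1 \<Longrightarrow> norm (ev (angular i j (angular i j p)) (cvec w)) \<le> K"
    using ev_cvec_bounded[of "angular i j (angular i j p)"] by blast
  let ?M = "measure sphere_measure UNIV"
  have rm [measurable]: "rot i j t \<in> borel_measurable borel" for t
    using orthogonal_transformation_rot[OF assms, of t]
    by (intro borel_measurable_continuous_onI)
      (simp add: orthogonal_transformation_def linear_continuous_on linear_linear)
  have bound: "norm (sphere_integral (angular i j p)) \<le> K * ?M * t" if t: "t > 0" for t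
  proof -
    let ?f = "\<lambda>w. ev p (cvec (rot i j t w))" and ?g = "\<lambda>w. ev p (cvec w)" and ?h =
      "\<lambda>w. ev (angular i j p) (cvec w)"
    have fd: "integral\<^sup>L sphere_measure ?f = sphere_integral p"
    proof -
      have "integral\<^sup>L (distr sphere_measure borel (rot i j t)) ?g = integral\<^sup>L sphere_measure ?f"
        by (rule integral_distr) measurable
      then show ?thesis
        by (simp add: sphere_integral_def distr_sphere_measure_orthogonal[OF
          orthogonal_transformation_rot[OF assms]])
    qed
    have fi: "integrable sphere_measure ?f"
    proof -
      have "integrable (distr sphere_measure borel (rot i j t)) ?g"
        by (simp add: distr_sphere_measure_orthogonal[OF orthogonal_transformation_rot[OF assms]]
          integrable_ev_cvec)
      then show ?thesis by (rule integrable_distr[rotated]) measurable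
    qed
    have pt: "norm (?f w - ?g w - t *\<^sub>R ?h w) \<le> t * (K * t)" if w: "norm w = 1" for w
    proof -
      have "norm (ev p (cvec (rot i j t w)) - ev p (cvec (rot i j 0 w)) - (t - 0) *\<^sub>R ev
        (angular i j p) (cvec (rot i j 0 w)))
        \<le> norm (t - 0) * (K * t)"
      proof (rule vector_differentiable_bound_linearization[where S = "{0..t}"
            and f' = "\<lambda>s. ev (angular i j p) (cvec (rot i j s w))"])
        fix s assume s: "s \<in> {0..t}"
        show "((\<lambda>t. ev p (cvec (rot i j t w))) has_vector_derivative ev (angular i j p) (cvec
          (rot i j s w))) (at s within {0..t})"
          by (rule ev_rot_has_vector_derivative[OF assms])
        have "norm (ev (angular i j p) (cvec (rot i j s w)) - ev (angular i j p) (cvec w)) \<le> K * s"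
          by (rule ev_rot_lipschitz[OF assms _ _ K(2)]) (use s w in auto)
        also have "\<dots> \<le> K * t" using s K(1) by (intro mult_left_mono) auto
        finally show "norm (ev (angular i j p) (cvec (rot i j s w)) - ev (angular i j p) (cvec
          (rot i j 0 w))) \<le> K * t"
          by simp
      qed (use t in \<open>auto simp: closed_segment_eq_real_ivl\<close>)
      then show ?thesis using t by simp
    qed
    have "integral\<^sup>L sphere_measure (\<lambda>w. ?f w - ?g w - t *\<^sub>R ?h w)
      = integral\<^sup>L sphere_measure ?f - sphere_integral p - t *\<^sub>R sphere_integral (angular i j p)"
      using fi by (simp add: sphere_integral_def integrable_ev_cvec)
    then have "norm (t *\<^sub>R sphere_integral (angular i j p))
      = norm (integral\<^sup>L sphere_measure (\<lambda>w. ?f w - ?g w - t *\<^sub>R ?h w))"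
      by (simp add: fd)
    also have "\<dots> \<le> integral\<^sup>L sphere_measure (\<lambda>w. norm (?f w - ?g w - t *\<^sub>R ?h w))"
      by (rule integral_norm_bound)
    also have "\<dots> \<le> integral\<^sup>L sphere_measure (\<lambda>w. t * (K * t))"
      using fi AE_sphere_measure_norm pt
      by (intro integral_mono_AE) (auto intro!: Bochner_Integration.integrable_diff
        integrable_norm integrable_scaleR_right
          integrable_ev_cvec elim!: eventually_mono)
    also have "\<dots> = t * (K * ?M * t)" by simp
    finally show ?thesis using t by simp
  qed
  have "norm (sphere_integral (angular i j p)) \<le> 0"
  proof (rule field_le_epsilon)
    fix e :: real assume e: "e > 0"
    have "K * ?M \<ge> 0" using K by simp
    have "norm (sphere_integral (angular i j p)) \<le> K * ?M * (e / (K * ?M + 1))"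
      using e \<open>K * ?M \<ge> 0\<close> by (intro bound) (simp add: add_nonneg_pos)
    also have "\<dots> \<le> e" using e \<open>K * ?M \<ge> 0\<close> by (simp add: field_simps)
    finally show "norm (sphere_integral (angular i j p)) \<le> 0 + e" by simp
  qed
  then show ?thesis by simp
qed

section \<open>Orthogonality of spherical harmonics\<close>

definition casimir :: "'a::comm_ring_1 tpoly \<Rightarrow> 'a tpoly" where
  "casimir p = angular 1 2 (angular 1 2 p) + angular 1 3 (angular 1 3 p) + angular 2 3
    (angular 2 3 p)"

text \<open>The Casimir operator is \<open>r\<^sup>2 \<Delta> - E\<^sup>2 - E\<close>, where \<open>E\<close> is the Euler operator.\<close>

lemma casimir_eq:
  fixes p :: "'a::field_char_0 tpoly"
  assumes "p \<in> hom d"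
  shows "casimir p = quad (mat 1) * lap (mat 1) p - of_nat (d * (d + 1)) * p"
proof -
  define E where "E p = (\<Sum>k\<in>UNIV. var k * der k p)" for p :: "'a tpoly"
  have E: "E p = of_nat d * p" unfolding E_def by (rule euler[OF assms])
  have cst_if: "cst (if b then 1 else 0) = (if b then 1 else (0 :: 'a tpoly))" for b by simp
  have 1: "lap (mat 1) p = der 1 (der 1 p) + der 2 (der 2 p) + der 3 (der 3 p)"
    by (simp add: lap_def sum_3 mat_def)
  have 2: "quad (mat 1) = var 1 * var 1 + var 2 * var 2 + (var 3 * var 3 :: 'a tpoly)"
    by (simp add: quad_def sum_3 mat_def)
  have "casimir p = quad (mat 1) * lap (mat 1) p - E (E p) - E p"
    unfolding 1 2 by (simp add: casimir_def angular_def E_def sum_3 der_mult der_var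
      der_commute[of 2 1] der_commute[of 3 1]
      der_commute[of 3 2] algebra_simps)
  moreover have "E (of_nat d * p) = of_nat d * E p"
    by (simp add: E_def sum_distrib_left mult.left_commute flip: cst_of_nat)
  ultimately show ?thesis by (simp add: E algebra_simps)
qed

lemma sphere_integral_angular_by_parts:
  assumes "i \<noteq> j"
  shows "sphere_integral (angular i j p * q) = - sphere_integral (p * angular i j q)"
proof -
  have "angular i j (p * q) = angular i j p * q + p * angular i j q"
    by (simp add: angular_def der_mult algebra_simps)
  then show ?thesis
    using sphere_integral_angular[OF assms, of "p * q"]
      by (simp add: sphere_integral_add eq_neg_iff_add_eq_0)
qed

lemma sphere_integral_casimir_symmetric:
  "sphere_integral (casimir p * q) = sphere_integral (p * casimir q)"
  by (simp add: casimir_def distrib_left distrib_right sphere_integral_add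
    sphere_integral_angular_by_parts)

lemma sphere_integral_harmonic_orthogonal:
  assumes "p \<in> hom a" "q \<in> hom b" "lap (mat 1) p = 0" "lap (mat 1) q = 0" "a \<noteq> b"
  shows "sphere_integral (p * q) = 0"
proof -
  have "casimir p * q = cst (- of_nat (a * (a + 1))) * (p * q)" "p * casimir q
    = cst (- of_nat (b * (b + 1))) * (p * q)"
    using assms by (simp_all add: casimir_eq cst_minus cst_of_nat mult_ac del: of_nat_mult
      of_nat_add of_nat_Suc)
  then have "- of_nat (a * (a + 1)) * sphere_integral (p * q)
    = - of_nat (b * (b + 1)) * sphere_integral (p * q)"
    using sphere_integral_casimir_symmetric[of p q] by (simp only: sphere_integral_cst_mult)
  then have "sphere_integral (p * q) = 0 \<or> a * (a + 1) = b * (b + 1)"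
    by (auto simp del: of_nat_mult of_nat_add of_nat_Suc)
  moreover have "a * (a + 1) \<noteq> b * (b + 1)"
  proof (cases "a < b")
    case True
    then have "a * (a + 1) < b * (b + 1)" by (intro mult_strict_mono) auto
    then show ?thesis by simp
  next
    case False
    then have "b * (b + 1) < a * (a + 1)" using assms(5) by (intro mult_strict_mono) auto
    then show ?thesis by simp
  qed
  ultimately show ?thesis by simp
qed

section \<open>The inner product on \<open>\<Upsilon>\<close>\<close>

lemma norm_cvec: "norm (cvec w) = norm w"
  by (simp add: norm_vec_def cvec_def L2_set_def)

lemma continuous_on_vector_matrix_mult [continuous_intros]:
  fixes A :: "'a::real_normed_field^3^3"
  assumes "continuous_on S f" shows "continuous_on S (\<lambda>v. f v v* A)"
  unfolding vector_matrix_mult_def by (intro continuous_intros assms)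

lemma continuous_on_cvec [continuous_intros]:
  assumes "continuous_on S f" shows "continuous_on S (\<lambda>x. cvec (f x))"
  unfolding cvec_def by (intro continuous_intros assms)

lemma closed_Upsilon: "closed (Upsilon A)"
proof -
  have "re_part (cvec w) = w" for w
    by (simp add: re_part_def cvec_def vec_eq_iff)
  then have "(\<exists>w. u = cvec w) \<longleftrightarrow> u = cvec (re_part u)" for u
    by metis
  then have "Upsilon A = {v. v v* A = cvec (re_part (v v* A))} \<inter> {v. norm (v v* A) = 1}"
    by (auto simp: Upsilon_def)
  moreover have "closed {v. v v* A = cvec (re_part (v v* A))}"
    unfolding re_part_def by (intro closed_Collect_eq continuous_intros)
  moreover have "closed {v. norm (v v* A) = 1}"
    by (intro closed_Collect_eq continuous_intros)
  ultimately show ?thesis by (simp add: closed_Int)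
qed

lemma vector_matrix_mult_assoc: "(v v* A) v* B = v v* (A ** B)" for v :: "'a::comm_semiring_1^3"
  by (simp add: vector_matrix_mul_assoc)

lemma Upsilon_inner_eq:
  assumes A: "invertible A"
  shows "Upsilon_inner A f g =
    Re (\<integral>w. ceval f (cvec w v* matrix_inv A) * cnj (ceval g
      (cvec w v* matrix_inv A)) \<partial>sphere_measure)"
proof -
  let ?T = "\<lambda>w. cvec w v* matrix_inv A"
  let ?F = "\<lambda>v. ceval f v * cnj (ceval g v)"
  have "continuous_on UNIV ?T" by (intro continuous_intros)
  then have T [measurable]: "?T \<in> borel_measurable borel" by (rule borel_measurable_continuous_onI)
  have "continuous_on UNIV ?F" unfolding ceval_eq_ev by (intro continuous_intros)
  then have F [measurable]: "?F \<in> borel_measurable borel" by (rule borel_measurable_continuous_onI)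
  have U [measurable]: "Upsilon A \<in> sets borel" using closed_Upsilon by simp
  have "set_lebesgue_integral (Upsilon_measure A) (Upsilon A) ?F
    = (\<integral>w. indicator (Upsilon A) (?T w) *\<^sub>R ?F (?T w) \<partial>sphere_measure)"
    unfolding set_lebesgue_integral_def Upsilon_measure_def by (rule integral_distr) measurable
  also have "\<dots> = (\<integral>w. ?F (?T w) \<partial>sphere_measure)"
  proof (rule integral_cong_AE)
    show "AE w in sphere_measure. indicator (Upsilon A) (?T w) *\<^sub>R ?F (?T w) = ?F (?T w)"
      using AE_sphere_measure_norm
    proof eventually_elim
      case (elim w)
      have "?T w v* A = cvec w" using A by (simp add: vector_matrix_mult_assoc matrix_inv_inverse)
      then have "?T w \<in> Upsilon A" using elim by (auto simp: Upsilon_def norm_cvec)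
      then show ?case by simp
    qed
  qed measurable
  finally show ?thesis by (simp add: Upsilon_inner_def)
qed

lemma cnj_ev_complexify: "cnj (ev (complexify p) v) = ev (complexify p) (\<chi> i. cnj (v $ i))"
  by (induction p rule: tpoly_induct) simp_all

lemma quad_mat_1_cvec: "ev (quad (mat 1)) (cvec w) = of_real ((norm w)\<^sup>2)"
  by (simp add: ev_quad sum_3 mat_def cvec_def power2_norm_eq_inner inner_vec_def)

text \<open>Pulled back to the sphere, \<open>Q\<close> becomes \<open>1\<close> and the harmonic factors become harmonic for the
  standard Laplacian. Conjugation is absorbed into the substitution: for a real polynomial it
  amounts to the use of the conjugate matrix, which also satisfies \<open>A\<^sup>-\<^sup>T A\<^sup>-\<^sup>1 = B\<^sup>-\<^sup>1\<close> because
  \<open>B\<close> is real.\<close>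

lemma Upsilon_inner_har_summand:
  fixes B :: "real^3^3" and A :: "complex^3^3"
  assumes sym: "transpose B = B" and inv: "invertible B"
    and A: "invertible A" "cmat B = A ** transpose A"
    and k: "2 * k \<le> d" and l: "2 * l \<le> d" and "k \<noteq> l"
    and h: "h \<in> hom (d - 2 * k)" "lap (matrix_inv B) h = 0"
    and h': "h' \<in> hom (d - 2 * l)" "lap (matrix_inv B) h' = 0"
  shows "Upsilon_inner A (quad B ^ k * h) (quad B ^ l * h') = 0"
proof -
  let ?B = "cmat B" and ?C = "map_matrix complex_of_real (matrix_inv B)"
  let ?A = "matrix_inv A" and ?A' = "map_matrix cnj (matrix_inv A)"
  have BC: "?B ** ?C = mat 1"
    by (simp add: matrix_inv_inverse inv map_matrix_mat_1 flip: map_matrix_mult)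
  have AA: "A ** ?A = mat 1" "?A ** A = mat 1" using A(1) by (simp_all add: matrix_inv_inverse)
  have tA: "transpose A ** transpose ?A = mat 1" "transpose ?A ** transpose A = mat 1"
    by (simp_all add: AA transpose_mat flip: matrix_transpose_mul)
  have "(transpose ?A ** ?A) ** ?B = transpose ?A ** (?A ** A) ** transpose A"
    by (simp add: A(2) matrix_mul_assoc)
  then have inverse_B: "(transpose ?A ** ?A) ** ?B = mat 1" by (simp add: AA tA)
  have "transpose ?A ** ?A = (transpose ?A ** ?A) ** (?B ** ?C)" by (simp add: BC)
  also have "\<dots> = ?C" by (simp add: matrix_mul_assoc inverse_B)
  finally have C: "transpose ?A ** ?A = ?C" .
  have C': "transpose ?A' ** ?A' = ?C"
  proof -
    have "transpose ?A' ** ?A' = map_matrix cnj (transpose ?A ** ?A)"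
      by (simp add: vec_eq_iff matrix_matrix_mult_def transpose_def)
    then show ?thesis by (simp add: C vec_eq_iff)
  qed
  have Q: "lin_subst ?A (complexify (quad B)) = quad (mat 1)"
  proof -
    have "?A ** ?B ** transpose ?A = (?A ** A) ** (transpose A ** transpose ?A)"
      by (simp add: A(2) matrix_mul_assoc)
    then show ?thesis by (simp add: complexify_quad lin_subst_quad AA tA)
  qed
  define p where "p = lin_subst ?A (complexify h)"
  \<comment> \<open>the factor that is conjugated in the inner product\<close>
  define q where "q = lin_subst ?A' (complexify h')"
  have p: "p \<in> hom (d - 2 * k)" "lap (mat 1) p = 0"
    using h by (simp_all add: p_def hom_lin_subst hom_complexify lap_lin_subst C flip:
      complexify_lap)
  have q: "q \<in> hom (d - 2 * l)" "lap (mat 1) q = 0"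
    using h' by (simp_all add: q_def hom_lin_subst hom_complexify lap_lin_subst C' flip:
      complexify_lap)
  have Q1: "ev (complexify (quad B)) (cvec w v* ?A) = 1" if "norm w = 1" for w
    using that by (simp add: Q quad_mat_1_cvec flip: ev_lin_subst)
  have conj: "(\<chi> i. cnj ((cvec w v* ?A) $ i)) = cvec w v* ?A'" for w
    by (simp add: vec_eq_iff vector_matrix_mult_def cvec_def)
  have "AE w in sphere_measure. ceval (quad B ^ k * h) (cvec w v* ?A) * cnj (ceval (quad B ^ l
    * h') (cvec w v* ?A))
    = ev (p * q) (cvec w)"
    using AE_sphere_measure_norm
  proof eventually_elim
    case (elim w)
    have "ceval (quad B ^ k * h) (cvec w v* ?A) = ev p (cvec w)"
      by (simp add: ceval_eq_ev Q1[OF elim] p_def ev_lin_subst)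
    moreover have "cnj (ceval (quad B ^ l * h') (cvec w v* ?A)) = ev q (cvec w)"
    proof -
      have "ceval (quad B ^ l * h') (cvec w v* ?A) = ev (complexify h') (cvec w v* ?A)"
        by (simp add: ceval_eq_ev Q1[OF elim])
      then show ?thesis by (simp add: cnj_ev_complexify conj q_def ev_lin_subst)
    qed
    ultimately show ?case by simp
  qed
  then have "(\<integral>w. ceval (quad B ^ k * h) (cvec w v* ?A) * cnj (ceval (quad B ^ l * h')
    (cvec w v* ?A)) \<partial>sphere_measure)
    = sphere_integral (p * q)"
    unfolding sphere_integral_def
  proof (intro integral_cong_AE)
    have "continuous_on UNIV (\<lambda>w. ceval (quad B ^ k * h) (cvec w v* ?A) * cnj (ceval (quad B ^ l
      * h') (cvec w v* ?A)))"
      unfolding ceval_eq_ev by (intro continuous_intros)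
    then show "(\<lambda>w. ceval (quad B ^ k * h) (cvec w v* ?A) * cnj (ceval (quad B ^ l * h')
      (cvec w v* ?A)))
      \<in> borel_measurable sphere_measure"
      using borel_measurable_continuous_onI
        by (simp add: measurable_cong_sets[OF sets_sphere_measure refl])
  qed measurable
  also have "\<dots> = 0"
    by (rule sphere_integral_harmonic_orthogonal[OF p(1) q(1) p(2) q(2)])
      (use k l \<open>k \<noteq> l\<close> in linarith)
  finally show ?thesis by (simp add: Upsilon_inner_eq[OF A(1)])
qed

section \<open>Invariance under the orthogonal group\<close>

lemma real_matrix_eq_if_quad_eq:
  fixes M N :: "real^3^3"
  assumes M: "transpose M = M" and N: "transpose N = N" and eq: "\<And>v. ev (quad M) v = ev (quad N) v"
  shows "M = N"
proof -
  have "u \<bullet> (M *v v) = u \<bullet> (N *v v)" for u v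
    using eq[of "u + 1 *\<^sub>R v"] eq[of u] eq[of v]
    unfolding quad_add_scale[OF M] quad_add_scale[OF N] by simp
  then have "M *v v = N *v v" for v by (metis vector_eq_ldot)
  then show ?thesis by (simp add: matrix_eq)
qed

text \<open>A real polynomial is determined by its values, so that preserving the values of \<open>Q\<close> gives
  \<open>g B g\<^sup>T = B\<close>, and by inversion \<open>g\<^sup>T B\<^sup>-\<^sup>1 g = B\<^sup>-\<^sup>1\<close>: the Laplacian commutes with the
  substitution.\<close>

lemma orth_group_preserves_har_summand:
  fixes B :: "real^3^3"
  assumes sym: "transpose B = B" and inv: "invertible B" and g: "g \<in> orth_group B"
    and h: "h \<in> hom m" "lap (matrix_inv B) h = 0"
  shows "lin_subst g (quad B ^ k * h) = quad B ^ k * lin_subst g h"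
    "lin_subst g h \<in> hom m" "lap (matrix_inv B) (lin_subst g h) = 0"
proof -
  interpret nondeg_form B "matrix_inv B"
    by (rule nondeg_form_matrix_inv[OF sym inv])
  have gi: "invertible g" and gQ: "ev (quad B) (v v* g) = ev (quad B) v" for v
    using g by (auto simp: orth_group_def reval_eq_ev Qpoly_eq_quad)
  have "lin_subst g (quad B) - quad B = 0"
    by (rule ev_zero_imp_zero) (simp add: ev_lin_subst gQ)
  then have Q: "lin_subst g (quad B) = quad B" by simp
  then show "lin_subst g (quad B ^ k * h) = quad B ^ k * lin_subst g h" by simp
  show "lin_subst g h \<in> hom m" by (rule hom_lin_subst[OF h(1)])
  have gB: "g ** B ** transpose g = B"
    by (rule real_matrix_eq_if_quad_eq)
      (simp_all add: matrix_transpose_mul sym matrix_mul_assoc Q flip: lin_subst_quad)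
  let ?C = "matrix_inv B" and ?t = "transpose g"
  have ti: "?t ** matrix_inv ?t = mat 1"
  proof (rule matrix_inv_inverse)
    show "invertible ?t"
      using gi by (simp add: transpose_invertible)
  qed
  have "(?t ** ?C ** g) ** B = (?t ** ?C ** g) ** B ** (?t ** matrix_inv ?t)" by (simp add: ti)
  also have "\<dots> = ?t ** (?C ** (g ** B ** ?t)) ** matrix_inv ?t" by (simp add: matrix_mul_assoc)
  also have "\<dots> = mat 1" by (simp add: gB CB ti)
  finally have left_inverse: "(?t ** ?C ** g) ** B = mat 1" .
  have "?t ** ?C ** g = (?t ** ?C ** g) ** (B ** ?C)" by (simp add: BC)
  also have "\<dots> = ((?t ** ?C ** g) ** B) ** ?C" by (simp only: matrix_mul_assoc)
  also have "\<dots> = ?C" by (simp only: left_inverse matrix_mul_lid)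
  finally have "?t ** ?C ** g = ?C" .
  then show "lap ?C (lin_subst g h) = 0" by (simp add: lap_lin_subst h(2))
qed

section \<open>The direct sum decomposition\<close>

lemma har_summand_eq:
  "har_summand B d k = {quad B ^ k * h |h. h \<in> hom (d - 2 * k) \<and> lap (matrix_inv B) h = 0}"
  by (auto simp: har_summand_def Har_def homog_eq_hom Laplace_eq_lap Qpoly_eq_quad)

lemma subspace_homog: "rpoly.subspace (homog d)"
  by (rule rpoly.subspaceI) (simp_all add: homog_eq_hom Const_eq_cst hom_add hom_cst_mult)

lemma subspace_har_summand: "rpoly.subspace (har_summand B d k)"
proof (rule rpoly.subspaceI)
  show "0 \<in> har_summand B d k"
    unfolding har_summand_eq by (intro CollectI exI[of _ 0]) simp
next
  fix p q assume "p \<in> har_summand B d k" "q \<in> har_summand B d k"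
  then obtain h h' where "p = quad B ^ k * h" "h \<in> hom (d - 2 * k)" "lap (matrix_inv B) h = 0"
    "q = quad B ^ k * h'" "h' \<in> hom (d - 2 * k)" "lap (matrix_inv B) h' = 0"
      by (auto simp: har_summand_eq)
  then show "p + q \<in> har_summand B d k"
    unfolding har_summand_eq by (intro CollectI exI[of _ "h + h'"]) (simp add: distrib_left hom_add)
next
  fix c p assume "p \<in> har_summand B d k"
  then obtain h where "p = quad B ^ k * h" "h \<in> hom (d - 2 * k)" "lap (matrix_inv B) h = 0"
    by (auto simp: har_summand_eq)
  then show "Const c * p \<in> har_summand B d k"
    unfolding har_summand_eq Const_eq_cst
    by (intro CollectI exI[of _ "cst c * h"]) (simp add: mult.left_commute hom_cst_mult)
qed

lemma internal_direct_sum_har_summand: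
  fixes B :: "real^3^3"
  assumes sym: "transpose B = B" and inv: "invertible B"
  shows "internal_direct_sum (homog d) {k. 2 * k \<le> d} (har_summand B d)"
proof -
  interpret nondeg_form B "matrix_inv B"
    by (rule nondeg_form_matrix_inv[OF sym inv])
  have sub: "har_summand B d k \<subseteq> homog d" if "2 * k \<le> d" for k
  proof
    fix p assume "p \<in> har_summand B d k"
    then obtain h where "p = quad B ^ k * h" "h \<in> hom (d - 2 * k)" by (auto simp: har_summand_eq)
    then show "p \<in> homog d"
      using hom_mult[OF hom_power[OF hom_quad, of B k]] that by (fastforce simp: homog_eq_hom)
  qed
  have "\<exists>!f. f \<in> (\<Pi>\<^sub>E k\<in>{k. 2 * k \<le> d}. har_summand B d k) \<and> p = (\<Sum>k | 2 * k \<le> d. f k)"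
    if p: "p \<in> homog d" for p
  proof -
    obtain g where g: "\<And>k. k \<le> d div 2 \<Longrightarrow> g k \<in> hom (d - 2 * k) \<and> lap (matrix_inv B) (g k) = 0"
      "p = (\<Sum>k\<le>d div 2. quad B ^ k * g k)"
      using harmonic_decomposition_exists p unfolding homog_eq_hom by blast
    let ?f = "\<lambda>k\<in>{k. 2 * k \<le> d}. quad B ^ k * g k"
    show ?thesis
    proof (rule ex1I[of _ ?f], intro conjI)
      show "?f \<in> (\<Pi>\<^sub>E k\<in>{k. 2 * k \<le> d}. har_summand B d k)"
        using g(1) by (auto simp: har_summand_eq)
      show "p = (\<Sum>k | 2 * k \<le> d. ?f k)"
        unfolding g(2) double_le_set[symmetric] by (intro sum.cong) auto
    next
      fix f assume f: "f \<in> (\<Pi>\<^sub>E k\<in>{k. 2 * k \<le> d}. har_summand B d k) \<and> p = (\<Sum>k | 2 * k \<le> d. f k)"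
      then have "\<forall>k. \<exists>h. 2 * k \<le> d \<longrightarrow> f k = quad B ^ k * h \<and> lap (matrix_inv B) h = 0"
        by (fastforce simp: har_summand_eq PiE_iff)
      then obtain h where h: "\<And>k. 2 * k \<le> d \<Longrightarrow> f k = quad B ^ k * h k \<and> lap (matrix_inv B) (h k) = 0"
        by metis
      have "p = (\<Sum>k\<le>d div 2. quad B ^ k * h k)"
        using f h by (auto simp flip: double_le_set intro!: sum.cong)
      then have z: "(\<Sum>k\<le>d div 2. quad B ^ k * (h k - g k)) = 0"
        by (simp add: right_diff_distrib sum_subtractf flip: g(2))
      have "h k = g k" if "2 * k \<le> d" for k
      proof -
        have "h k - g k = 0"
          by (rule harmonic_decomposition_unique[OF _ z]) (use h g(1) that in auto)
        then show ?thesis by simp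
      qed
      then have in_range: "f k = quad B ^ k * g k" if "2 * k \<le> d" for k
        using h[OF that] that by simp
      have outside: "f k = undefined" if "\<not> 2 * k \<le> d" for k
        by (rule PiE_arb[OF conjunct1[OF f]]) (use that in simp)
      show "f = ?f"
      proof
        fix k
        show "f k = ?f k"
        proof (cases "2 * k \<le> d")
          case True
          then show ?thesis by (simp only: in_range restrict_apply mem_Collect_eq if_True)
        next
          case False
          then show ?thesis by (simp only: outside[OF False] restrict_apply mem_Collect_eq if_False)
        qed
      qed
    qed
  qed
  then show ?thesis
    unfolding internal_direct_sum_def
    by (intro conjI ballI subspace_homog subspace_har_summand sub) simp_all
qed

section \<open>Harmonic decomposition, Dirichlet problem and Maxwell representation\<close>

theorem theorem17:
  fixes B :: "real^3^3"
  assumes "transpose B = B" and "invertible B"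
  shows
    "(\<forall>d. internal_direct_sum (homog d) {k. 2 * k \<le> d} (har_summand B d) \<and>
          (\<forall>g\<in>orth_group B. \<forall>k. 2 * k \<le> d \<longrightarrow>
             psubst g ` har_summand B d k \<subseteq> har_summand B d k) \<and>
          (\<forall>A :: complex^3^3. invertible A \<and> map_matrix of_real B = A ** transpose A \<longrightarrow>
             (\<forall>k l. 2 * k \<le> d \<and> 2 * l \<le> d \<and> k \<noteq> l \<longrightarrow>
               (\<forall>f\<in>har_summand B d k. \<forall>g\<in>har_summand B d l. Upsilon_inner A f g = 0))))
     \<and>
     (\<forall>c. two_dimensional (level_set B c) \<longrightarrow>
       (\<forall>F. \<exists>P. Laplace B P = 0 \<and> (\<forall>v\<in>level_set B c. reval P v = reval F v)))
     \<and>
     (\<forall>c. two_dimensional (level_set B c) \<longrightarrow>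
       (\<forall>M N. \<exists>!P. Laplace B P = M \<and> (\<forall>v\<in>level_set B c. reval P v = reval N v)))
     \<and>
     (\<forall>d. \<forall>P\<in>homog d.
       (\<exists>u \<mu>. maxwell_rep B d P u \<mu>) \<and>
       (pos_definite B \<longrightarrow>
         (\<exists>(u :: nat \<Rightarrow> nat \<Rightarrow> real^3) (\<mu> :: real).
            maxwell_rep B d P (\<lambda>k j. cvec (u k j)) (of_real \<mu>)) \<and>
         (\<forall>(u :: nat \<Rightarrow> nat \<Rightarrow> real^3) (\<mu> :: real) u' (\<mu>' :: real).
            maxwell_rep B d P (\<lambda>k j. cvec (u k j)) (of_real \<mu>) \<and>
            maxwell_rep B d P (\<lambda>k j. cvec (u' k j)) (of_real \<mu>') \<longrightarrow>
            (\<forall>k. 2 * k < d \<longrightarrow> same_directions (d - 2 * k) (u k) (u' k)) \<and>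
            (even d \<longrightarrow> \<mu> = \<mu>'))))"
proof -
  note sym = assms(1) and inv = assms(2)
  have dirichlet: "\<exists>!P. Laplace B P = M \<and> (\<forall>v\<in>level_set B c. reval P v = reval N v)"
    if two: "two_dimensional (level_set B c)" for c M N
  proof -
    obtain v0 where "v0 \<in> level_set B c" "v0 \<noteq> 0" using two_dimensional_nonzero_point[OF two] .
    then have "v0 \<noteq> 0" "ev (quad B) v0 = c" by (simp_all add: level_set_def reval_eq_ev Qpoly_eq_quad)
    from dirichlet_unique_solution[OF sym inv this, of M N] show ?thesis
      by (simp add: Laplace_eq_lap level_set_def reval_eq_ev Qpoly_eq_quad)
  qed
  have inv_sum: "psubst g ` har_summand B d k \<subseteq> har_summand B d k" if "g \<in> orth_group B" for g d k
  proof
    fix p assume "p \<in> psubst g ` har_summand B d k"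
    then obtain h where h: "h \<in> hom (d - 2 * k)" "lap (matrix_inv B) h = 0" "p = lin_subst g (quad B ^ k * h)"
      by (auto simp: har_summand_eq psubst_eq_lin_subst)
    show "p \<in> har_summand B d k"
      unfolding h(3) har_summand_eq orth_group_preserves_har_summand(1)[OF sym inv that h(1,2)]
      using orth_group_preserves_har_summand(2,3)[OF sym inv that h(1,2)] by blast
  qed
  have orth: "Upsilon_inner A f g = 0"
    if "invertible A" "map_matrix of_real B = A ** transpose A" "2 * k \<le> d" "2 * l \<le> d" "k \<noteq> l"
      "f \<in> har_summand B d k" "g \<in> har_summand B d l" for A d k l f g
    using that Upsilon_inner_har_summand[OF sym inv that(1-5)] by (auto simp: har_summand_eq)
  have pos: "pos_def_form B" if "pos_definite B"
    using that sym by unfold_locales (auto simp: pos_definite_def reval_eq_ev Qpoly_eq_quad ev_quad_inner)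
  show ?thesis
  proof (intro conjI allI impI ballI)
    show "internal_direct_sum (homog d) {k. 2 * k \<le> d} (har_summand B d)" for d
      by (rule internal_direct_sum_har_summand[OF sym inv])
    show "psubst g ` har_summand B d k \<subseteq> har_summand B d k" if "g \<in> orth_group B" for g d k
      by (rule inv_sum[OF that])
    show "Upsilon_inner A f g = 0"
      if "invertible A \<and> map_matrix of_real B = A ** transpose A" "2 * k \<le> d \<and> 2 * l \<le> d \<and> k \<noteq> l"
      "f \<in> har_summand B d k" "g \<in> har_summand B d l" for A d k l f g
      using that orth by blast
    show "\<exists>P. Laplace B P = 0 \<and> (\<forall>v\<in>level_set B c. reval P v = reval F v)"
      if "two_dimensional (level_set B c)" for c F
      using dirichlet[OF that, of 0 F] by blast
    show "\<exists>!P. Laplace B P = M \<and> (\<forall>v\<in>level_set B c. reval P v = reval N v)"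
      if "two_dimensional (level_set B c)" for c M N
      by (rule dirichlet[OF that])
    show "\<exists>u \<mu>. maxwell_rep B d P u \<mu>" if "P \<in> homog d" for d P
      using maxwell_rep_exists[OF sym inv] that by (simp add: homog_eq_hom)
    show "\<exists>(u :: nat \<Rightarrow> nat \<Rightarrow> real^3) (\<mu> :: real). maxwell_rep B d P (\<lambda>k j. cvec (u k j)) (of_real \<mu>)"
      if "P \<in> homog d" "pos_definite B" for d P
      using pos_def_form.real_maxwell_rep_exists[OF pos] that by (simp add: homog_eq_hom)
    show "same_directions (d - 2 * k) (u k) (u' k)"
      if "pos_definite B" "maxwell_rep B d P (\<lambda>k j. cvec (u k j)) (of_real \<mu>) \<and>
        maxwell_rep B d P (\<lambda>k j. cvec (u' k j)) (of_real \<mu>')" "2 * k < d"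
      for d P k and u u' :: "nat \<Rightarrow> nat \<Rightarrow> real^3" and \<mu> \<mu>' :: real
      using pos_def_form.real_maxwell_rep_unique[OF pos] that by blast
    show "\<mu> = \<mu>'"
      if "pos_definite B" "maxwell_rep B d P (\<lambda>k j. cvec (u k j)) (of_real \<mu>) \<and>
        maxwell_rep B d P (\<lambda>k j. cvec (u' k j)) (of_real \<mu>')" "even d"
      for d P and u u' :: "nat \<Rightarrow> nat \<Rightarrow> real^3" and \<mu> \<mu>' :: real
      using pos_def_form.real_maxwell_rep_unique[OF pos] that by blast
  qed
qed

end
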